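(* Let $\mathcal H=\mathcal H(\mathbf U,v_x)$ be smooth, let $\mathbf B\in\mathbb R^{N\times N}$ be symmetric and nonsingular, let $\Omega\subset\mathbb R^{N+2}$ be open, and suppose there is a smooth mapping $(\mu,\boldsymbol\lambda,c)\in\Omega\mapsto(\underline{\mathbf U},\Xi)$ such that, for every $(\mu,\boldsymbol\lambda,c)\in\Omega$, $\underline{\mathbf U}$ is a $\Xi$-periodic solution of the profile equations $$\mathsf E(\mathcal H+c\mathcal Q)[\underline{\mathbf U}]+\boldsymbol\lambda=0,\qquad \mathsf L\mathcal L[\underline{\mathbf U}]=\mu,$$ with $\underline{\mathbf U}(0)=\underline{\mathbf U}(\Xi)$ and $\underline v_x(0)=\underline v_x(\Xi)=0$. Let $$\Theta(\mu,\boldsymbol\lambda,c):=\int_0^{\Xi}\big(\mathcal H(\underline{\mathbf U},\underline v_x)+c\,\mathcal Q(\underline{\mathbf U})+\boldsymbol\lambda\cdot\underline{\mathbf U}+\mu\big)\,dx .$$ Assume moreover that $\Xi_\mu:=\partial\Xi/\partial\mu\neq0$ and that the $(N+1)\times(N+1)$ matrix $$\mathbf C:=\check\nabla^2\Theta-\frac{\check\nabla\Xi\otimes\check\nabla\Xi}{\Xi_\mu}$$ takes nonsingular values, where $\check\nabla$ denotes the gradient (and $\check\nabla^2$ the Hessian) with respect to $(\boldsymbol\lambda,c)$ at fixed $\mu$. Then, denoting $\mathscr A:=\mathsf{Hess}(\mathcal H+c\mathcal Q)[\underline{\mathbf U}]$, we have $$\mathsf n(\mathscr A)=\mathsf n\big(\mathscr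 A_{|T_{\underline{\mathbf U}}\mathscr C}\big)+\mathsf n(-\mathbf C).$$
   Context: The unknown $\mathbf U=(v,\mathbf u)$ takes values in $\mathbb R^N$ ($N\ge1$), $v$ being its first component and $\mathbf u\in\mathbb R^{N-1}$ the remaining ones; $\mathcal H=\mathcal H(\mathbf U,v_x)$ depends on derivatives of $\mathbf U$ only through $v_x$. Parameters are $\mu\in\mathbb R$, $\boldsymbol\lambda\in\mathbb R^N$, $c\in\mathbb R$. A subscript $\mu$, $\lambda_\alpha$ or $c$ denotes the corresponding partial derivative. Impulse: $\mathcal Q(\mathbf U):=\tfrac12\,\mathbf U\cdot\mathbf B^{-1}\mathbf U$. Lagrangian: $\mathcal L(\mathbf U,v_x;c,\boldsymbol\lambda):=\mathcal H(\mathbf U,v_x)+c\,\mathcal Q(\mathbf U)+\boldsymbol\lambda\cdot\mathbf U$. Variational derivative: for $\mathcal F=\mathcal F(\mathbf U,\mathbf U_x)$, $(\mathsf E\mathcal F[\mathbf U])_\alpha:=\frac{\partial\mathcal F}{\partial U_\alpha}(\mathbf U,\mathbf U_x)-\frac{d}{dx}\Big(\frac{\partial\mathcal F}{\partial U_{\alpha,x}}(\mathbf U,\mathbf U_x)\Big)$, $\alpha=1,\dots,N$, where $\frac{d}{dx}$ is the total derivative. "Legendre transform" (in the original variables): $\mathsf L\mathcal F[\mathbf U]:=\sum_\alpha U_{\alpha,x}\frac{\partial\mathcal F}{\partial U_{\alpha,x}}(\mathbf U,\mathbf U_x)-\mathcal F(\mathbf U,\mathbf U_x)$. Smoothness of $(\mu,\boldsymbol\lambda,c)\mapsto(\underline{\mathbf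 U},\Xi)$ means that $\Xi>0$ depends smoothly on the parameters and $\underline{\mathbf U}$ depends smoothly on $x$ and the parameters. $\underline v$ is the first component of $\underline{\mathbf U}$. The operator $\mathscr A=\mathsf{Hess}(\mathcal H+c\mathcal Q)[\underline{\mathbf U}]$ is the second variational derivative, i.e. the linear differential operator $\mathscr A\mathbf V:=\frac{d}{d\theta}\big|_{\theta=0}\mathsf E(\mathcal H+c\mathcal Q)[\underline{\mathbf U}+\theta\mathbf V]$, symmetric for the $L^2(\mathbb R/\Xi\mathbb Z;\mathbb R^N)$ inner product. With $\mathbb H^s:=H^s(\mathbb R/\Xi\mathbb Z)\times(L^2(\mathbb R/\Xi\mathbb Z))^{N-1}$, it is considered as an operator on $\mathbb H^0=(L^2(\mathbb R/\Xi\mathbb Z))^N$ with domain $\mathbb H^2$. The constraint manifold is $\mathscr C=\{\mathbf U\in\mathbb H^0:\int_0^\Xi\mathcal Q(\mathbf U)\,dx=\int_0^\Xi\mathcal Q(\underline{\mathbf U})\,dx,\ \int_0^\Xi\mathbf U\,dx=\int_0^\Xi\underline{\mathbf U}\,dx\}$, and its tangent space at $\underline{\mathbf U}$ is $$T_{\underline{\mathbf U}}\mathscr C=\Big\{\mathbf U\in\mathbb H^0:\ \int_0^\Xi\mathbf U\cdot\nabla_{\mathbf U}\mathcal Q(\underline{\mathbf U})\,dx=0,\ \int_0^\Xi\mathbf U\,dx=0\Big\},\qquad \nabla_{\mathbf U}\mathcal Q(\underline{\mathbf U})=\mathbf B^{-1}\underline{\mathbf U}.$$ $\mathsf n(\cdot)$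 denotes negative signature: $\mathsf n(\mathscr A)$ is the maximal dimension of a subspace of $\mathbb H^2$ on which $\mathbf V\mapsto\langle\mathbf V\cdot\mathscr A\mathbf V\rangle_{L^2(\mathbb R/\Xi\mathbb Z)}$ is negative definite; $\mathsf n(\mathscr A_{|T_{\underline{\mathbf U}}\mathscr C})$ is the same with subspaces of $\mathbb H^2\cap T_{\underline{\mathbf U}}\mathscr C$; for a real symmetric matrix, $\mathsf n$ is the number of negative eigenvalues counted with multiplicity. *)

theory Defs
  imports
    "HOL-Analysis.Analysis"
    "HOL-Library.Extended_Nat"
    "HOL-Library.Function_Algebras"
begin

primrec higher_differentiable_on ::
  "'a::real_normed_vector set \<Rightarrow> ('a \<Rightarrow> 'b::real_normed_vector) \<Rightarrow> nat \<Rightarrow> bool" where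
  "higher_differentiable_on S f 0 \<longleftrightarrow> continuous_on S f"
| "higher_differentiable_on S f (Suc n) \<longleftrightarrow>
     (\<forall>x\<in>S. f differentiable (at x)) \<and>
     (\<forall>v. higher_differentiable_on S (\<lambda>x. frechet_derivative f (at x) v) n)"

text \<open>Only used on open sets.\<close>
definition smooth_on ::
  "'a::real_normed_vector set \<Rightarrow> ('a \<Rightarrow> 'b::real_normed_vector) \<Rightarrow> bool" where
  "smooth_on S f \<longleftrightarrow> (\<forall>n. higher_differentiable_on S f n)"

text \<open>
  A density \<open>F(U, U_x)\<close> is a function of two vector arguments; \<open>partial_1\<close> and \<open>partial_2\<close> are its
  partial derivatives with respect to the components of the first and of the second one.
\<close>
definition partial_1 :: "('n::finite) \<Rightarrow> (real^'n \<Rightarrow> real^'n \<Rightarrow> real) \<Rightarrow> real^'n \<Rightarrow> real^'n \<Rightarrow> real" where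
  "partial_1 \<alpha> F a b = deriv (\<lambda>t. F (a + t *\<^sub>R axis \<alpha> 1) b) 0"

definition partial_2 :: "('n::finite) \<Rightarrow> (real^'n \<Rightarrow> real^'n \<Rightarrow> real) \<Rightarrow> real^'n \<Rightarrow> real^'n \<Rightarrow> real" where
  "partial_2 \<alpha> F a b = deriv (\<lambda>t. F a (b + t *\<^sub>R axis \<alpha> 1)) 0"

definition ddx :: "(real \<Rightarrow> 'a::real_normed_vector) \<Rightarrow> real \<Rightarrow> 'a" where
  "ddx f x = vector_derivative f (at x)"

definition var_deriv ::
  "(real^'n::finite \<Rightarrow> real^'n \<Rightarrow> real) \<Rightarrow> (real \<Rightarrow> real^'n) \<Rightarrow> real \<Rightarrow> real^'n" where
  "var_deriv F U x = (\<chi> \<alpha>. partial_1 \<alpha> F (U x) (ddx U x)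
     - ddx (\<lambda>y. partial_2 \<alpha> F (U y) (ddx U y)) x)"

definition legendre ::
  "(real^'n::finite \<Rightarrow> real^'n \<Rightarrow> real) \<Rightarrow> (real \<Rightarrow> real^'n) \<Rightarrow> real \<Rightarrow> real" where
  "legendre F U x = (\<Sum>\<alpha>\<in>UNIV. ddx U x $ \<alpha> * partial_2 \<alpha> F (U x) (ddx U x)) - F (U x) (ddx U x)"

text \<open>The second variational derivative at \<open>U\<close>, acting on smooth \<open>V\<close>.\<close>
definition Hess ::
  "(real^'n::finite \<Rightarrow> real^'n \<Rightarrow> real) \<Rightarrow> (real \<Rightarrow> real^'n) \<Rightarrow> (real \<Rightarrow> real^'n) \<Rightarrow> real \<Rightarrow> real^'n" where
  "Hess F U V x = vector_derivative (\<lambda>\<theta>. var_deriv F (\<lambda>y. U y + \<theta> *\<^sub>R V y) x) (at 0)"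

definition impulse :: "real^'n^'n \<Rightarrow> real^'n::finite \<Rightarrow> real" where
  "impulse B a = (1/2) * (a \<bullet> (matrix_inv B *v a))"

text \<open>
  The component of \<open>U\<close> singled out as \<open>v\<close> has an arbitrary index \<open>k\<close>. The Hamiltonian is a function
  \<open>H U v_x\<close>, so that as a density it sees only the component \<open>k\<close> of \<open>U_x\<close>.
\<close>
definition HcQ ::
  "'n::finite \<Rightarrow> (real^'n \<Rightarrow> real \<Rightarrow> real) \<Rightarrow> real^'n^'n \<Rightarrow> real \<Rightarrow> real^'n \<Rightarrow> real^'n \<Rightarrow> real" where
  "HcQ k H B c a b = H a (b $ k) + c * impulse B a"

definition lagrangian ::
  "'n::finite \<Rightarrow> (real^'n \<Rightarrow> real \<Rightarrow> real) \<Rightarrow> real^'n^'n \<Rightarrow> real \<Rightarrow> real^'n \<Rightarrow> real^'n \<Rightarrow> real^'n \<Rightarrow> real" where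
  "lagrangian k H B c lam a b = H a (b $ k) + c * impulse B a + lam \<bullet> a"

text \<open>Parameter triples are \<open>(\<mu>, lam, c)\<close>.\<close>
type_synonym 'n param = "real \<times> (real^'n) \<times> real"

definition pderiv_along :: "'n::finite param \<Rightarrow> ('n param \<Rightarrow> real) \<Rightarrow> 'n param \<Rightarrow> real" where
  "pderiv_along d f p = deriv (\<lambda>t. f (p + t *\<^sub>R d)) 0"

definition dir_mu :: "'n::finite param" where
  "dir_mu = (1, 0, 0)"

text \<open>The \<open>N + 1\<close> directions \<open>(lam, c)\<close>: \<open>Some \<alpha>\<close> stands for the component \<open>\<alpha>\<close> of \<open>lam\<close>, \<open>None\<close> for \<open>c\<close>.\<close>
definition dir_check :: "'n::finite option \<Rightarrow> 'n param" where
  "dir_check a = (case a of Some \<alpha> \<Rightarrow> (0, axis \<alpha> 1, 0) | None \<Rightarrow> (0, 0, 1))"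

definition Theta ::
  "'n::finite \<Rightarrow> (real^'n \<Rightarrow> real \<Rightarrow> real) \<Rightarrow> real^'n^'n \<Rightarrow> ('n param \<Rightarrow> real \<Rightarrow> real^'n) \<Rightarrow>
    ('n param \<Rightarrow> real) \<Rightarrow> 'n param \<Rightarrow> real" where
  "Theta k H B U \<Xi> = (\<lambda>(\<mu>, lam, c).
     LINT x:{0..\<Xi> (\<mu>, lam, c)}|lborel.
       H (U (\<mu>, lam, c) x) (ddx (\<lambda>y. U (\<mu>, lam, c) y $ k) x)
       + c * impulse B (U (\<mu>, lam, c) x) + lam \<bullet> U (\<mu>, lam, c) x + \<mu>)"

definition C_matrix ::
  "('n::finite param \<Rightarrow> real) \<Rightarrow> ('n param \<Rightarrow> real) \<Rightarrow> 'n param \<Rightarrow> real^('n option)^('n option)" where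
  "C_matrix \<Theta> \<Xi> p = (\<chi> a b.
     pderiv_along (dir_check a) (pderiv_along (dir_check b) \<Theta>) p
     - pderiv_along (dir_check a) \<Xi> p * pderiv_along (dir_check b) \<Xi> p / pderiv_along dir_mu \<Xi> p)"

text \<open>
  Functions on the circle of length \<open>T\<close> are \<open>T\<close>-periodic functions on the line, and elements of the
  Lebesgue and Sobolev spaces are represented by functions rather than by almost-everywhere classes.
\<close>
definition L2_per :: "real \<Rightarrow> (real \<Rightarrow> 'a::euclidean_space) set" where
  "L2_per T = {f. f \<in> borel_measurable borel \<and> (\<forall>x. f (x + T) = f x) \<and>
     set_integrable lborel {0..T} (\<lambda>x. (norm (f x))\<^sup>2)}"

definition smooth_per :: "real \<Rightarrow> (real \<Rightarrow> 'a::real_normed_vector) set" where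
  "smooth_per T = {f. smooth_on UNIV f \<and> (\<forall>x. f (x + T) = f x)}"

definition weak_deriv_per :: "real \<Rightarrow> (real \<Rightarrow> real) \<Rightarrow> (real \<Rightarrow> real) \<Rightarrow> bool" where
  "weak_deriv_per T f g \<longleftrightarrow> (\<forall>\<phi>\<in>smooth_per T.
     (LINT x:{0..T}|lborel. f x * ddx \<phi> x) = - (LINT x:{0..T}|lborel. g x * \<phi> x))"

primrec sobolev_per :: "real \<Rightarrow> nat \<Rightarrow> (real \<Rightarrow> real) set" where
  "sobolev_per T 0 = L2_per T"
| "sobolev_per T (Suc s) = {f \<in> L2_per T. \<exists>g\<in>sobolev_per T s. weak_deriv_per T f g}"

text \<open>Sobolev regularity \<open>s\<close> for the component \<open>k\<close>, square integrability for the other ones.\<close>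
definition HH :: "'n::finite \<Rightarrow> real \<Rightarrow> nat \<Rightarrow> (real \<Rightarrow> real^'n) set" where
  "HH k T s = {V \<in> L2_per T. (\<lambda>x. V x $ k) \<in> sobolev_per T s}"

definition L2_inner :: "real \<Rightarrow> (real \<Rightarrow> real^'n::finite) \<Rightarrow> (real \<Rightarrow> real^'n) \<Rightarrow> real" where
  "L2_inner T V W = (LINT x:{0..T}|lborel. V x \<bullet> W x)"

text \<open>
  The formal differential operator \<open>Hess F U\<close> is symmetric for the \<open>L2\<close> inner product, hence equal to
  its own transpose; its action on a nonsmooth \<open>V\<close>, in the sense of distributions on the circle, is
  therefore given by testing \<open>V\<close> against \<open>Hess F U \<phi>\<close>. The following relation says that this
  distribution is the square integrable function \<open>W\<close>, which is then unique up to a null set.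
\<close>
definition Hess_dist ::
  "'n::finite \<Rightarrow> real \<Rightarrow> (real^'n \<Rightarrow> real^'n \<Rightarrow> real) \<Rightarrow> (real \<Rightarrow> real^'n) \<Rightarrow>
    (real \<Rightarrow> real^'n) \<Rightarrow> (real \<Rightarrow> real^'n) \<Rightarrow> bool" where
  "Hess_dist k T F U V W \<longleftrightarrow> W \<in> HH k T 0 \<and>
     (\<forall>\<phi>\<in>smooth_per T. L2_inner T W \<phi> = L2_inner T V (Hess F U \<phi>))"

text \<open>
  This is all of \<open>HH k T 2\<close> as soon as the density has no mixed second derivatives with respect to
  \<open>v_x\<close> and a component of \<open>U\<close> other than \<open>v\<close>. Otherwise some elements of \<open>HH k T 2\<close> are mapped to
  distributions that are not square integrable, and have to be left out.
\<close>
definition Hess_domain ::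
  "'n::finite \<Rightarrow> real \<Rightarrow> (real^'n \<Rightarrow> real^'n \<Rightarrow> real) \<Rightarrow> (real \<Rightarrow> real^'n) \<Rightarrow> (real \<Rightarrow> real^'n) set" where
  "Hess_domain k T F U = {V \<in> HH k T 2. \<exists>W. Hess_dist k T F U V W}"

definition Hess_op ::
  "'n::finite \<Rightarrow> real \<Rightarrow> (real^'n \<Rightarrow> real^'n \<Rightarrow> real) \<Rightarrow> (real \<Rightarrow> real^'n) \<Rightarrow>
    (real \<Rightarrow> real^'n) \<Rightarrow> real \<Rightarrow> real^'n" where
  "Hess_op k T F U V = (SOME W. Hess_dist k T F U V W)"

definition tangent_C ::
  "'n::finite \<Rightarrow> real \<Rightarrow> real^'n^'n \<Rightarrow> (real \<Rightarrow> real^'n) \<Rightarrow> (real \<Rightarrow> real^'n) set" where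
  "tangent_C k T B U = {V \<in> HH k T 0.
     (LINT x:{0..T}|lborel. V x \<bullet> (matrix_inv B *v U x)) = 0 \<and> (LINT x:{0..T}|lborel. V x) = 0}"

instantiation "fun" :: (type, real_vector) real_vector
begin

definition scaleR_fun :: "real \<Rightarrow> ('a \<Rightarrow> 'b) \<Rightarrow> 'a \<Rightarrow> 'b" where
  "scaleR_fun r f = (\<lambda>x. r *\<^sub>R f x)"

instance
  by standard (auto simp: scaleR_fun_def fun_eq_iff scaleR_right_distrib scaleR_left_distrib)

end

text \<open>
  The value is infinite if the dimensions are unbounded. Since \<open>dim\<close> is \<open>0\<close> on infinite-dimensional
  spaces, only finite-dimensional subspaces are taken into account, which does not change the supremum.
  For a form \<open>q\<close> that is invariant under modification on null sets, definiteness on a space of functions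
  forces its nonzero elements to be nonzero almost everywhere classes, so that dimensions are the same
  for functions and for classes.
\<close>
definition neg_signature :: "'v::real_vector set \<Rightarrow> ('v \<Rightarrow> real) \<Rightarrow> enat" where
  "neg_signature D q = Sup {enat (dim S) | S. subspace S \<and> (\<exists>b. finite b \<and> S = span b) \<and> S \<subseteq> D \<and>
     (\<forall>V\<in>S. V \<noteq> 0 \<longrightarrow> q V < 0)}"

text \<open>For symmetric matrices, geometric and algebraic multiplicities agree.\<close>
definition neg_eigenvalue_count :: "real^'m^'m::finite \<Rightarrow> nat" where
  "neg_eigenvalue_count M =
     (\<Sum>r\<in>{r. r < 0 \<and> (\<exists>x. x \<noteq> 0 \<and> M *v x = r *\<^sub>R x)}. dim {x. M *v x = r *\<^sub>R x})"

end

theory Submission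
  imports Defs
begin

text \<open>
  Fix a parameter \<open>p = (\<mu>, lam, c)\<close>, write \<open>T = \<Xi> p\<close> and \<open>u = U p\<close>, and let \<open>A\<close> be the Hessian at \<open>u\<close>.
  The tangent space of the constraint manifold is the \<open>A\<close>-orthogonal complement of an explicit
  \<open>(N + 1)\<close>-dimensional space \<open>\<Phi>\<close> of smooth periodic functions on which the form of \<open>A\<close> is given by the
  matrix \<open>-C\<close>. Since \<open>C\<close> is nonsingular, the domain of \<open>A\<close> is the \<open>A\<close>-orthogonal direct sum of \<open>\<Phi>\<close> and
  of its part in the tangent space, and negative signatures add.

  The space \<open>\<Phi>\<close> comes from differentiating the profile equation with respect to the parameters. For a
  direction \<open>d\<close> of parameters this gives \<open>A (U_d) = - g_d\<close>, where \<open>g_d\<close> is the derivative of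
  \<open>lam + c B\<^sup>-\<^sup>1 u\<close> with respect to the parameters at fixed \<open>u\<close>: a constant vector for the
  components of \<open>lam\<close>, the vector \<open>B\<^sup>-\<^sup>1 u\<close> for \<open>c\<close>, and \<open>0\<close> for \<open>\<mu>\<close> (lemma \<open>linearized_profile_equation\<close>). The derivative \<open>U_d\<close> is not periodic because the period
  moves: \<open>U_d (x + T) = U_d x - \<Xi>_d u_x\<close>. The combination \<open>\<phi>_d = U_d - (\<Xi>_d / \<Xi>_\<mu>) U_\<mu>\<close> is periodic and
  still satisfies \<open>A \<phi>_d = - g_d\<close>. Being orthogonal to all \<open>A \<phi>_d\<close> with \<open>d\<close> among the directions
  \<open>(lam, c)\<close> means having mean value zero and being orthogonal to \<open>B\<^sup>-\<^sup>1 u\<close>; this is the tangent space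
  (lemma \<open>tangent_C_iff\<close>).

  The identity \<open>\<langle>g_b, \<phi>_a\<rangle> = C_ab\<close> is a computation with the action \<open>\<Theta>\<close> (lemma \<open>C_matrix_entry\<close>). Its
  integrand is a Lagrangian at a critical point and vanishes at the end of the period, and the boundary
  terms of the integration by parts cancel because \<open>v_x\<close> vanishes there. So \<open>\<Theta>_d\<close> is the integral of the
  explicit parameter derivative of the integrand; in particular \<open>\<Theta>_\<mu> = \<Xi>\<close>. Differentiating once more,
  the moving endpoint contributes \<open>\<Xi>_a G_b\<close>, with \<open>G_b\<close> an endpoint value, and
  \<open>\<Theta>_ab = \<Xi>_a G_b + \<langle>g_b, U_a\<rangle>\<close>. For \<open>a = \<mu>\<close> the left hand side is \<open>\<Xi>_b\<close>, by equality of mixed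
  derivatives. Eliminating \<open>G_b\<close> from the two relations gives \<open>\<Theta>_ab - \<Xi>_a \<Xi>_b / \<Xi>_\<mu> = \<langle>g_b, \<phi>_a\<rangle>\<close>.

  Two further ingredients are needed. On smooth functions \<open>A\<close> is symmetric, because up to a total
  derivative \<open>W \<bullet> A V\<close> is the second derivative of the density (lemma \<open>second_variation_inner\<close>). On the
  domain, \<open>A\<close> is defined by duality with smooth periodic functions, so that its values are determined up
  to null sets and \<open>q (w + \<phi>)\<close> expands as a quadratic form should for smooth \<open>\<phi>\<close>
  (lemma \<open>Hess_form_add_smooth\<close>); this rests on smooth periodic functions separating
  square integrable ones.
\<close>

section \<open>Negative directions of quadratic forms\<close>

text \<open>
  Minimize \<open>h x = x \<bullet> (M *v x)\<close> over the unit sphere of \<open>W\<close>. With \<open>r < 0\<close> the minimum and \<open>y\<close> a minimizer,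
  the form \<open>h x - r * (x \<bullet> x)\<close> is nonnegative on \<open>W\<close> and vanishes at \<open>y\<close>, so its derivative at \<open>y\<close>
  vanishes in all directions of \<open>W\<close>. By invariance \<open>z = M *v y - r *\<^sub>R y\<close> is such a direction, and the
  derivative there is \<open>2 * (z \<bullet> z)\<close>.
\<close>
lemma Rayleigh_minimizer_is_eigenvector:
  fixes M :: "real^'m^'m::finite"
  assumes sym: "transpose M = M" and W: "subspace W" "\<And>x. x \<in> W \<Longrightarrow> M *v x \<in> W"
    and neg: "x \<in> W" "x \<bullet> (M *v x) < 0"
  obtains r y where "r < 0" "y \<in> W" "y \<noteq> 0" "M *v y = r *\<^sub>R y"
proof -
  define h where "h = (\<lambda>x. x \<bullet> (M *v x))"
  have h_scale: "h (c *\<^sub>R x) = c\<^sup>2 * h x" for c x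
    by (simp add: h_def matrix_vector_mult_scaleR power2_eq_square)
  have symM: "x \<bullet> (M *v y) = (M *v x) \<bullet> y" for x y
    using dot_lmul_matrix[of x M y] by (simp add: sym vector_transpose_matrix[symmetric])
  define K where "K = sphere 0 1 \<inter> W"
  have "compact K" unfolding K_def
    by (intro compact_Int_closed compact_sphere closed_subspace W)
  have x0: "x \<noteq> 0" using neg by auto
  have unit: "(1 / norm y) *\<^sub>R y \<in> K" if "y \<in> W" "y \<noteq> 0" for y
    using that W(1) by (simp add: K_def subspace_scale)
  have "K \<noteq> {}" using unit[OF neg(1) x0] by auto
  moreover have "continuous_on K h"
    unfolding h_def by (intro continuous_intros linear_continuous_on matrix_vector_mul_bounded_linear)
  ultimately obtain y where y: "y \<in> K" and min: "\<And>z. z \<in> K \<Longrightarrow> h y \<le> h z"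
    using continuous_attains_inf[OF \<open>compact K\<close>] by blast
  define r where "r = h y"
  have "y \<in> W" "norm y = 1" using y by (auto simp: K_def)
  then have yy: "y \<bullet> y = 1" by (simp add: norm_eq_1)
  have ge: "h z \<ge> r * (z \<bullet> z)" if "z \<in> W" for z
  proof (cases "z = 0")
    case False
    have "r \<le> (1 / norm z)\<^sup>2 * h z"
      using min[OF unit[OF that False]] h_scale[of "1 / norm z" z] by (simp add: r_def)
    then show ?thesis using False by (simp add: field_simps dot_square_norm)
  qed (simp add: h_def)
  have "r < 0"
  proof (rule ccontr)
    assume "\<not> r < 0"
    then have "r * (x \<bullet> x) \<ge> 0" by simp
    then show False using ge[OF neg(1)] neg(2) by (simp add: h_def)
  qed
  define z where "z = M *v y - r *\<^sub>R y"
  have "z \<in> W" unfolding z_def using \<open>y \<in> W\<close> W by (simp add: subspace_diff subspace_scale)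
  have quad: "2 * t * (z \<bullet> z) + t\<^sup>2 * (h z - r * (z \<bullet> z)) \<ge> 0" for t
  proof -
    have "y + t *\<^sub>R z \<in> W" using \<open>y \<in> W\<close> \<open>z \<in> W\<close> W by (simp add: subspace_add subspace_scale)
    note q1 = ge[OF this]
    have q2: "h (y + t *\<^sub>R z) = r + 2 * t * ((M *v y) \<bullet> z) + t\<^sup>2 * h z"
    proof -
      have "y \<bullet> (M *v z) = (M *v y) \<bullet> z" "z \<bullet> (M *v y) = (M *v y) \<bullet> z"
        by (rule symM, rule inner_commute)
      then show ?thesis
        by (simp add: h_def r_def matrix_vector_right_distrib matrix_vector_mult_scaleR inner_add_left
          inner_add_right power2_eq_square algebra_simps)
    qed
    have q3: "(y + t *\<^sub>R z) \<bullet> (y + t *\<^sub>R z) = 1 + 2 * t * (y \<bullet> z) + t\<^sup>2 * (z \<bullet> z)"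
      using inner_commute[of z y]
      by (simp add: inner_add_left inner_add_right power2_eq_square yy algebra_simps)
    have q4: "(M *v y) \<bullet> z = z \<bullet> z + r * (y \<bullet> z)"
      by (simp add: z_def inner_diff_left)
    show ?thesis using q1 unfolding q2 q3 q4 by (simp add: algebra_simps)
  qed
  have "z = 0"
  proof (rule ccontr)
    assume "z \<noteq> 0"
    define a where "a = z \<bullet> z"
    have a: "a > 0" using \<open>z \<noteq> 0\<close> by (simp add: a_def)
    \<comment> \<open>The step \<open>t = - a / b\<close> is small enough for the linear term \<open>2 * t * a\<close> to dominate the
      quadratic one, whose coefficient is at most \<open>b\<close>.\<close>
    define b where "b = \<bar>h z - r * a\<bar> + 1"
    have b: "b > 0" "h z - r * a \<le> b" by (auto simp: b_def)
    have "0 \<le> 2 * (- a / b) * a + (- a / b)\<^sup>2 * (h z - r * a)"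
      using quad[of "- a / b"] by (simp add: a_def)
    also have "\<dots> \<le> 2 * (- a / b) * a + (- a / b)\<^sup>2 * b"
      using b by (intro add_left_mono mult_left_mono) auto
    also have "\<dots> = - (a\<^sup>2 / b)" using b by (simp add: field_simps power2_eq_square)
    also have "\<dots> < 0" using a b by simp
    finally show False by simp
  qed
  moreover have "y \<noteq> 0" using \<open>norm y = 1\<close> by auto
  ultimately show thesis using that[of r y] \<open>r < 0\<close> \<open>y \<in> W\<close> by (simp add: z_def)
qed

text \<open>
  Symmetry makes eigenspaces orthogonal, so orthonormal bases of those with negative eigenvalues can be
  put together. If the form took a negative value on the orthogonal complement, which is invariant, the
  Rayleigh argument would give an eigenvector there with negative eigenvalue, orthogonal to its own
  eigenspace.
\<close>
lemma negative_eigenbasis: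
  fixes M :: "real^'m^'m::finite"
  assumes sym: "transpose M = M"
  obtains b where "finite b" "independent b" "card b = neg_eigenvalue_count M"
    "pairwise orthogonal b" "\<And>e. e \<in> b \<Longrightarrow> \<exists>r<0. M *v e = r *\<^sub>R e"
    "\<And>x. (\<And>e. e \<in> b \<Longrightarrow> orthogonal e x) \<Longrightarrow> x \<bullet> (M *v x) \<ge> 0"
proof -
  have symM: "x \<bullet> (M *v y) = (M *v x) \<bullet> y" for x y
    using dot_lmul_matrix[of x M y] by (simp add: sym vector_transpose_matrix[symmetric])
  define Ev where "Ev = (\<lambda>r. {x. M *v x = r *\<^sub>R x})"
  define R where "R = {r. r < 0 \<and> (\<exists>x. x \<noteq> 0 \<and> M *v x = r *\<^sub>R x)}"
  have "subspace (Ev r)" for r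
    by (auto simp: subspace_def Ev_def matrix_vector_right_distrib matrix_vector_mult_scaleR scaleR_add_right)
  then have "\<exists>c. c \<subseteq> Ev r \<and> pairwise orthogonal c \<and> (\<forall>x\<in>c. norm x = 1) \<and> independent c \<and>
      card c = dim (Ev r) \<and> span c = Ev r" for r
    using orthonormal_basis_subspace by metis
  then obtain c where c: "\<And>r. c r \<subseteq> Ev r" "\<And>r. pairwise orthogonal (c r)"
      "\<And>r x. x \<in> c r \<Longrightarrow> norm x = 1" "\<And>r. independent (c r)"
      "\<And>r. card (c r) = dim (Ev r)" "\<And>r. span (c r) = Ev r"
    by metis
  define b where "b = (\<Union>r\<in>R. c r)"
  have orth_Ev: "orthogonal x y" if "x \<in> Ev r" "y \<in> Ev s" "r \<noteq> s" for x y r s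
  proof -
    have "s * (x \<bullet> y) = r * (x \<bullet> y)"
      using symM[of x y] that by (simp add: Ev_def)
    then show ?thesis using that by (simp add: orthogonal_def)
  qed
  have orth: "pairwise orthogonal b"
    unfolding pairwise_def b_def
  proof (intro ballI impI)
    fix x y assume "x \<in> (\<Union>r\<in>R. c r)" "y \<in> (\<Union>r\<in>R. c r)" "x \<noteq> y"
    then obtain r s where "x \<in> c r" "y \<in> c s" by auto
    then show "orthogonal x y"
      using orth_Ev[of x r y s] c(1)[of r] c(1)[of s] c(2)[of r] \<open>x \<noteq> y\<close>
      by (cases "r = s") (auto simp: pairwise_def)
  qed
  have "0 \<notin> b" using c(3) by (force simp: b_def)
  then have ind: "independent b" using orth pairwise_orthogonal_independent by blast
  then have fin: "finite b" using independent_bound by blast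
  have disj: "c r \<inter> c s = {}" if "r \<noteq> s" for r s
  proof (rule ccontr)
    assume "c r \<inter> c s \<noteq> {}"
    then obtain x where x: "x \<in> c r" "x \<in> c s" by auto
    then have "x \<bullet> x = 0"
      using orth_Ev[of x r x s] c(1)[of r] c(1)[of s] that by (auto simp: orthogonal_def)
    then show False using c(3)[OF x(1)] by simp
  qed
  have c_ne: "c r \<noteq> {}" if r: "r \<in> R" for r
  proof
    assume "c r = {}"
    then have "Ev r = {0}" using c(6)[of r] by simp
    then show False using r by (auto simp: R_def Ev_def)
  qed
  have fin_c: "finite (c r)" if "r \<in> R" for r
    using that by (intro finite_subset[OF _ fin]) (auto simp: b_def)
  \<comment> \<open>Finiteness of \<open>R\<close> matters: the sum defining \<open>neg_eigenvalue_count\<close> would be \<open>0\<close> over an infinite set.\<close>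
  have "finite R"
  proof (rule ccontr)
    assume inf: "infinite R"
    define g where "g = (\<lambda>r. SOME x. x \<in> c r)"
    have g: "g r \<in> c r" if "r \<in> R" for r
      using c_ne[OF that] unfolding g_def by (simp add: some_in_eq)
    have "inj_on g R" using g disj by (intro inj_onI) (metis disjoint_iff)
    moreover have "g ` R \<subseteq> b" using g by (auto simp: b_def)
    ultimately show False using inf fin by (meson finite_subset finite_imageD)
  qed
  then have "card b = (\<Sum>r\<in>R. card (c r))"
    unfolding b_def using disj fin_c by (intro card_UN_disjoint) auto
  also have "\<dots> = neg_eigenvalue_count M"
    unfolding neg_eigenvalue_count_def R_def[symmetric] by (simp add: c(5) Ev_def)
  finally have card: "card b = neg_eigenvalue_count M" .
  have eig: "\<exists>r<0. M *v e = r *\<^sub>R e" if "e \<in> b" for e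
    using that c(1) by (auto simp: b_def R_def Ev_def)
  have "x \<bullet> (M *v x) \<ge> 0" if x: "\<And>e. e \<in> b \<Longrightarrow> orthogonal e x" for x
  proof (rule ccontr)
    assume neg: "\<not> x \<bullet> (M *v x) \<ge> 0"
    define W where "W = {x. \<forall>e\<in>b. orthogonal e x}"
    have "subspace W" by (auto simp: W_def subspace_def orthogonal_def inner_add_right)
    moreover have "M *v y \<in> W" if "y \<in> W" for y
      unfolding W_def
    proof (intro CollectI ballI)
      fix e assume e: "e \<in> b"
      then obtain r where "M *v e = r *\<^sub>R e" using eig by blast
      then show "orthogonal e (M *v y)"
        using that e symM[of e y] by (simp add: W_def orthogonal_def)
    qed
    ultimately obtain r y where y: "r < 0" "y \<in> W" "y \<noteq> 0" "M *v y = r *\<^sub>R y"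
      by (rule Rayleigh_minimizer_is_eigenvector[OF sym, of W x]) (use x neg in \<open>auto simp: W_def\<close>)
    then have "r \<in> R" by (auto simp: R_def)
    then have "orthogonal y e" if "e \<in> c r" for e
      using that y(2) by (auto simp: W_def b_def orthogonal_commute)
    moreover have "y \<in> span (c r)" using y(4) c(6)[of r] by (simp add: Ev_def)
    ultimately have "orthogonal y y" by (metis orthogonal_to_span)
    then show False using y(3) by (simp add: orthogonal_self)
  qed
  then show thesis using that[OF fin ind card orth eig] by blast
qed

text \<open>
  The form is diagonal in an orthogonal family of eigenvectors, with the eigenvalues as coefficients.
\<close>
lemma negative_definite_on_negative_eigenvectors:
  fixes M :: "real^'m^'m::finite"
  assumes "finite b" "pairwise orthogonal b" "\<And>e. e \<in> b \<Longrightarrow> \<exists>r<0. M *v e = r *\<^sub>R e"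
    and x: "x \<in> span b" "x \<noteq> 0"
  shows "x \<bullet> (M *v x) < 0"
proof -
  obtain r where r: "\<And>e. e \<in> b \<Longrightarrow> r e < 0 \<and> M *v e = r e *\<^sub>R e" using assms(3) by metis
  obtain u where u: "x = (\<Sum>e\<in>b. u e *\<^sub>R e)" using x(1) span_finite[OF \<open>finite b\<close>] by auto
  have orth: "e \<bullet> f = 0" if "e \<in> b" "f \<in> b" "f \<noteq> e" for e f
    using assms(2) that by (auto simp: pairwise_def orthogonal_def)
  have "x \<bullet> (M *v x) = (\<Sum>e\<in>b. \<Sum>f\<in>b. (u e *\<^sub>R e) \<bullet> (u f *\<^sub>R r f *\<^sub>R f))"
  proof -
    have "M *v x = (\<Sum>e\<in>b. u e *\<^sub>R r e *\<^sub>R e)"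
      unfolding u using r
      by (simp add: linear_sum[OF matrix_vector_mul_linear] matrix_vector_mult_scaleR cong: sum.cong)
    from arg_cong2[where f = inner, OF u this]
    have "x \<bullet> (M *v x) = (\<Sum>e\<in>b. u e *\<^sub>R e) \<bullet> (\<Sum>e\<in>b. u e *\<^sub>R r e *\<^sub>R e)" .
    also have "\<dots> = (\<Sum>e\<in>b. (u e *\<^sub>R e) \<bullet> (\<Sum>f\<in>b. u f *\<^sub>R r f *\<^sub>R f))"
      by (rule inner_sum_left)
    finally show ?thesis by (simp only: inner_sum_right)
  qed
  also have "\<dots> = (\<Sum>e\<in>b. r e * (norm (u e *\<^sub>R e))\<^sup>2)"
  proof (rule sum.cong[OF refl])
    fix e assume e: "e \<in> b"
    have "(\<Sum>f\<in>b. (u e *\<^sub>R e) \<bullet> (u f *\<^sub>R r f *\<^sub>R f)) = (\<Sum>f\<in>b. if f = e then (u e *\<^sub>R e) \<bullet> (u e *\<^sub>R r e *\<^sub>R e) else 0)"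
      by (rule sum.cong) (use orth[OF e] in auto)
    also have "\<dots> = r e * (norm (u e *\<^sub>R e))\<^sup>2"
      using e \<open>finite b\<close> by (simp add: power2_norm_eq_inner del: norm_scaleR)
    finally show "(\<Sum>f\<in>b. (u e *\<^sub>R e) \<bullet> (u f *\<^sub>R r f *\<^sub>R f)) = r e * (norm (u e *\<^sub>R e))\<^sup>2" .
  qed
  also have "\<dots> < 0"
  proof -
    obtain e where e: "e \<in> b" "u e *\<^sub>R e \<noteq> 0"
      using x(2) sum.neutral[of b "\<lambda>e. u e *\<^sub>R e"] unfolding u by blast
    have "(\<Sum>e\<in>b. r e * (norm (u e *\<^sub>R e))\<^sup>2) < (\<Sum>e\<in>b. 0)"
    proof (rule sum_strict_mono_ex1[OF \<open>finite b\<close>])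
      show "\<forall>e\<in>b. r e * (norm (u e *\<^sub>R e))\<^sup>2 \<le> 0"
        using r by (auto intro!: mult_nonpos_nonneg simp: less_imp_le)
      show "\<exists>e\<in>b. r e * (norm (u e *\<^sub>R e))\<^sup>2 < 0"
        using e r by (intro bexI[of _ e] mult_neg_pos) auto
    qed
    then show ?thesis by simp
  qed
  finally show ?thesis .
qed


text \<open>
  The kernel of a functional has codimension at most one: adding to a basis of it one vector outside of
  it spans everything. Linearity is asked for on the span only, since the functionals of interest are
  built from integrals, which are additive on integrable functions only.
\<close>
lemma independent_kernel_of_functional:
  fixes f :: "'v::real_vector \<Rightarrow> real"
  assumes b: "finite b" "independent b"
    and f: "\<And>V W r. V \<in> span b \<Longrightarrow> W \<in> span b \<Longrightarrow> f (V + r *\<^sub>R W) = f V + r * f W"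
  obtains b' where "finite b'" "independent b'" "span b' \<subseteq> {V \<in> span b. f V = 0}" "card b \<le> card b' + 1"
proof -
  define K where "K = {V \<in> span b. f V = 0}"
  have f0: "f 0 = 0" using f[OF span_zero span_zero, of 1] by simp
  have f_scale: "f (r *\<^sub>R V) = r * f V" if "V \<in> span b" for r V
    using f[OF span_zero that, of r] f0 by simp
  have f_add: "f (V + W) = f V + f W" if "V \<in> span b" "W \<in> span b" for V W
    using f[of V W 1] that by simp
  have K: "subspace K"
    by (auto simp: subspace_def K_def f0 f_add f_scale span_zero span_add span_scale)
  obtain b' where b': "b' \<subseteq> K" "independent b'" "K \<subseteq> span b'"
    using maximal_independent_subset[of K] by blast
  have fin: "finite b'"
    using independent_span_bound[OF b(1) b'(2)] b'(1) by (auto simp: K_def)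
  have sub: "span b' \<subseteq> K" using b'(1) K by (rule span_minimal)
  have "card b \<le> card b' + 1"
  proof (cases "\<exists>v\<in>span b. f v \<noteq> 0")
    case True
    then obtain v where v: "v \<in> span b" "f v \<noteq> 0" by blast
    have "b \<subseteq> span (insert v b')"
    proof
      fix V assume "V \<in> b"
      then have V: "V \<in> span b" by (rule span_base)
      have "V + (- (f V / f v)) *\<^sub>R v \<in> K"
        using V v f[of V v "- (f V / f v)"] unfolding K_def
        by (auto intro!: span_add span_scale simp del: scaleR_minus_left)
      then have "V + (- (f V / f v)) *\<^sub>R v \<in> span (insert v b')"
        using b'(3) span_mono[of b' "insert v b'"] by blast
      moreover have "(f V / f v) *\<^sub>R v \<in> span (insert v b')"
        by (intro span_scale span_base) simp
      ultimately have "(V + (- (f V / f v)) *\<^sub>R v) + (f V / f v) *\<^sub>R v \<in> span (insert v b')"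
        by (rule span_add)
      then show "V \<in> span (insert v b')" by simp
    qed
    then have "card b \<le> card (insert v b')"
      using independent_span_bound[OF _ b(2), of "insert v b'"] fin by simp
    also have "\<dots> \<le> card b' + 1" using card_insert_le_m1 fin by (simp add: card_insert_if)
    finally show ?thesis .
  next
    case False
    then have "b \<subseteq> K" by (auto simp: K_def span_base)
    then have "b \<subseteq> span b'" using b'(3) by blast
    then show ?thesis using independent_span_bound[OF fin b(2)] by simp
  qed
  then show thesis using that[OF fin b'(2)] sub by (simp add: K_def)
qed

lemma independent_kernel_of_functionals:
  fixes f :: "'i \<Rightarrow> 'v::real_vector \<Rightarrow> real"
  assumes "finite I" "finite b" "independent b"
    and "\<And>i V W r. i \<in> I \<Longrightarrow> V \<in> span b \<Longrightarrow> W \<in> span b \<Longrightarrow> f i (V + r *\<^sub>R W) = f i V + r * f i W"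
  shows "\<exists>b'. finite b' \<and> independent b' \<and> span b' \<subseteq> {V \<in> span b. \<forall>i\<in>I. f i V = 0} \<and> card b \<le> card b' + card I"
  using assms(1,4)
proof (induction I rule: finite_induct)
  case empty
  then show ?case using assms(2,3) by (intro exI[of _ b]) auto
next
  case (insert j I)
  then obtain b' where b': "finite b'" "independent b'"
      "span b' \<subseteq> {V \<in> span b. \<forall>i\<in>I. f i V = 0}" "card b \<le> card b' + card I"
    by auto
  have "f j (V + r *\<^sub>R W) = f j V + r * f j W" if "V \<in> span b'" "W \<in> span b'" for V W r
    using insert.prems[of j V W r] b'(3) that by auto
  from independent_kernel_of_functional[OF b'(1,2) this]
  obtain c where "finite c" "independent c" "span c \<subseteq> {V \<in> span b'. f j V = 0}" "card b' \<le> card c + 1"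
    by metis
  then show ?case using b' insert.hyps by (intro exI[of _ c]) auto
qed

text \<open>
  The map \<open>w\<close> is linear on the span only. It is replaced by the linear map defined everywhere that agrees
  with it on the basis, hence on the span.
\<close>
lemma independent_image_if_injective_on_span:
  fixes w :: "'v::real_vector \<Rightarrow> 'u::real_vector"
  assumes b: "finite b" "independent b"
    and w: "\<And>V W r. V \<in> span b \<Longrightarrow> W \<in> span b \<Longrightarrow> w (V + r *\<^sub>R W) = w V + r *\<^sub>R w W"
    and inj: "\<And>V. V \<in> span b \<Longrightarrow> w V = 0 \<Longrightarrow> V = 0"
  shows "independent (w ` b) \<and> card (w ` b) = card b \<and> span (w ` b) = w ` span b"
proof -
  obtain g where g: "linear g" "\<And>v. v \<in> b \<Longrightarrow> g v = w v"
    using linear_independent_extend[OF b(2), of w] by blast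
  have w0: "w 0 = 0" using w[OF span_zero span_zero, of 1] by simp
  have gw: "V \<in> span b \<and> g V = w V" if "V \<in> span b" for V
    using that
  proof (induction rule: span_induct_alt)
    case base
    then show ?case using linear_0[OF g(1)] w0 by (simp add: span_zero)
  next
    case (step c x y)
    have x: "x \<in> span b" using step(1) by (rule span_base)
    have "w (y + c *\<^sub>R x) = w y + c *\<^sub>R w x" using w step x by blast
    then show ?case
      using step x g(2)[of x] linear_add[OF g(1)] linear_scale[OF g(1)]
      by (simp add: span_add span_scale add.commute)
  qed
  have "inj_on g (span b)"
  proof (rule inj_onI)
    fix V W assume VW: "V \<in> span b" "W \<in> span b" "g V = g W"
    then have "g (V - W) = 0" using linear_diff[OF g(1)] by simp
    then show "V = W" using inj[of "V - W"] gw[of "V - W"] VW by (simp add: span_diff)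
  qed
  then have "independent (g ` b)" "inj_on g b"
    using linear_independent_injective_image[OF g(1) b(2)] inj_on_subset span_superset by blast+
  moreover have "g ` b = w ` b" using g(2) by (auto simp: image_iff)
  moreover have "g ` span b = w ` span b" using gw by (auto simp: image_iff)
  ultimately show ?thesis using linear_span_image[OF g(1), of b] by (metis card_image)
qed

text \<open>
  Finite independent sets are easier than dimensions to follow through linear maps in a vector space
  that is not finite-dimensional.
\<close>
lemma neg_signature_bases:
  fixes q :: "'v::real_vector \<Rightarrow> real"
  shows "neg_signature D q = (SUP b \<in> {b. finite b \<and> independent b \<and> span b \<subseteq> D \<and>
     (\<forall>V\<in>span b. V \<noteq> 0 \<longrightarrow> q V < 0)}. enat (card b))"
proof -
  have basis: "\<exists>b. finite b \<and> independent b \<and> span b = S \<and> dim S = card b" if "finite c" "S = span c" for S c :: "'v set"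
  proof -
    obtain b where b: "b \<subseteq> c" "independent b" "c \<subseteq> span b"
      using maximal_independent_subset[of c] by blast
    then have "span b = span c"
      unfolding span_eq using span_superset[of c] by (intro conjI) (rule subset_trans, assumption+)
    then show ?thesis
      using b that finite_subset[OF b(1)] dim_span_eq_card_independent[OF b(2)] by metis
  qed
  have "{enat (dim S) | S. subspace S \<and> (\<exists>b. finite b \<and> S = span b) \<and> S \<subseteq> D \<and> (\<forall>V\<in>S. V \<noteq> 0 \<longrightarrow> q V < 0)} =
     (\<lambda>b. enat (card b)) ` {b. finite b \<and> independent b \<and> span b \<subseteq> D \<and> (\<forall>V\<in>span b. V \<noteq> 0 \<longrightarrow> q V < 0)}"
    (is "?L = ?R")
  proof (rule set_eqI, rule iffI)
    fix d assume "d \<in> ?L"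
    then obtain S c where S: "d = enat (dim S)" "finite c" "S = span c" "S \<subseteq> D" "\<forall>V\<in>S. V \<noteq> 0 \<longrightarrow> q V < 0"
      unfolding mem_Collect_eq by (elim exE conjE)
    from basis[OF S(2,3)] obtain b where b: "finite b" "independent b" "span b = S" "dim S = card b"
      by (elim exE conjE)
    show "d \<in> ?R"
      by (rule image_eqI[of _ _ b]) (use b S in simp_all)
  next
    fix d assume "d \<in> ?R"
    then obtain b where b: "d = enat (card b)" "finite b" "independent b" "span b \<subseteq> D"
        "\<forall>V\<in>span b. V \<noteq> 0 \<longrightarrow> q V < 0"
      unfolding image_iff by (elim bexE CollectE conjE)
    have "d = enat (dim (span b))" using b(1) dim_span_eq_card_independent[OF b(3)] by simp
    then show "d \<in> ?L"
      unfolding mem_Collect_eq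
      by (intro exI[of _ "span b"] conjI exI[of _ b] subspace_span b refl)
  qed
  then show ?thesis unfolding neg_signature_def by simp
qed

text \<open>
  The space \<open>D\<close> is the direct sum of \<open>N\<close> and of the range of \<open>\<Phi>\<close>, orthogonally for \<open>q\<close>, which is the form of
  \<open>M\<close> on the second summand. Let \<open>e\<close> be a basis of eigenvectors for the negative eigenvalues of \<open>M\<close>.
  
  A negative definite subspace of \<open>N\<close> and \<open>\<Phi> ` span e\<close> together span a negative definite subspace, which
  gives one inequality. Conversely, in a negative definite subspace of \<open>D\<close> the vectors whose component in
  the range of \<open>\<Phi>\<close> is orthogonal to \<open>e\<close> form a subspace of codimension at most \<open>card e\<close>. On it the second
  summand contributes a nonnegative amount to \<open>q\<close>, so the projection to \<open>N\<close> is injective and has a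
  negative definite image.
\<close>
lemma neg_signature_orthogonal_decomposition:
  fixes q :: "'v::real_vector \<Rightarrow> real" and \<Phi> :: "real^'m::finite \<Rightarrow> 'v"
  assumes D: "subspace D" and N: "subspace N" "N \<subseteq> D"
    and \<Phi>: "linear \<Phi>" "range \<Phi> \<subseteq> D"
    and direct: "\<And>x. \<Phi> x \<in> N \<Longrightarrow> x = 0"
    and decomp: "\<And>V. V \<in> D \<Longrightarrow> \<exists>x. V - \<Phi> x \<in> N"
    and q: "\<And>w x. w \<in> N \<Longrightarrow> q (w + \<Phi> x) = q w + x \<bullet> (M *v x)"
    and q0: "q 0 = 0" and M: "transpose M = M"
  shows "neg_signature D q = neg_signature N q + enat (neg_eigenvalue_count M)"
proof -
  obtain e where e: "finite e" "independent e" "card e = neg_eigenvalue_count M"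
    "pairwise orthogonal e" "\<And>x. x \<in> e \<Longrightarrow> \<exists>r<0. M *v x = r *\<^sub>R x"
    and nonneg: "\<And>x. (\<And>y. y \<in> e \<Longrightarrow> orthogonal y x) \<Longrightarrow> x \<bullet> (M *v x) \<ge> 0"
    using negative_eigenbasis[OF M] by metis
  have neg: "x \<bullet> (M *v x) < 0" if "x \<in> span e" "x \<noteq> 0" for x
    using negative_definite_on_negative_eigenvectors[OF e(1,4,5) that] .
  obtain X where X: "\<And>V. V \<in> D \<Longrightarrow> V - \<Phi> (X V) \<in> N" using decomp by metis
  have X_unique: "X V = x" if "V - \<Phi> x \<in> N" "V \<in> D" for V x
  proof -
    have "(V - \<Phi> x) - (V - \<Phi> (X V)) \<in> N" by (rule subspace_diff[OF N(1) that(1) X[OF that(2)]])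
    then have "\<Phi> (X V - x) \<in> N" using linear_diff[OF \<Phi>(1)] by simp
    then show ?thesis using direct by force
  qed
  have X_lin: "X (V + r *\<^sub>R W) = X V + r *\<^sub>R X W" if "V \<in> D" "W \<in> D" for V W r
  proof (rule X_unique)
    have "(V - \<Phi> (X V)) + r *\<^sub>R (W - \<Phi> (X W)) \<in> N"
      by (rule subspace_add[OF N(1) X[OF that(1)] subspace_scale[OF N(1) X[OF that(2)]]])
    then show "V + r *\<^sub>R W - \<Phi> (X V + r *\<^sub>R X W) \<in> N"
      by (simp add: linear_add[OF \<Phi>(1)] linear_scale[OF \<Phi>(1)] algebra_simps)
    show "V + r *\<^sub>R W \<in> D" using D that by (simp add: subspace_add subspace_scale)
  qed
  define m where "m = neg_eigenvalue_count M"
  have le: "enat (card b) \<le> neg_signature N q + enat m"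
    if b: "finite b" "independent b" "span b \<subseteq> D" "\<And>V. V \<in> span b \<Longrightarrow> V \<noteq> 0 \<Longrightarrow> q V < 0" for b
  proof -
    have "\<exists>b'. finite b' \<and> independent b' \<and> span b' \<subseteq> {V \<in> span b. \<forall>y\<in>e. y \<bullet> X V = 0} \<and> card b \<le> card b' + card e"
      by (rule independent_kernel_of_functionals[OF e(1) b(1,2)])
         (use b(3) X_lin in \<open>auto simp: inner_add_right subset_iff\<close>)
    then obtain b' where b': "finite b'" "independent b'"
        "span b' \<subseteq> {V \<in> span b. \<forall>y\<in>e. y \<bullet> X V = 0}" "card b \<le> card b' + m"
      using e(3) by (auto simp: m_def)
    define w where "w = (\<lambda>V. V - \<Phi> (X V))"
    have wN: "w V \<in> N" if "V \<in> span b'" for V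
      using b'(3) b(3) X that by (auto simp: w_def)
    have w_neg: "q (w V) < 0" if "V \<in> span b'" "V \<noteq> 0" for V
    proof -
      have "q V = q (w V) + X V \<bullet> (M *v X V)"
        using q[OF wN[OF that(1)], of "X V"] by (simp add: w_def)
      moreover have "X V \<bullet> (M *v X V) \<ge> 0"
        using b'(3) that(1) by (intro nonneg) (auto simp: orthogonal_def)
      moreover have "q V < 0" using b(4) b'(3) that by auto
      ultimately show ?thesis by simp
    qed
    have "w (V + r *\<^sub>R W) = w V + r *\<^sub>R w W" if "V \<in> span b'" "W \<in> span b'" for V W r
    proof -
      have "V \<in> D" "W \<in> D" using b'(3) b(3) that by auto
      from X_lin[OF this] show ?thesis
        by (simp add: w_def linear_add[OF \<Phi>(1)] linear_scale[OF \<Phi>(1)] algebra_simps)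
    qed
    moreover have "V = 0" if "V \<in> span b'" "w V = 0" for V
      using w_neg[OF that(1)] that(2) q0 by auto
    ultimately have im: "independent (w ` b')" "card (w ` b') = card b'" "span (w ` b') = w ` span b'"
      using independent_image_if_injective_on_span[OF b'(1,2), of w] by blast+
    have "enat (card b') \<le> neg_signature N q"
      unfolding neg_signature_bases
    proof (rule SUP_upper2[of "w ` b'"])
      have "q V < 0" if "V \<in> span (w ` b')" "V \<noteq> 0" for V
      proof -
        obtain V' where "V' \<in> span b'" "V = w V'" using \<open>V \<in> span (w ` b')\<close> im(3) by auto
        moreover have "V' \<noteq> 0"
        proof
          assume "V' = 0"
          then have "X V' = 0"
            using X_unique[of V' 0] linear_0[OF \<Phi>(1)] subspace_0[OF N(1)] subspace_0[OF D] by simp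
          then show False using \<open>V = w V'\<close> \<open>V \<noteq> 0\<close> \<open>V' = 0\<close> linear_0[OF \<Phi>(1)] by (simp add: w_def)
        qed
        ultimately show ?thesis using w_neg by simp
      qed
      then show "w ` b' \<in> {b. finite b \<and> independent b \<and> span b \<subseteq> N \<and> (\<forall>V\<in>span b. V \<noteq> 0 \<longrightarrow> q V < 0)}"
        using b'(1) im wN by auto
    qed (simp add: im)
    then have "enat (card b') + enat m \<le> neg_signature N q + enat m" by (rule add_right_mono)
    moreover have "enat (card b) \<le> enat (card b') + enat m" using b'(4) by simp
    ultimately show ?thesis by (rule order_trans[rotated])
  qed
  have ge: "enat (card c) + enat m \<le> neg_signature D q"
    if c: "finite c" "independent c" "span c \<subseteq> N" "\<And>V. V \<in> span c \<Longrightarrow> V \<noteq> 0 \<Longrightarrow> q V < 0" for c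
  proof -
    have "independent (c \<union> \<Phi> ` e') \<and> card (c \<union> \<Phi> ` e') = card c + card e'" if "finite e'" "e' \<subseteq> e" for e'
      using that
    proof (induction e' rule: finite_induct)
      case (insert y e')
      have "\<Phi> y \<notin> span (c \<union> \<Phi> ` e')"
      proof
        assume "\<Phi> y \<in> span (c \<union> \<Phi> ` e')"
        then obtain n z where nz: "\<Phi> y = n + z" "n \<in> span c" "z \<in> span (\<Phi> ` e')"
          by (auto simp: span_Un)
        then obtain z' where z': "z = \<Phi> z'" "z' \<in> span e'"
          using linear_span_image[OF \<Phi>(1), of e'] by auto
        have "\<Phi> (y - z') \<in> N" using nz z' c(3) linear_diff[OF \<Phi>(1)] by auto
        then have "y = z'" using direct by force
        moreover have "independent (insert y e')" using independent_mono[OF e(2)] insert.prems by blast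
        ultimately show False using z'(2) insert.hyps(2) by (simp add: independent_insert)
      qed
      moreover from this have "\<Phi> y \<notin> c \<union> \<Phi> ` e'" by (rule contrapos_nn) (rule span_base)
      ultimately show ?case
        using insert c(1) by (simp add: independent_insert)
    qed (use c in auto)
    from this[OF e(1) subset_refl]
    have ind: "independent (c \<union> \<Phi> ` e)" and card: "card (c \<union> \<Phi> ` e) = card c + m"
      using e(3) by (auto simp: m_def)
    have "enat (card (c \<union> \<Phi> ` e)) \<le> neg_signature D q"
      unfolding neg_signature_bases
    proof (rule SUP_upper)
      have "c \<union> \<Phi> ` e \<subseteq> D" using c(3) N(2) \<Phi>(2) span_superset[of c] by blast
      then have "span (c \<union> \<Phi> ` e) \<subseteq> D" using D by (rule span_minimal)
      moreover have "q V < 0" if V: "V \<in> span (c \<union> \<Phi> ` e)" "V \<noteq> 0" for V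
      proof -
        obtain n z where nz: "V = n + z" "n \<in> span c" "z \<in> span (\<Phi> ` e)"
          using V(1) by (auto simp: span_Un)
        then obtain z' where z': "z = \<Phi> z'" "z' \<in> span e"
          using linear_span_image[OF \<Phi>(1), of e] by auto
        have eq: "q V = q n + z' \<bullet> (M *v z')" using q[of n z'] nz z' c(3) by auto
        show ?thesis
        proof (cases "n = 0")
          case True
          then have "z' \<noteq> 0" using V(2) nz(1) z'(1) linear_0[OF \<Phi>(1)] by auto
          then show ?thesis using eq neg[OF z'(2)] True q0 by simp
        next
          case False
          then show ?thesis using eq neg[OF z'(2)] c(4)[OF nz(2)] by (cases "z' = 0") auto
        qed
      qed
      ultimately show "c \<union> \<Phi> ` e \<in> {b. finite b \<and> independent b \<and> span b \<subseteq> D \<and> (\<forall>V\<in>span b. V \<noteq> 0 \<longrightarrow> q V < 0)}"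
        using ind c(1) e(1) by auto
    qed
    then show ?thesis by (simp add: card)
  qed
  have "neg_signature D q \<le> neg_signature N q + enat m"
    unfolding neg_signature_bases[of D] by (rule SUP_least) (use le in auto)
  moreover have "neg_signature N q + enat m \<le> neg_signature D q"
  proof (cases "neg_signature D q")
    case (enat d)
    have "m \<le> d" using ge[of "{}"] subspace_0[OF N(1)] enat independent_empty by simp
    have "neg_signature N q \<le> enat (d - m)"
      unfolding neg_signature_bases[of N]
    proof (rule SUP_least, clarify)
      fix c :: "'v set"
      assume "finite c" "independent c" "span c \<subseteq> N" "\<forall>V\<in>span c. V \<noteq> 0 \<longrightarrow> q V < 0"
      then have "enat (card c) + enat m \<le> neg_signature D q" by (intro ge) auto
      then show "enat (card c) \<le> enat (d - m)" using enat by simp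
    qed
    then have "neg_signature N q + enat m \<le> enat (d - m) + enat m" by (rule add_right_mono)
    then show ?thesis using enat \<open>m \<le> d\<close> by simp
  qed simp
  ultimately show ?thesis by (simp add: m_def)
qed

section \<open>Smooth functions\<close>

abbreviation dirderiv :: "('a::real_normed_vector \<Rightarrow> 'b::real_normed_vector) \<Rightarrow> 'a \<Rightarrow> 'a \<Rightarrow> 'b"
  where "dirderiv f v \<equiv> (\<lambda>x. frechet_derivative f (at x) v)"

lemma higher_differentiable_on_cong:
  assumes "open S" "\<And>x. x \<in> S \<Longrightarrow> f x = g x" "higher_differentiable_on S f n"
  shows "higher_differentiable_on S g n"
  using assms(2,3)
proof (induction n arbitrary: f g)
  case 0
  then show ?case using continuous_on_cong[of S S f g] by simp
next
  case (Suc n)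
  have der: "(g has_derivative frechet_derivative f (at x)) (at x)" if "x \<in> S" for x
  proof (rule has_derivative_transform_within_open[OF _ \<open>open S\<close> that])
    show "(f has_derivative frechet_derivative f (at x)) (at x)"
      using Suc.prems(2) that by (simp add: frechet_derivative_works)
  qed (use Suc.prems in auto)
  have "higher_differentiable_on S (dirderiv g v) n" for v
  proof (rule Suc.IH)
    show "dirderiv f v x = dirderiv g v x" if "x \<in> S" for x
      using frechet_derivative_at[OF der[OF that]] by simp
    show "higher_differentiable_on S (dirderiv f v) n"
      using Suc.prems by simp
  qed
  then show ?case using der by (auto simp: differentiable_def)
qed

text \<open>
  The derivative may be prescribed by a formula that is valid on \<open>S\<close> only, where it agrees with
  \<open>frechet_derivative\<close>.
\<close>
lemma higher_differentiable_on_SucI: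
  assumes "open S" and der: "\<And>x. x \<in> S \<Longrightarrow> (f has_derivative f' x) (at x)"
    and hd: "\<And>v. higher_differentiable_on S (\<lambda>x. f' x v) n"
  shows "higher_differentiable_on S f (Suc n)"
proof -
  have "higher_differentiable_on S (dirderiv f v) n" for v
    by (rule higher_differentiable_on_cong[OF \<open>open S\<close> _ hd])
       (simp add: frechet_derivative_at[OF der, symmetric])
  then show ?thesis using der by (auto simp: differentiable_def)
qed

lemma higher_differentiable_on_SucD:
  "higher_differentiable_on S f (Suc n) \<Longrightarrow> higher_differentiable_on S f n"
proof (induction n arbitrary: f)
  case 0
  then show ?case
    using differentiable_imp_continuous_within[of f _ UNIV]
    by (auto intro!: continuous_at_imp_continuous_on differentiable_imp_continuous_within)
next
  case (Suc n)
  have "higher_differentiable_on S (dirderiv f v) n" for v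
    by (rule Suc.IH) (use Suc.prems in auto)
  then show ?case using Suc.prems by simp
qed

lemma higher_differentiable_on_const:
  "higher_differentiable_on S (\<lambda>x. c) n"
  by (induction n arbitrary: c) (auto simp: frechet_derivative_const)

lemma higher_differentiable_on_linear:
  assumes "bounded_linear h" "open S"
  shows "higher_differentiable_on S h n"
proof (cases n)
  case 0
  then show ?thesis using assms by (simp add: linear_continuous_on)
next
  case (Suc m)
  show ?thesis unfolding Suc
    by (rule higher_differentiable_on_SucI[where f' = "\<lambda>x. h"])
       (use assms in \<open>auto intro: bounded_linear_imp_has_derivative higher_differentiable_on_const\<close>)
qed

lemma higher_differentiable_on_add:
  assumes "open S" "higher_differentiable_on S f n" "higher_differentiable_on S g n"
  shows "higher_differentiable_on S (\<lambda>x. f x + g x) n"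
  using assms(2,3)
proof (induction n arbitrary: f g)
  case 0
  then show ?case by (simp add: continuous_on_add)
next
  case (Suc n)
  show ?case
  proof (rule higher_differentiable_on_SucI[OF \<open>open S\<close>])
    fix x assume "x \<in> S"
    then show "((\<lambda>x. f x + g x) has_derivative (\<lambda>v. dirderiv f v x + dirderiv g v x)) (at x)"
      using Suc.prems by (intro has_derivative_add) (auto simp: frechet_derivative_works)
  qed (use Suc \<open>open S\<close> in auto)
qed

text \<open>
  By the product rule a derivative of \<open>h (f x) (g x)\<close> is a sum of expressions of the same form, with
  one derivative less available for one of the factors.
\<close>
lemma higher_differentiable_on_bilinear:
  assumes "bounded_bilinear h" "open S"
    "higher_differentiable_on S f n" "higher_differentiable_on S g n"
  shows "higher_differentiable_on S (\<lambda>x. h (f x) (g x)) n"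
  using assms(3,4)
proof (induction n arbitrary: f g)
  case 0
  then show ?case by (simp add: bounded_bilinear.continuous_on[OF assms(1)])
next
  case (Suc n)
  note lower = Suc.prems[THEN higher_differentiable_on_SucD]
  show ?case
  proof (rule higher_differentiable_on_SucI[OF \<open>open S\<close>])
    fix x assume "x \<in> S"
    then show "((\<lambda>x. h (f x) (g x)) has_derivative
        (\<lambda>v. h (f x) (dirderiv g v x) + h (dirderiv f v x) (g x))) (at x)"
      using Suc.prems
      by (intro bounded_bilinear.FDERIV[OF assms(1)]) (auto simp: frechet_derivative_works)
  next
    fix v
    show "higher_differentiable_on S (\<lambda>x. h (f x) (dirderiv g v x) + h (dirderiv f v x) (g x)) n"
      using Suc lower by (intro higher_differentiable_on_add[OF \<open>open S\<close>] Suc.IH) auto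
  qed
qed

lemma higher_differentiable_on_sum:
  assumes "open S" "\<And>i. i \<in> I \<Longrightarrow> higher_differentiable_on S (f i) n"
  shows "higher_differentiable_on S (\<lambda>x. \<Sum>i\<in>I. f i x) n"
  using assms(2)
  by (induction I rule: infinite_finite_induct)
     (auto intro: higher_differentiable_on_const higher_differentiable_on_add[OF \<open>open S\<close>])

lemma dirderiv_sum_Basis:
  fixes f :: "'a::euclidean_space \<Rightarrow> 'b::real_normed_vector"
  assumes "f differentiable (at x)"
  shows "dirderiv f v x = (\<Sum>i\<in>Basis. (v \<bullet> i) *\<^sub>R dirderiv f i x)"
proof -
  interpret linear "frechet_derivative f (at x)"
    using assms by (rule linear_frechet_derivative)
  have "dirderiv f v x = frechet_derivative f (at x) (\<Sum>i\<in>Basis. (v \<bullet> i) *\<^sub>R i)"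
    by (simp add: euclidean_representation)
  then show ?thesis by (simp add: sum scale)
qed

text \<open>
  The derivative of \<open>f o g\<close> in the direction \<open>v\<close> is the sum over a basis of the products of the components
  of \<open>Dg v\<close> and of the functions \<open>D_i f o g\<close>. The latter are again compositions with \<open>g\<close>, so the induction on
  the order is for all \<open>f\<close> simultaneously. Expanding in a basis is necessary because the direction in which
  \<open>f\<close> is differentiated depends on the point.
\<close>
lemma higher_differentiable_on_compose:
  fixes g :: "'a::real_normed_vector \<Rightarrow> 'b::euclidean_space"
  assumes "open S" "open T" "\<And>x. x \<in> S \<Longrightarrow> g x \<in> T"
    "higher_differentiable_on T f n" "higher_differentiable_on S g n"
  shows "higher_differentiable_on S (\<lambda>x. f (g x)) n"
  using assms(4,5)
proof (induction n arbitrary: f)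
  case 0
  then show ?case using assms(3) by (auto intro: continuous_on_compose2)
next
  case (Suc n)
  have diff: "f differentiable (at (g x))" if "x \<in> S" for x using Suc.prems assms(3) that by simp
  show ?case
  proof (rule higher_differentiable_on_SucI[OF \<open>open S\<close>])
    fix x assume x: "x \<in> S"
    have 1: "(g has_derivative (\<lambda>v. dirderiv g v x)) (at x)"
      using Suc.prems(2) x by (simp add: frechet_derivative_works)
    have 2: "(f has_derivative (\<lambda>v. dirderiv f v (g x))) (at (g x))"
      using diff[OF x] by (simp add: frechet_derivative_works)
    show "((\<lambda>x. f (g x)) has_derivative
        (\<lambda>v. \<Sum>i\<in>Basis. (dirderiv g v x \<bullet> i) *\<^sub>R dirderiv f i (g x))) (at x)"
      using has_derivative_compose[OF 1 2] unfolding dirderiv_sum_Basis[OF diff[OF x], of "dirderiv g _ x"] .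
  next
    fix v
    have *: "higher_differentiable_on S (\<lambda>x. dirderiv f i (g x)) n" for i
      by (rule Suc.IH) (use Suc.prems higher_differentiable_on_SucD in auto)
    show "higher_differentiable_on S (\<lambda>x. \<Sum>i\<in>Basis. (dirderiv g v x \<bullet> i) *\<^sub>R dirderiv f i (g x)) n"
      using * Suc.prems
      by (intro higher_differentiable_on_sum higher_differentiable_on_bilinear[OF bounded_bilinear_scaleR]
           higher_differentiable_on_bilinear[OF bounded_bilinear_inner] higher_differentiable_on_const \<open>open S\<close>) auto
  qed
qed

lemma higher_differentiable_on_linear_compose:
  assumes "bounded_linear h" "open S" "higher_differentiable_on S f n"
  shows "higher_differentiable_on S (\<lambda>x. h (f x)) n"
  using assms(3)
proof (induction n arbitrary: f)
  case 0
  then show ?case by (simp add: bounded_linear.continuous_on[OF assms(1)])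
next
  case (Suc n)
  show ?case
    by (rule higher_differentiable_on_SucI[OF \<open>open S\<close>, where f' = "\<lambda>x v. h (dirderiv f v x)"])
       (use Suc assms in \<open>auto intro!: bounded_linear.has_derivative[OF assms(1)] simp: frechet_derivative_works\<close>)
qed

lemma smooth_on_add: "open S \<Longrightarrow> smooth_on S f \<Longrightarrow> smooth_on S g \<Longrightarrow> smooth_on S (\<lambda>x. f x + g x)"
  by (simp add: smooth_on_def higher_differentiable_on_add)

lemma smooth_on_const: "smooth_on S (\<lambda>x. c)"
  by (simp add: smooth_on_def higher_differentiable_on_const)

lemma smooth_on_linear: "bounded_linear h \<Longrightarrow> open S \<Longrightarrow> smooth_on S h"
  by (simp add: smooth_on_def higher_differentiable_on_linear)

lemma smooth_on_linear_compose:
  "bounded_linear h \<Longrightarrow> open S \<Longrightarrow> smooth_on S f \<Longrightarrow> smooth_on S (\<lambda>x. h (f x))"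
  by (simp add: smooth_on_def higher_differentiable_on_linear_compose)

lemma smooth_on_bilinear:
  "bounded_bilinear h \<Longrightarrow> open S \<Longrightarrow> smooth_on S f \<Longrightarrow> smooth_on S g \<Longrightarrow> smooth_on S (\<lambda>x. h (f x) (g x))"
  by (simp add: smooth_on_def higher_differentiable_on_bilinear)

lemmas smooth_on_scaleR = smooth_on_bilinear[OF bounded_bilinear_scaleR]
lemmas smooth_on_inner = smooth_on_bilinear[OF bounded_bilinear_inner]
lemmas smooth_on_mult = smooth_on_bilinear[OF bounded_bilinear_mult]

lemma smooth_on_sum:
  "open S \<Longrightarrow> (\<And>i. i \<in> I \<Longrightarrow> smooth_on S (f i)) \<Longrightarrow> smooth_on S (\<lambda>x. \<Sum>i\<in>I. f i x)"
  by (simp add: smooth_on_def higher_differentiable_on_sum)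

lemma smooth_on_diff:
  "open S \<Longrightarrow> smooth_on S f \<Longrightarrow> smooth_on S g \<Longrightarrow> smooth_on S (\<lambda>x. f x - g x)"
  using smooth_on_add[OF _ _ smooth_on_linear_compose[OF bounded_linear_minus[OF bounded_linear_ident]], of S f g] by simp

lemma smooth_on_compose:
  fixes g :: "'a::real_normed_vector \<Rightarrow> 'b::euclidean_space"
  shows "open S \<Longrightarrow> open T \<Longrightarrow> (\<And>x. x \<in> S \<Longrightarrow> g x \<in> T) \<Longrightarrow> smooth_on T f \<Longrightarrow> smooth_on S g \<Longrightarrow>
    smooth_on S (\<lambda>x. f (g x))"
  unfolding smooth_on_def by (blast intro: higher_differentiable_on_compose)

lemma smooth_on_Pair:
  assumes "open S" "smooth_on S f" "smooth_on S g"
  shows "smooth_on S (\<lambda>x. (f x, g x))"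
proof -
  have "smooth_on S (\<lambda>x. (f x, 0) + (0, g x))"
    by (intro smooth_on_add smooth_on_linear_compose[where h = "\<lambda>y. (y, 0)"]
       smooth_on_linear_compose[where h = "\<lambda>y. (0, y)"] assms bounded_linear_Pair
       bounded_linear_ident bounded_linear_zero)
  then show ?thesis by simp
qed

lemma smooth_on_dirderiv: "smooth_on S f \<Longrightarrow> smooth_on S (dirderiv f v)"
  unfolding smooth_on_def using higher_differentiable_on.simps(2) by blast

lemma smooth_on_imp_continuous_on: "smooth_on S f \<Longrightarrow> continuous_on S f"
  unfolding smooth_on_def using higher_differentiable_on.simps(1) by blast

lemma smooth_on_has_derivative:
  assumes "smooth_on S f" "x \<in> S"
  shows "(f has_derivative (\<lambda>v. dirderiv f v x)) (at x)"
proof -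
  have "higher_differentiable_on S f (Suc 0)"
    using assms(1) unfolding smooth_on_def by blast
  then show ?thesis using assms(2) by (simp add: frechet_derivative_works)
qed

lemma smooth_on_cong: "open S \<Longrightarrow> (\<And>x. x \<in> S \<Longrightarrow> f x = g x) \<Longrightarrow> smooth_on S f \<Longrightarrow> smooth_on S g"
  unfolding smooth_on_def using higher_differentiable_on_cong by blast

lemma smooth_on_chain:
  assumes "smooth_on S f" "g t \<in> S" "(g has_vector_derivative g') (at t)"
  shows "((\<lambda>t. f (g t)) has_vector_derivative dirderiv f g' (g t)) (at t)"
proof -
  have f: "(f has_derivative (\<lambda>v. dirderiv f v (g t))) (at (g t))"
    using smooth_on_has_derivative[OF assms(1,2)] .
  interpret linear "\<lambda>v. dirderiv f v (g t)"
    using f by (rule has_derivative_linear)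
  show ?thesis
    using has_derivative_compose[OF assms(3)[unfolded has_vector_derivative_def] f]
    by (simp add: has_vector_derivative_def scale)
qed

section \<open>Mixed partial derivatives and moving endpoints\<close>

text \<open>
  Integrating \<open>h\<close> over \<open>t\<close> and differentiating under the integral sign shows that \<open>m t - m a\<close> is the
  integral of \<open>k 0\<close> from \<open>a\<close> to \<open>t\<close>. Existence and continuity of one mixed derivative, \<open>k\<close>, thus yield
  existence of the other one. For the action integral \<open>k\<close> is at hand: the derivative \<open>h\<close> in the direction \<open>\<mu>\<close>
  is the period, a smooth function.
\<close>
lemma mixed_partial_derivatives:
  fixes g :: "real \<Rightarrow> real \<Rightarrow> 'a::euclidean_space"
  assumes "e > 0"
    and g_t: "\<And>s t. \<bar>s\<bar> < e \<Longrightarrow> \<bar>t\<bar> < e \<Longrightarrow> ((\<lambda>t. g s t) has_vector_derivative h s t) (at t)"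
    and h_s: "\<And>s t. \<bar>s\<bar> < e \<Longrightarrow> \<bar>t\<bar> < e \<Longrightarrow> ((\<lambda>s. h s t) has_vector_derivative k s t) (at s)"
    and g_s: "\<And>t. \<bar>t\<bar> < e \<Longrightarrow> ((\<lambda>s. g s t) has_vector_derivative m t) (at 0)"
    and cont_h: "continuous_on ({-e<..<e} \<times> {-e<..<e}) (\<lambda>(s, t). h s t)"
    and cont_k: "continuous_on ({-e<..<e} \<times> {-e<..<e}) (\<lambda>(s, t). k s t)"
  shows "(m has_vector_derivative k 0 0) (at 0)"
proof -
  \<comment> \<open>The integrals start to the left of \<open>0\<close>, so that \<open>0\<close> is an interior point.\<close>
  define a where "a = - e / 2"
  have a: "- e < a" "a < 0" using \<open>e > 0\<close> by (auto simp: a_def)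
  have diff: "g s t - g s a = integral {a..t} (h s)" if "\<bar>s\<bar> < e" "a \<le> t" "t < e" for s t
    by (rule sym, rule integral_unique, rule fundamental_theorem_of_calculus)
       (use that a in \<open>auto intro!: has_vector_derivative_at_within[OF g_t]\<close>)
  have cont_ks: "continuous_on {a..t} (k 0)" if "t < e" for t
    by (rule continuous_on_compose2[OF cont_k, of _ "\<lambda>t. (0, t)", simplified])
       (use that a \<open>e > 0\<close> in \<open>auto intro!: continuous_intros\<close>)
  have eq: "m t = m a + integral {a..t} (k 0)" if t: "a \<le> t" "t < e" for t
  proof -
    have "((\<lambda>s. integral (cbox a t) (h s)) has_vector_derivative integral (cbox a t) (k 0))
        (at 0 within {-e<..<e})"
    proof (rule leibniz_rule_vector_derivative)
      fix s assume s: "s \<in> {-e<..<e}"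
      have "continuous_on (cbox a t) (h s)"
        by (rule continuous_on_compose2[OF cont_h, of _ "\<lambda>t. (s, t)", simplified])
           (use s t a in \<open>auto intro!: continuous_intros\<close>)
      then show "h s integrable_on cbox a t" by (rule integrable_continuous)
    next
      show "continuous_on ({-e<..<e} \<times> cbox a t) (\<lambda>(s, t). k s t)"
        by (rule continuous_on_subset[OF cont_k]) (use t a in auto)
    qed (use t a \<open>e > 0\<close> in \<open>auto intro!: has_vector_derivative_at_within[OF h_s]\<close>)
    then have "((\<lambda>s. integral {a..t} (h s)) has_vector_derivative integral {a..t} (k 0)) (at 0)"
      using \<open>e > 0\<close> by (simp add: at_within_open[of _ "{-e<..<e}"])
    then have "((\<lambda>s. g s t - g s a) has_vector_derivative integral {a..t} (k 0)) (at 0)"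
      by (rule has_vector_derivative_transform_within_open[of _ _ _ "{-e<..<e}"])
         (use diff t \<open>e > 0\<close> in auto)
    moreover have "((\<lambda>s. g s t - g s a) has_vector_derivative m t - m a) (at 0)"
      by (intro has_vector_derivative_diff g_s) (use t a in auto)
    ultimately have "m t - m a = integral {a..t} (k 0)"
      by (rule vector_derivative_unique_at[rotated])
    then show ?thesis by (simp add: algebra_simps)
  qed
  have "((\<lambda>t. integral {a..t} (k 0)) has_vector_derivative k 0 0) (at 0 within {a..e/2})"
    by (rule integral_has_vector_derivative[OF cont_ks]) (use \<open>e > 0\<close> a in auto)
  then have "((\<lambda>t. integral {a..t} (k 0)) has_vector_derivative k 0 0) (at 0)"
    using at_within_interior[of 0 "{a..e/2}"] \<open>e > 0\<close> a by (simp add: interior_atLeastAtMost_real)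
  then have "((\<lambda>t. m a + integral {a..t} (k 0)) has_vector_derivative 0 + k 0 0) (at 0)"
    by (intro has_vector_derivative_add has_vector_derivative_const)
  then have "((\<lambda>t. m a + integral {a..t} (k 0)) has_vector_derivative k 0 0) (at 0)" by simp
  then show ?thesis
    by (rule has_vector_derivative_transform_within_open[of _ _ _ "{a<..<e}"])
       (use a \<open>e > 0\<close> in \<open>auto intro: eq[symmetric]\<close>)
qed

lemma open_two_parameter_neighbourhood:
  fixes x u v :: "'a::real_normed_vector"
  assumes "open S" "x \<in> S"
  obtains e :: real where "e > 0" "\<And>s t. \<bar>s\<bar> < e \<Longrightarrow> \<bar>t\<bar> < e \<Longrightarrow> x + s *\<^sub>R u + t *\<^sub>R v \<in> S"
proof -
  have "continuous_on UNIV (\<lambda>(s, t). x + s *\<^sub>R u + t *\<^sub>R v)"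
    by (auto intro!: continuous_intros simp: case_prod_unfold)
  then have "open ((\<lambda>(s, t). x + s *\<^sub>R u + t *\<^sub>R v) -` S)"
    using \<open>open S\<close> by (rule open_vimage[rotated])
  moreover have "(0, 0) \<in> (\<lambda>(s, t). x + s *\<^sub>R u + t *\<^sub>R v) -` S" using assms by simp
  ultimately obtain A C where AC: "open A" "open C" "(0::real) \<in> A" "(0::real) \<in> C"
      "A \<times> C \<subseteq> (\<lambda>(s, t). x + s *\<^sub>R u + t *\<^sub>R v) -` S"
    by (auto elim!: open_prod_elim)
  obtain d1 where d1: "d1 > 0" "ball 0 d1 \<subseteq> A" using AC openE by blast
  obtain d2 where d2: "d2 > 0" "ball 0 d2 \<subseteq> C" using AC openE by blast
  define e where "e = min d1 d2"
  have e: "e > 0" using d1 d2 by (simp add: e_def)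
  have "x + s *\<^sub>R u + t *\<^sub>R v \<in> S" if "\<bar>s\<bar> < e" "\<bar>t\<bar> < e" for s t
    using AC(5) d1 d2 that by (force simp: e_def subset_iff)
  with e show thesis by (rule that)
qed

text \<open>
  Apply \<open>mixed_partial_derivatives\<close> to the restriction of \<open>f\<close> to the plane through \<open>x\<close> in the directions
  \<open>u\<close> and \<open>v\<close>.
\<close>
lemma dirderiv_commute:
  fixes f :: "'a::real_normed_vector \<Rightarrow> 'b::euclidean_space"
  assumes "open S" "smooth_on S f" "x \<in> S"
  shows "dirderiv (dirderiv f u) v x = dirderiv (dirderiv f v) u x"
proof -
  obtain e where e: "e > 0" and in_S: "\<And>s t. \<bar>s\<bar> < e \<Longrightarrow> \<bar>t\<bar> < e \<Longrightarrow> x + s *\<^sub>R u + t *\<^sub>R v \<in> S"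
    using open_two_parameter_neighbourhood[OF assms(1,3)] by metis
  have cont: "continuous_on ({-e<..<e} \<times> {-e<..<e}) (\<lambda>(s, t). F (x + s *\<^sub>R u + t *\<^sub>R v))"
    if "smooth_on S F" for F :: "'a \<Rightarrow> 'b"
    unfolding case_prod_unfold
    by (rule continuous_on_compose2[OF smooth_on_imp_continuous_on[OF that]])
       (auto intro!: continuous_intros in_S)
  have line_t: "((\<lambda>t. F (x + s *\<^sub>R u + t *\<^sub>R v)) has_vector_derivative
      dirderiv F v (x + s *\<^sub>R u + t *\<^sub>R v)) (at t)"
    if "smooth_on S F" "\<bar>s\<bar> < e" "\<bar>t\<bar> < e" for F :: "'a \<Rightarrow> 'b" and s t
    by (rule smooth_on_chain[OF that(1)]) (auto intro!: derivative_eq_intros in_S that)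
  have line_s: "((\<lambda>s. F (x + s *\<^sub>R u + t *\<^sub>R v)) has_vector_derivative
      dirderiv F u (x + s *\<^sub>R u + t *\<^sub>R v)) (at s)"
    if "smooth_on S F" "\<bar>s\<bar> < e" "\<bar>t\<bar> < e" for F :: "'a \<Rightarrow> 'b" and s t
    by (rule smooth_on_chain[OF that(1)]) (auto intro!: derivative_eq_intros in_S that)
  have "((\<lambda>t. dirderiv f u (x + t *\<^sub>R v)) has_vector_derivative
      dirderiv (dirderiv f v) u (x + 0 *\<^sub>R u + 0 *\<^sub>R v)) (at 0)"
  proof (rule mixed_partial_derivatives[OF e, where
        g = "\<lambda>s t. f (x + s *\<^sub>R u + t *\<^sub>R v)" and
        h = "\<lambda>s t. dirderiv f v (x + s *\<^sub>R u + t *\<^sub>R v)" and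
        k = "\<lambda>s t. dirderiv (dirderiv f v) u (x + s *\<^sub>R u + t *\<^sub>R v)"])
    show "((\<lambda>s. f (x + s *\<^sub>R u + t *\<^sub>R v)) has_vector_derivative dirderiv f u (x + t *\<^sub>R v)) (at 0)"
      if "\<bar>t\<bar> < e" for t
      using line_s[of f 0 t] assms that e by simp
    note sm = smooth_on_dirderiv[OF assms(2), of v]
    show "((\<lambda>t. f (x + s *\<^sub>R u + t *\<^sub>R v)) has_vector_derivative
        dirderiv f v (x + s *\<^sub>R u + t *\<^sub>R v)) (at t)" if "\<bar>s\<bar> < e" "\<bar>t\<bar> < e" for s t
      using line_t[OF assms(2) that] .
    show "((\<lambda>s. dirderiv f v (x + s *\<^sub>R u + t *\<^sub>R v)) has_vector_derivative
        dirderiv (dirderiv f v) u (x + s *\<^sub>R u + t *\<^sub>R v)) (at s)" if "\<bar>s\<bar> < e" "\<bar>t\<bar> < e" for s t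
      using line_s[OF sm that] .
    show "continuous_on ({-e<..<e} \<times> {-e<..<e}) (\<lambda>(s, t). dirderiv f v (x + s *\<^sub>R u + t *\<^sub>R v))"
      using cont[OF sm] .
    show "continuous_on ({-e<..<e} \<times> {-e<..<e})
        (\<lambda>(s, t). dirderiv (dirderiv f v) u (x + s *\<^sub>R u + t *\<^sub>R v))"
      using cont[OF smooth_on_dirderiv[OF sm]] .
  qed
  moreover have "((\<lambda>t. dirderiv f u (x + t *\<^sub>R v)) has_vector_derivative
      dirderiv (dirderiv f u) v x) (at 0)"
    using line_t[OF smooth_on_dirderiv[OF assms(2)], of 0 0 u] e by simp
  ultimately show ?thesis using vector_derivative_unique_at by force
qed

text \<open>
  The integral of \<open>f t\<close> over \<open>{0..y}\<close> is a differentiable function of \<open>(t, y)\<close>: it has a partial derivative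
  in \<open>t\<close> by differentiation under the integral sign, and a continuous one in \<open>y\<close>. The curve \<open>t \<mapsto> (t, b t)\<close> is
  then inserted by the chain rule.
\<close>
lemma integral_moving_endpoint_derivative:
  fixes f f' :: "real \<Rightarrow> real \<Rightarrow> real"
  assumes "e > 0"
    and der: "\<And>t x. \<bar>t\<bar> < e \<Longrightarrow> ((\<lambda>t. f t x) has_vector_derivative f' t x) (at t)"
    and cont: "continuous_on ({-e<..<e} \<times> UNIV) (\<lambda>(t, x). f t x)"
    and cont': "continuous_on ({-e<..<e} \<times> UNIV) (\<lambda>(t, x). f' t x)"
    and b: "(b has_vector_derivative b') (at 0)" and b_pos: "b 0 > 0"
  shows "((\<lambda>t. integral {0..b t} (f t)) has_vector_derivative
      b' * f 0 (b 0) + integral {0..b 0} (f' 0)) (at 0)"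
proof -
  define I where "I = {-e<..<e}"
  define Y where "Y = {0::real<..}"
  have cont_x: "continuous_on X (f t)" if "t \<in> I" for t X
    by (rule continuous_on_compose2[OF cont, of _ "\<lambda>x. (t, x)", simplified])
       (use that in \<open>auto intro!: continuous_intros simp: I_def\<close>)
  have part_t: "((\<lambda>t. integral {0..b 0} (f t)) has_derivative
      (\<lambda>h. h *\<^sub>R integral {0..b 0} (f' 0))) (at 0 within I)"
  proof -
    have "((\<lambda>t. integral (cbox 0 (b 0)) (f t)) has_vector_derivative
        integral (cbox 0 (b 0)) (f' 0)) (at 0 within I)"
    proof (rule leibniz_rule_vector_derivative)
      show "f t integrable_on cbox 0 (b 0)" if "t \<in> I" for t
        by (rule integrable_continuous[OF cont_x[OF that]])
      show "continuous_on (I \<times> cbox 0 (b 0)) (\<lambda>(t, x). f' t x)"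
        by (rule continuous_on_subset[OF cont']) (auto simp: I_def)
    qed (use \<open>e > 0\<close> in \<open>auto intro!: has_vector_derivative_at_within[OF der] simp: I_def\<close>)
    then show ?thesis by (simp add: has_vector_derivative_def)
  qed
  have part_y: "((\<lambda>y. integral {0..y} (f t)) has_derivative
      blinfun_apply (blinfun_scaleR_left (f t y))) (at y within Y)" if "t \<in> I" "y \<in> Y" for t y
  proof -
    have "((\<lambda>y. integral {0..y} (f t)) has_vector_derivative f t y) (at y within {0..y+1})"
      by (rule integral_has_vector_derivative[OF cont_x]) (use that in \<open>auto simp: Y_def\<close>)
    then have "((\<lambda>y. integral {0..y} (f t)) has_vector_derivative f t y) (at y)"
      using at_within_interior[of y "{0..y+1}"] that by (simp add: interior_atLeastAtMost_real Y_def)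
    then show ?thesis
      unfolding has_vector_derivative_def blinfun_scaleR_left.rep_eq
      by (rule has_derivative_at_withinI)
  qed
  have "continuous (at (0, b 0) within I \<times> Y) (\<lambda>(t, y). blinfun_scaleR_left (f t y))"
  proof -
    have "((\<lambda>(t, y). f t y) \<longlongrightarrow> f 0 (b 0)) (at (0, b 0) within I \<times> UNIV)"
      using cont \<open>e > 0\<close> by (auto simp: continuous_on_def I_def)
    then have "((\<lambda>(t, y). f t y) \<longlongrightarrow> f 0 (b 0)) (at (0, b 0) within I \<times> Y)"
      by (rule tendsto_within_subset) auto
    then show ?thesis
      unfolding case_prod_unfold continuous_within by (simp add: tendsto_intros)
  qed
  from has_derivative_partialsI[OF part_t part_y this]
  have both: "((\<lambda>(t, y). integral {0..y} (f t)) has_derivative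
      (\<lambda>(h, k). h *\<^sub>R integral {0..b 0} (f' 0) + blinfun_apply (blinfun_scaleR_left (f 0 (b 0))) k))
      (at (0, b 0) within I \<times> Y)"
    using \<open>e > 0\<close> b_pos by (auto simp: I_def Y_def)
  have "at (0, b 0) within I \<times> Y = at (0, b 0)"
    using \<open>e > 0\<close> b_pos by (intro at_within_open open_Times) (auto simp: I_def Y_def)
  with both have both: "((\<lambda>z. integral {0..snd z} (f (fst z))) has_derivative
      (\<lambda>z. fst z *\<^sub>R integral {0..b 0} (f' 0) + snd z *\<^sub>R f 0 (b 0))) (at (0, b 0))"
    by (simp add: case_prod_unfold)
  have "((\<lambda>t. (t, b t)) has_derivative (\<lambda>h. (h, h *\<^sub>R b'))) (at 0)"
    using b by (auto intro!: has_derivative_Pair simp: has_vector_derivative_def)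
  from has_derivative_compose[OF this, of "\<lambda>z. integral {0..snd z} (f (fst z))", OF both]
  show ?thesis
    by (simp add: has_vector_derivative_def algebra_simps)
qed

section \<open>Smooth periodic test functions\<close>

lemma smooth_on_has_vector_derivative:
  assumes "smooth_on S f" "x \<in> S"
  shows "(f has_vector_derivative ddx f x) (at x)"
  using smooth_on_has_derivative[OF assms] vector_derivative_works differentiableI
  unfolding ddx_def by blast

lemma ddx_eqI: "(f has_vector_derivative f') (at x) \<Longrightarrow> ddx f x = f'"
  unfolding ddx_def by (rule vector_derivative_at)

lemma ddx_eq_dirderiv:
  assumes "smooth_on S f" "x \<in> S"
  shows "ddx f x = dirderiv f 1 x"
  using smooth_on_chain[OF assms(1), of "\<lambda>t. t" x 1] assms(2)
  by (intro ddx_eqI) auto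

lemma smooth_on_ddx:
  assumes "open S" "smooth_on S f"
  shows "smooth_on S (ddx f)"
  by (rule smooth_on_cong[OF assms(1) ddx_eq_dirderiv[OF assms(2), symmetric] smooth_on_dirderiv[OF assms(2)]])

text \<open>
  Membership in a class of functions that is closed under differentiation propagates to all derivatives.
  The classes used are \<open>{exp}\<close> and the multiples of sine functions of a given frequency.
\<close>
lemma smooth_on_UNIV_if_closed_under_derivative:
  fixes f :: "real \<Rightarrow> real"
  assumes "P f"
    and step: "\<And>f. P f \<Longrightarrow> \<exists>f'. P f' \<and> (\<forall>x. (f has_real_derivative f' x) (at x))"
  shows "smooth_on UNIV f"
proof -
  have "higher_differentiable_on UNIV f n" if "P f" for n f
    using that
  proof (induction n arbitrary: f)
    case 0
    then show ?case
      using step[OF 0] by (auto intro!: continuous_at_imp_continuous_on intro: DERIV_isCont)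
  next
    case (Suc n)
    obtain f' where f': "P f'" "\<And>x. (f has_real_derivative f' x) (at x)"
      using step[OF Suc.prems] by blast
    show ?case
    proof (rule higher_differentiable_on_SucI)
      show "(f has_derivative (\<lambda>v. f' x * v)) (at x)" for x
        using f'(2)[of x] unfolding has_field_derivative_def .
      show "higher_differentiable_on UNIV (\<lambda>x. f' x * v) n" for v
        by (intro higher_differentiable_on_bilinear[OF bounded_bilinear_mult]
              Suc.IH f'(1) higher_differentiable_on_const) auto
    qed auto
  qed
  then show ?thesis using \<open>P f\<close> by (simp add: smooth_on_def)
qed

lemma smooth_on_exp: "smooth_on UNIV (exp :: real \<Rightarrow> real)"
  by (rule smooth_on_UNIV_if_closed_under_derivative[where P = "\<lambda>f. f = exp"]) (auto intro: DERIV_exp)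

lemma smooth_on_sin_affine: "smooth_on UNIV (\<lambda>x. sin (w * x + d) :: real)"
proof (rule smooth_on_UNIV_if_closed_under_derivative[where P = "\<lambda>f. \<exists>a d. f = (\<lambda>x. a * sin (w * x + d))"])
  show "\<exists>a d'. (\<lambda>x. sin (w * x + d)) = (\<lambda>x. a * sin (w * x + d'))"
    by (intro exI[of _ 1] exI[of _ d]) simp
  fix f :: "real \<Rightarrow> real"
  assume "\<exists>a d. f = (\<lambda>x. a * sin (w * x + d))"
  then obtain a d where f: "f = (\<lambda>x. a * sin (w * x + d))" by blast
  have "(f has_real_derivative a * w * sin (w * x + (d + pi / 2))) (at x)" for x
    unfolding f by (auto intro!: derivative_eq_intros simp: sin_add cos_add algebra_simps)
  then show "\<exists>f'. (\<exists>a d. f' = (\<lambda>x. a * sin (w * x + d))) \<and> (\<forall>x. (f has_real_derivative f' x) (at x))"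
    by (intro exI[of _ "\<lambda>x. a * w * sin (w * x + (d + pi / 2))"]) blast
qed

text \<open>
  The product of the two sine functions is \<open>T\<close>-periodic, as both change sign under \<open>x \<mapsto> x + T\<close>. Within
  a period it is negative on \<open>(0, b)\<close> and positive on \<open>(b, T)\<close>; the outer exponentials send large negative
  numbers to values near \<open>1\<close> and large positive ones to values near \<open>0\<close>. As a composition of entire functions
  this is smooth without any case distinction.
\<close>
definition smoothed_step :: "real \<Rightarrow> real \<Rightarrow> nat \<Rightarrow> real \<Rightarrow> real" where
  "smoothed_step T b n x = exp (- exp (real n * (sin (pi * x / T) * sin (pi * (x - b) / T))))"

lemma smoothed_step_smooth_per:
  assumes "T > 0"
  shows "smoothed_step T b n \<in> smooth_per T"
proof -
  have "smooth_on UNIV (\<lambda>x. sin (pi / T * x + 0) * sin (pi / T * x + (- (pi * b / T))))"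
    by (intro smooth_on_mult smooth_on_sin_affine) auto
  then have s: "smooth_on UNIV (\<lambda>x. sin (pi * x / T) * sin (pi * (x - b) / T))"
    by (simp add: algebra_simps diff_divide_distrib)
  have "smooth_on UNIV (smoothed_step T b n)"
    unfolding smoothed_step_def
    by (intro smooth_on_compose[OF _ _ _ smooth_on_exp]
          smooth_on_linear_compose[OF bounded_linear_minus[OF bounded_linear_ident]]
          smooth_on_mult smooth_on_const s) auto
  moreover have "smoothed_step T b n (x + T) = smoothed_step T b n x" for x
  proof -
    have "sin (pi * (x + T) / T) = - sin (pi * x / T)"
      "sin (pi * (x + T - b) / T) = - sin (pi * (x - b) / T)"
      using assms sin_periodic_pi[of "pi * x / T"] sin_periodic_pi[of "pi * (x - b) / T"]
      by (simp_all add: field_simps)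
    then show ?thesis by (simp add: smoothed_step_def)
  qed
  ultimately show ?thesis by (simp add: smooth_per_def)
qed

lemma smoothed_step_tendsto:
  assumes "0 < b" "b < T" "0 < x" "x < T" "x \<noteq> b"
  shows "(\<lambda>n. smoothed_step T b n x) \<longlonglongrightarrow> indicator {0..b} x"
proof -
  define h where "h = sin (pi * x / T) * sin (pi * (x - b) / T)"
  have 1: "sin (pi * x / T) > 0"
    using assms by (intro sin_gt_zero) (auto simp: field_simps)
  show ?thesis
  proof (cases "x < b")
    case True
    have "sin (pi * (x - b) / T) < 0"
    proof -
      have "(b - x) / T < 1" "(b - x) / T > 0" using assms True by (auto simp: field_simps)
      then have "sin (pi * ((b - x) / T)) > 0"
        using mult_strict_left_mono[of "(b - x) / T" 1 pi] by (intro sin_gt_zero mult_pos_pos) simp_all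
      moreover have "pi * ((b - x) / T) = - (pi * (x - b) / T)"
        by (simp add: right_diff_distrib diff_divide_distrib)
      ultimately show ?thesis by (simp add: sin_minus del: minus_divide_left)
    qed
    with 1 have "h < 0" unfolding h_def by (rule mult_pos_neg)
    then have "(\<lambda>n. exp (- exp (real n * h))) \<longlonglongrightarrow> exp (- 0)"
      by (intro tendsto_intros filterlim_compose[OF exp_at_bot])
         (auto intro!: filterlim_tendsto_neg_mult_at_bot tendsto_const filterlim_real_sequentially
               simp: mult.commute[of _ h])
    then show ?thesis using True assms by (simp add: smoothed_step_def h_def)
  next
    case False
    have "(x - b) / T < 1" "(x - b) / T > 0" using assms False by (auto simp: field_simps)
    then have "sin (pi * ((x - b) / T)) > 0"
      using mult_strict_left_mono[of "(x - b) / T" 1 pi] by (intro sin_gt_zero mult_pos_pos) simp_all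
    then have "sin (pi * (x - b) / T) > 0" by simp
    with 1 have "h > 0" unfolding h_def by (rule mult_pos_pos)
    then have "(\<lambda>n. exp (- exp (real n * h))) \<longlonglongrightarrow> 0"
      by (intro filterlim_compose[OF exp_at_bot] filterlim_compose[OF filterlim_uminus_at_bot_at_top]
            filterlim_compose[OF exp_at_top])
         (auto intro!: filterlim_tendsto_pos_mult_at_top tendsto_const filterlim_real_sequentially
               simp: mult.commute[of _ h])
    then show ?thesis using False assms by (simp add: smoothed_step_def h_def)
  qed
qed

lemma smooth_per_const: "(\<lambda>x. c) \<in> smooth_per T"
  by (simp add: smooth_per_def smooth_on_const)

text \<open>
  The sets on which the integral vanishes form a Dynkin system, which contains the half lines and so all
  Borel sets.
\<close>
lemma AE_zero_if_half_line_integrals_zero: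
  fixes F :: "real \<Rightarrow> real"
  assumes F: "integrable lborel F" and zero: "\<And>a. (LINT x:{a<..}|lborel. F x) = 0"
    and total: "(LINT x|lborel. F x) = 0"
  shows "AE x in lborel. F x = 0"
proof (rule sigma_finite_measure.density_zero[OF lborel.sigma_finite_measure_axioms F])
  fix A :: "real set" assume "A \<in> sets lborel"
  then have A: "A \<in> sigma_sets UNIV (range greaterThan)"
    by (simp add: borel_Ioi sets_measure_of_conv)
  have sets: "A \<in> sets borel" if "A \<in> sigma_sets UNIV (range greaterThan)" for A :: "real set"
    using that by (simp add: borel_Ioi sets_measure_of_conv)
  have Int: "Int_stable (range (greaterThan :: real \<Rightarrow> _))"
  proof -
    have "{a<..} \<inter> {b<..} = {max a b<..}" for a b :: real by auto
    then show ?thesis by (auto simp: Int_stable_def)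
  qed
  have sub: "range (greaterThan :: real \<Rightarrow> _) \<subseteq> Pow UNIV" by simp
  show "(LINT x:A|lborel. F x) = 0"
    using A
  proof (induction rule: sigma_sets_induct_disjoint[OF Int sub, consumes 1, case_names basic empty compl union])
    case (compl A)
    have [measurable]: "A \<in> sets borel" using sets compl by blast
    have "(LINT x|lborel. F x) = (LINT x:A \<union> (UNIV - A)|lborel. F x)"
      by (simp add: set_lebesgue_integral_def)
    also have "\<dots> = (LINT x:A|lborel. F x) + (LINT x:UNIV - A|lborel. F x)"
      using F by (intro set_integral_Un) (auto simp: set_integrable_def intro!: integrable_mult_indicator[where 'b = real, simplified])
    finally show ?case using compl total by simp
  next
    case (union A)
    have [measurable]: "A i \<in> sets borel" for i using sets union by blast
    have "(LINT x:(\<Union>i. A i)|lborel. F x) = (\<Sum>i. (LINT x:A i|lborel. F x))"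
      using union F sets
      by (intro lebesgue_integral_countable_add)
         (auto simp: set_integrable_def disjoint_family_on_def intro!: integrable_mult_indicator[where 'b = real, simplified])
    then show ?case using union by simp
  qed (use zero in \<open>auto simp: set_lebesgue_integral_def\<close>)
qed

text \<open>
  The functions \<open>smoothed_step T b n\<close> converge boundedly to the indicator function of \<open>{0..b}\<close>, so that the
  integral of \<open>f\<close> over \<open>{0..b}\<close> vanishes for all \<open>b\<close>.
\<close>
lemma AE_zero_if_orthogonal_to_smooth_per:
  fixes f :: "real \<Rightarrow> real"
  assumes "T > 0" and f: "set_integrable lborel {0..T} f"
    and orth: "\<And>\<phi>. \<phi> \<in> smooth_per T \<Longrightarrow> (LINT x:{0..T}|lborel. f x * \<phi> x) = 0"
  shows "AE x in lborel. x \<in> {0..T} \<longrightarrow> f x = 0"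
proof -
  define F where "F = (\<lambda>x. indicator {0..T} x * f x)"
  have F: "integrable lborel F"
    using f by (simp add: F_def set_integrable_def)
  then have [measurable]: "F \<in> borel_measurable borel" by auto
  have total: "(LINT x|lborel. F x) = 0"
    using orth[OF smooth_per_const[of 1]] by (simp add: F_def set_lebesgue_integral_def)
  have initial: "(LINT x:{0..b}|lborel. F x) = 0" if b: "0 < b" "b < T" for b
  proof -
    have "(\<lambda>n. LINT x|lborel. F x * smoothed_step T b n x) \<longlonglongrightarrow> (LINT x|lborel. F x * indicator {0..b} x)"
    proof (rule integral_dominated_convergence[where w = "\<lambda>x. \<bar>F x\<bar>"])
      have "continuous_on UNIV (smoothed_step T b n)" for n
        using smoothed_step_smooth_per[OF \<open>T > 0\<close>, of b n]
        by (simp add: smooth_per_def smooth_on_imp_continuous_on)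
      then have [measurable]: "smoothed_step T b n \<in> borel_measurable borel" for n
        by (rule borel_measurable_continuous_onI)
      show "(\<lambda>x. F x * smoothed_step T b n x) \<in> borel_measurable lborel" for n by measurable
      have "AE x in lborel. x \<notin> {0, b, T}"
        by (rule AE_not_in) (auto intro!: countable_imp_null_set_lborel)
      then show "AE x in lborel. (\<lambda>n. F x * smoothed_step T b n x) \<longlonglongrightarrow> F x * indicator {0..b} x"
      proof eventually_elim
        case (elim x)
        show ?case
        proof (cases "x \<in> {0..T}")
          case True
          then show ?thesis using elim b by (intro tendsto_mult tendsto_const smoothed_step_tendsto) auto
        qed (simp add: F_def)
      qed
      show "AE x in lborel. norm (F x * smoothed_step T b n x) \<le> \<bar>F x\<bar>" for n
        by (rule AE_I2) (simp add: abs_mult smoothed_step_def mult_left_le)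
    qed (use F in auto)
    moreover have "(LINT x|lborel. F x * smoothed_step T b n x) = 0" for n
      using orth[OF smoothed_step_smooth_per[OF \<open>T > 0\<close>], of b n]
      by (simp add: F_def set_lebesgue_integral_def mult.assoc)
    ultimately have "(LINT x|lborel. F x * indicator {0..b} x) = 0"
      by (simp add: LIMSEQ_const_iff)
    then show ?thesis by (simp add: set_lebesgue_integral_def mult.commute)
  qed
  have "AE x in lborel. F x = 0"
  proof (rule AE_zero_if_half_line_integrals_zero[OF F _ total])
    fix a :: real
    consider "a \<le> 0" | "a \<ge> T" | "0 < a" "a < T" by linarith
    then show "(LINT x:{a<..}|lborel. F x) = 0"
    proof cases
      case 1
      have "(LINT x:{a<..}|lborel. F x) = (LINT x|lborel. F x)"
        unfolding set_lebesgue_integral_def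
      proof (rule integral_cong_AE)
        have "AE x in lborel. x \<notin> {0::real}"
          by (rule AE_not_in) (auto intro!: countable_imp_null_set_lborel)
        then show "AE x in lborel. indicator {a<..} x *\<^sub>R F x = F x"
          by eventually_elim (use 1 in \<open>auto simp: F_def indicator_def\<close>)
      qed auto
      then show ?thesis using total by simp
    next
      case 2
      then have "indicator {a<..} x *\<^sub>R F x = 0" for x by (auto simp: F_def indicator_def)
      then show ?thesis unfolding set_lebesgue_integral_def by (simp only: integral_zero)
    next
      case 3
      have "(LINT x|lborel. F x) = (LINT x:{0..a} \<union> {a<..}|lborel. F x)"
        unfolding set_lebesgue_integral_def
        by (rule Bochner_Integration.integral_cong) (use 3 in \<open>auto simp: F_def indicator_def\<close>)
      also have "\<dots> = (LINT x:{0..a}|lborel. F x) + (LINT x:{a<..}|lborel. F x)"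
        using F by (intro set_integral_Un) (auto simp: set_integrable_def intro!: integrable_mult_indicator[where 'b = real, simplified])
      finally show ?thesis using total initial[of a] 3 by simp
    qed
  qed
  then show ?thesis by eventually_elim (auto simp: F_def indicator_def)
qed

section \<open>Periodic function spaces and the Hessian operator\<close>

lemma smooth_perD:
  assumes "f \<in> smooth_per T"
  shows "smooth_on UNIV f" "f (x + T) = f x" "continuous_on X f"
  using assms continuous_on_subset[OF smooth_on_imp_continuous_on, of UNIV f X]
  by (auto simp: smooth_per_def)

lemma smooth_per_ddx:
  assumes "f \<in> smooth_per T"
  shows "ddx f \<in> smooth_per T"
proof -
  have "ddx f (x + T) = ddx f x" for x
  proof (rule sym, rule ddx_eqI)
    have "((\<lambda>x. x + T) has_vector_derivative 1) (at x)"
      by (auto intro!: derivative_eq_intros)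
    from vector_diff_chain_at[OF this smooth_on_has_vector_derivative[OF smooth_perD(1)[OF assms]]]
    show "(f has_vector_derivative ddx f (x + T)) (at x)"
      using smooth_perD(2)[OF assms] by (simp add: o_def)
  qed
  then show ?thesis using smooth_on_ddx[OF open_UNIV smooth_perD(1)[OF assms]] by (simp add: smooth_per_def)
qed

lemma smooth_per_add: "f \<in> smooth_per T \<Longrightarrow> g \<in> smooth_per T \<Longrightarrow> (\<lambda>x. f x + g x) \<in> smooth_per T"
  by (simp add: smooth_per_def smooth_on_add)

lemma smooth_per_linear: "bounded_linear h \<Longrightarrow> f \<in> smooth_per T \<Longrightarrow> (\<lambda>x. h (f x)) \<in> smooth_per T"
  by (simp add: smooth_per_def smooth_on_linear_compose)

lemma smooth_per_bilinear:
  "bounded_bilinear h \<Longrightarrow> f \<in> smooth_per T \<Longrightarrow> g \<in> smooth_per T \<Longrightarrow> (\<lambda>x. h (f x) (g x)) \<in> smooth_per T"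
  by (simp add: smooth_per_def smooth_on_bilinear)

lemma smooth_per_sum: "(\<And>i. i \<in> I \<Longrightarrow> f i \<in> smooth_per T) \<Longrightarrow> (\<lambda>x. \<Sum>i\<in>I. f i x) \<in> smooth_per T"
  by (simp add: smooth_per_def smooth_on_sum)

lemma integral_ddx_per:
  fixes f :: "real \<Rightarrow> real"
  assumes "f \<in> smooth_per T" "T > 0"
  shows "(LINT x:{0..T}|lborel. ddx f x) = 0"
proof -
  have "continuous_on {0..T} (ddx f)" using smooth_perD(3)[OF smooth_per_ddx[OF assms(1)]] .
  then have "(LINT x:{0..T}|lborel. ddx f x) = integral {0..T} (ddx f)"
    by (intro set_borel_integral_eq_integral borel_integrable_atLeastAtMost') 
  also have "\<dots> = f T - f 0"
    using assms(2)
    by (intro integral_unique fundamental_theorem_of_calculus)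
       (auto intro: has_vector_derivative_at_within[OF smooth_on_has_vector_derivative[OF smooth_perD(1)[OF assms(1)]]])
  finally show ?thesis using smooth_perD(2)[OF assms(1), of 0] by simp
qed

lemma L2_perD:
  assumes "f \<in> L2_per T"
  shows "f \<in> borel_measurable borel" "f (x + T) = f x" "set_integrable lborel {0..T} (\<lambda>x. (norm (f x))\<^sup>2)"
  using assms by (auto simp: L2_per_def)

text \<open>
  The product is dominated by the sum of the squared norms.
\<close>
lemma L2_per_bilinear_integrable:
  fixes h :: "'a::euclidean_space \<Rightarrow> 'b::euclidean_space \<Rightarrow> 'c::euclidean_space"
  assumes h: "bounded_bilinear h" and f: "f \<in> L2_per T" and g: "g \<in> L2_per T"
  shows "set_integrable lborel {0..T} (\<lambda>x. h (f x) (g x))"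
proof -
  obtain K where K: "K > 0" "\<And>a b. norm (h a b) \<le> norm a * norm b * K"
    using bounded_bilinear.pos_bounded[OF h] by blast
  have [measurable]: "f \<in> borel_measurable borel" "g \<in> borel_measurable borel"
    using f g L2_perD by blast+
  have "continuous_on UNIV (\<lambda>z. h (fst z) (snd z))"
    by (intro bounded_bilinear.continuous_on[OF h] continuous_intros)
  then have "(\<lambda>z. h (fst z) (snd z)) \<in> borel_measurable borel"
    by (rule borel_measurable_continuous_onI)
  moreover have "(\<lambda>x. (f x, g x)) \<in> borel_measurable borel" by measurable
  ultimately have meas: "(\<lambda>x. h (f x) (g x)) \<in> borel_measurable borel"
    using measurable_compose[of "\<lambda>x. (f x, g x)" borel borel "\<lambda>z. h (fst z) (snd z)" borel] by simp
  show ?thesis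
  proof (rule set_integrable_bound[of _ _ "\<lambda>x. K * ((norm (f x))\<^sup>2 + (norm (g x))\<^sup>2)"])
    show "set_integrable lborel {0..T} (\<lambda>x. K * ((norm (f x))\<^sup>2 + (norm (g x))\<^sup>2))"
      by (intro set_integrable_mult_right set_integral_add L2_perD f g)
    show "set_borel_measurable lborel {0..T} (\<lambda>x. h (f x) (g x))"
      using meas unfolding set_borel_measurable_def by measurable
    have "norm (h a b) \<le> K * ((norm a)\<^sup>2 + (norm b)\<^sup>2)" for a b
    proof -
      have "0 \<le> (norm a - norm b)\<^sup>2" by simp
      then have "norm a * norm b \<le> (norm a)\<^sup>2 + (norm b)\<^sup>2"
        using zero_le_power2[of "norm a"] zero_le_power2[of "norm b"] unfolding power2_diff by linarith
      then have "norm a * norm b * K \<le> ((norm a)\<^sup>2 + (norm b)\<^sup>2) * K"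
        using K(1) by (intro mult_right_mono) auto
      then show ?thesis using K(2)[of a b] by (simp add: mult.commute)
    qed
    then have "norm (h (f x) (g x)) \<le> norm (K * ((norm (f x))\<^sup>2 + (norm (g x))\<^sup>2))" for x
      using K(1) by (simp add: abs_of_nonneg)
    then show "AE x in lborel. x \<in> {0..T} \<longrightarrow> norm (h (f x) (g x)) \<le> norm (K * ((norm (f x))\<^sup>2 + (norm (g x))\<^sup>2))"
      by simp
  qed
qed

lemmas L2_per_inner_integrable = L2_per_bilinear_integrable[OF bounded_bilinear_inner]
lemmas L2_per_mult_integrable = L2_per_bilinear_integrable[OF bounded_bilinear_mult]

lemma smooth_per_subset_L2_per:
  fixes f :: "real \<Rightarrow> 'a::euclidean_space"
  assumes "f \<in> smooth_per T"
  shows "f \<in> L2_per T"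
proof -
  have "continuous_on UNIV f" using assms by (rule smooth_perD)
  moreover have "set_integrable lborel {0..T} (\<lambda>x. (norm (f x))\<^sup>2)"
    by (intro borel_integrable_atLeastAtMost' continuous_intros smooth_perD(3)[OF assms])
  ultimately show ?thesis
    using smooth_perD(2)[OF assms] by (simp add: L2_per_def borel_measurable_continuous_onI)
qed

lemma L2_per_integrable:
  assumes "f \<in> L2_per T"
  shows "set_integrable lborel {0..T} f"
  using L2_per_bilinear_integrable[OF bounded_bilinear_scaleR smooth_per_subset_L2_per[OF smooth_per_const] assms, of 1]
  by simp

lemma L2_per_add_scaleR:
  assumes "f \<in> L2_per T" "g \<in> L2_per T"
  shows "(\<lambda>x. f x + r *\<^sub>R g x) \<in> L2_per T"
proof -
  have [measurable]: "f \<in> borel_measurable borel" "g \<in> borel_measurable borel"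
    using assms L2_perD by blast+
  have "set_integrable lborel {0..T} (\<lambda>x. (norm (f x))\<^sup>2 + 2 * r * (f x \<bullet> g x) + r\<^sup>2 * (norm (g x))\<^sup>2)"
    by (intro set_integral_add set_integrable_mult_right L2_perD L2_per_inner_integrable assms)
  moreover have "(norm (f x + r *\<^sub>R g x))\<^sup>2 = (norm (f x))\<^sup>2 + 2 * r * (f x \<bullet> g x) + r\<^sup>2 * (norm (g x))\<^sup>2" for x
    using inner_commute[of "g x" "f x"]
    unfolding power2_norm_eq_inner inner_add_left inner_add_right by (simp add: power2_eq_square)
  ultimately show ?thesis using assms by (simp add: L2_per_def)
qed

lemma L2_inner_commute: "L2_inner T V W = L2_inner T W V"
  by (simp add: L2_inner_def inner_commute)

lemma L2_inner_linear_right: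
  assumes "V \<in> L2_per T" "W \<in> L2_per T" "X \<in> L2_per T"
  shows "L2_inner T X (\<lambda>x. V x + r *\<^sub>R W x) = L2_inner T X V + r * L2_inner T X W"
  unfolding L2_inner_def inner_add_right inner_scaleR_right
  using assms by (simp add: set_integral_add set_integrable_mult_right L2_per_inner_integrable)

lemma L2_inner_linear_left:
  assumes "V \<in> L2_per T" "W \<in> L2_per T" "X \<in> L2_per T"
  shows "L2_inner T (\<lambda>x. V x + r *\<^sub>R W x) X = L2_inner T V X + r * L2_inner T W X"
  using L2_inner_linear_right[OF assms] by (simp add: L2_inner_commute)

lemma L2_per_component:
  fixes f :: "real \<Rightarrow> real^'n::finite"
  shows "f \<in> L2_per T \<Longrightarrow> (\<lambda>x. f x $ k) \<in> L2_per T"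
proof -
  assume f: "f \<in> L2_per T"
  have [measurable]: "f \<in> borel_measurable borel" using f by (rule L2_perD)
  have "(\<lambda>x. f x \<bullet> axis k 1) \<in> borel_measurable borel" by measurable
  then have [measurable]: "(\<lambda>x. f x $ k) \<in> borel_measurable borel" by (simp add: inner_axis)
  have "set_integrable lborel {0..T} (\<lambda>x. (norm (f x $ k))\<^sup>2)"
  proof (rule set_integrable_bound[OF L2_perD(3)[OF f]])
    show "set_borel_measurable lborel {0..T} (\<lambda>x. (norm (f x $ k))\<^sup>2)"
      unfolding set_borel_measurable_def by measurable
    show "AE x in lborel. x \<in> {0..T} \<longrightarrow> norm ((norm (f x $ k))\<^sup>2) \<le> norm ((norm (f x))\<^sup>2)"
      by (intro AE_I2 impI) (simp add: abs_le_square_iff[symmetric] component_le_norm_cart)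
  qed
  then show "(\<lambda>x. f x $ k) \<in> L2_per T" using f by (simp add: L2_per_def)
qed

text \<open>
  A square integrable function is determined almost everywhere by its products with smooth periodic ones.
  This is what makes \<open>Hess_op\<close>, which selects one function from an almost everywhere class, well behaved
  inside inner products.
\<close>
lemma L2_inner_cong_if_equal_on_smooth_per:
  fixes W1 W2 :: "real \<Rightarrow> real^'n::finite"
  assumes "T > 0" and W: "W1 \<in> L2_per T" "W2 \<in> L2_per T" and V: "V \<in> L2_per T"
    and eq: "\<And>\<phi>. \<phi> \<in> smooth_per T \<Longrightarrow> L2_inner T W1 \<phi> = L2_inner T W2 \<phi>"
  shows "L2_inner T V W1 = L2_inner T V W2"
proof -
  define W where "W = (\<lambda>x. W1 x + (- 1) *\<^sub>R W2 x)"
  have W': "W \<in> L2_per T" unfolding W_def using W by (rule L2_per_add_scaleR)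
  have "AE x in lborel. x \<in> {0..T} \<longrightarrow> W x $ i = 0" for i
  proof (rule AE_zero_if_orthogonal_to_smooth_per[OF \<open>T > 0\<close> L2_per_integrable[OF L2_per_component[OF W']]])
    fix \<phi> :: "real \<Rightarrow> real" assume \<phi>: "\<phi> \<in> smooth_per T"
    then have \<phi>i: "(\<lambda>x. \<phi> x *\<^sub>R axis i 1 :: real^'n) \<in> smooth_per T"
      by (intro smooth_per_linear[where h = "\<lambda>y. y *\<^sub>R axis i 1"] bounded_linear_scaleR_left)
    have "L2_inner T W (\<lambda>x. \<phi> x *\<^sub>R axis i 1) = 0"
      unfolding W_def using L2_inner_linear_left[OF W smooth_per_subset_L2_per[OF \<phi>i], of "-1"] eq[OF \<phi>i] by simp
    then show "(LINT x:{0..T}|lborel. W x $ i * \<phi> x) = 0"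
      by (simp add: L2_inner_def inner_axis mult.commute)
  qed
  then have "AE x in lborel. \<forall>i. x \<in> {0..T} \<longrightarrow> W x $ i = 0" 
    by (subst AE_all_countable) blast
  then have ae: "AE x in lborel. x \<in> {0..T} \<longrightarrow> V x \<bullet> W x = 0"
    by eventually_elim (auto simp: inner_vec_def)
  have "L2_inner T V W = (LINT x:{0..T}|lborel. 0)"
    unfolding L2_inner_def
  proof (rule set_lebesgue_integral_cong_AE)
    have [measurable]: "V \<in> borel_measurable borel" "W \<in> borel_measurable borel"
      using L2_perD(1)[OF V] L2_perD(1)[OF W'] .
    show "(\<lambda>x. V x \<bullet> W x) \<in> borel_measurable lborel" by measurable
  qed (use ae in auto)
  then show ?thesis using L2_inner_linear_right[OF W V, of "-1"] by (simp add: W_def)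
qed

text \<open>
  The classical derivative is a weak one, by periodic integration by parts.
\<close>
lemma smooth_per_subset_sobolev_per:
  assumes "f \<in> smooth_per T" "T > 0"
  shows "f \<in> sobolev_per T s"
  using assms(1)
proof (induction s arbitrary: f)
  case 0
  then show ?case by (simp add: smooth_per_subset_L2_per)
next
  case (Suc s)
  have "weak_deriv_per T f (ddx f)"
    unfolding weak_deriv_per_def
  proof
    fix \<phi> :: "real \<Rightarrow> real" assume \<phi>: "\<phi> \<in> smooth_per T"
    have "ddx (\<lambda>x. f x * \<phi> x) x = f x * ddx \<phi> x + ddx f x * \<phi> x" for x
      by (intro ddx_eqI has_vector_derivative_mult 
        smooth_on_has_vector_derivative[OF smooth_perD(1)[OF Suc.prems]]
        smooth_on_has_vector_derivative[OF smooth_perD(1)[OF \<phi>]]) auto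
    then have "0 = (LINT x:{0..T}|lborel. f x * ddx \<phi> x + ddx f x * \<phi> x)"
      using integral_ddx_per[OF smooth_per_bilinear[OF bounded_bilinear_mult Suc.prems \<phi>] \<open>T > 0\<close>] by simp
    also have "\<dots> = (LINT x:{0..T}|lborel. f x * ddx \<phi> x) + (LINT x:{0..T}|lborel. ddx f x * \<phi> x)"
      by (intro set_integral_add L2_per_mult_integrable smooth_per_subset_L2_per smooth_per_ddx Suc.prems \<phi>)
    finally show "(LINT x:{0..T}|lborel. f x * ddx \<phi> x) = - (LINT x:{0..T}|lborel. ddx f x * \<phi> x)" by simp
  qed
  then show ?case
    using Suc.IH[OF smooth_per_ddx[OF Suc.prems]] smooth_per_subset_L2_per[OF Suc.prems] by auto
qed

lemma sobolev_per_subset_L2_per: "f \<in> sobolev_per T s \<Longrightarrow> f \<in> L2_per T"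
  by (cases s) auto

lemma sobolev_per_add_scaleR:
  "f \<in> sobolev_per T s \<Longrightarrow> g \<in> sobolev_per T s \<Longrightarrow> (\<lambda>x. f x + r *\<^sub>R g x) \<in> sobolev_per T s"
proof (induction s arbitrary: f g)
  case 0
  then show ?case using L2_per_add_scaleR[of f T g r] by simp
next
  case (Suc s)
  then obtain f' g' where f': "f' \<in> sobolev_per T s" "weak_deriv_per T f f'"
      and g': "g' \<in> sobolev_per T s" "weak_deriv_per T g g'" and fg: "f \<in> L2_per T" "g \<in> L2_per T" by auto
  have "weak_deriv_per T (\<lambda>x. f x + r *\<^sub>R g x) (\<lambda>x. f' x + r *\<^sub>R g' x)"
    unfolding weak_deriv_per_def
  proof
    fix \<phi> :: "real \<Rightarrow> real" assume \<phi>: "\<phi> \<in> smooth_per T"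
    have split: "(LINT x:{0..T}|lborel. (a x + r *\<^sub>R b x) * \<psi> x)
        = (LINT x:{0..T}|lborel. a x * \<psi> x) + r * (LINT x:{0..T}|lborel. b x * \<psi> x)"
      if "a \<in> L2_per T" "b \<in> L2_per T" "\<psi> \<in> smooth_per T" for a b \<psi> :: "real \<Rightarrow> real"
    proof -
      have "(LINT x:{0..T}|lborel. (a x + r *\<^sub>R b x) * \<psi> x)
        = (LINT x:{0..T}|lborel. a x * \<psi> x + r * (b x * \<psi> x))" by (simp add: algebra_simps)
      also have "\<dots> = (LINT x:{0..T}|lborel. a x * \<psi> x) + (LINT x:{0..T}|lborel. r * (b x * \<psi> x))"
        by (intro set_integral_add set_integrable_mult_right L2_per_mult_integrable smooth_per_subset_L2_per that)
      finally show ?thesis by simp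
    qed
    show "(LINT x:{0..T}|lborel. (f x + r *\<^sub>R g x) * ddx \<phi> x) = - (LINT x:{0..T}|lborel. (f' x + r *\<^sub>R g' x) * \<phi> x)"
      using split[OF fg smooth_per_ddx[OF \<phi>]] split[OF _ _ \<phi>, of f' g'] f' g' \<phi> sobolev_per_subset_L2_per
      by (simp add: weak_deriv_per_def)
  qed
  then show ?case using Suc.IH[OF f'(1) g'(1)] L2_per_add_scaleR[OF fg] by auto
qed


lemma HH_0_eq_L2_per: "HH k T 0 = L2_per T"
  by (auto simp: HH_def L2_per_component)

lemma fun_linear_combination:
  fixes V W :: "real \<Rightarrow> 'a::real_vector"
  shows "V + r *\<^sub>R W = (\<lambda>x. V x + r *\<^sub>R W x)"
  by (simp add: fun_eq_iff scaleR_fun_def)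

text \<open>
  The vector space operations of the function type are pointwise; this form spares unfolding them.
\<close>
lemma subspace_funI:
  fixes D :: "(real \<Rightarrow> 'a::real_vector) set"
  assumes "(\<lambda>x. 0) \<in> D" "\<And>V W r. V \<in> D \<Longrightarrow> W \<in> D \<Longrightarrow> (\<lambda>x. V x + r *\<^sub>R W x) \<in> D"
  shows "subspace D"
  unfolding subspace_def
proof (intro conjI ballI allI)
  show zero: "0 \<in> D" using assms(1) by (simp add: zero_fun_def)
  show "V + W \<in> D" if "V \<in> D" "W \<in> D" for V W
    using assms(2)[OF that, of 1] by (simp add: plus_fun_def)
  show "c *\<^sub>R V \<in> D" if "V \<in> D" for c V
    using assms(2)[OF assms(1) that, of c] by (simp add: scaleR_fun_def)
qed

lemma Hess_dist_linear:
  assumes Hess_smooth: "\<And>\<phi>. \<phi> \<in> smooth_per T \<Longrightarrow> Hess F U \<phi> \<in> smooth_per T"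
    and V: "V \<in> L2_per T" "W \<in> L2_per T"
    and d: "Hess_dist k T F U V V'" "Hess_dist k T F U W W'"
  shows "Hess_dist k T F U (\<lambda>x. V x + r *\<^sub>R W x) (\<lambda>x. V' x + r *\<^sub>R W' x)"
proof -
  have L2: "V' \<in> L2_per T" "W' \<in> L2_per T" using d by (auto simp: Hess_dist_def HH_0_eq_L2_per)
  have "L2_inner T (\<lambda>x. V' x + r *\<^sub>R W' x) \<phi> = L2_inner T (\<lambda>x. V x + r *\<^sub>R W x) (Hess F U \<phi>)"
    if \<phi>: "\<phi> \<in> smooth_per T" for \<phi>
    using L2_inner_linear_left[OF L2 smooth_per_subset_L2_per[OF \<phi>], of r]
      L2_inner_linear_left[OF V smooth_per_subset_L2_per[OF Hess_smooth[OF \<phi>]], of r] d \<phi>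
    by (simp add: Hess_dist_def)
  then show ?thesis using L2_per_add_scaleR[OF L2, of r] by (simp add: Hess_dist_def HH_0_eq_L2_per)
qed

lemma Hess_domainD:
  assumes "V \<in> Hess_domain k T F U"
  shows "V \<in> L2_per T" "Hess_dist k T F U V (Hess_op k T F U V)" "Hess_op k T F U V \<in> L2_per T"
proof -
  show "V \<in> L2_per T" using assms by (simp add: Hess_domain_def HH_def)
  show *: "Hess_dist k T F U V (Hess_op k T F U V)"
    unfolding Hess_op_def using assms by (intro someI_ex[of "Hess_dist k T F U V"]) (simp add: Hess_domain_def)
  then show "Hess_op k T F U V \<in> L2_per T" by (simp add: Hess_dist_def HH_0_eq_L2_per)
qed

lemma subspace_Hess_domain:
  assumes Hess_smooth: "\<And>\<phi>. \<phi> \<in> smooth_per T \<Longrightarrow> Hess F U \<phi> \<in> smooth_per T" and "T > 0"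
  shows "subspace (Hess_domain k T F U)"
proof (rule subspace_funI)
  have "Hess_dist k T F U (\<lambda>x. 0) (\<lambda>x. 0)"
    using smooth_per_subset_L2_per[OF smooth_per_const]
    by (auto simp: Hess_dist_def HH_0_eq_L2_per L2_inner_def)
  moreover have "(\<lambda>x. 0) \<in> HH k T 2"
    using smooth_per_subset_L2_per[OF smooth_per_const]
      smooth_per_subset_sobolev_per[OF smooth_per_const \<open>T > 0\<close>, of 0 2] by (simp add: HH_def)
  ultimately show "(\<lambda>x. 0) \<in> Hess_domain k T F U" by (auto simp: Hess_domain_def)
  fix V W r assume VW: "V \<in> Hess_domain k T F U" "W \<in> Hess_domain k T F U"
  then have "(\<lambda>x. V x + r *\<^sub>R W x) \<in> HH k T 2"
    using L2_per_add_scaleR[of V T W r] sobolev_per_add_scaleR[of "\<lambda>x. V x $ k" T 2 "\<lambda>x. W x $ k" r]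
    by (auto simp: Hess_domain_def HH_def)
  then show "(\<lambda>x. V x + r *\<^sub>R W x) \<in> Hess_domain k T F U"
    using Hess_dist_linear[OF Hess_smooth Hess_domainD(1)[OF VW(1)] Hess_domainD(1)[OF VW(2)]
        Hess_domainD(2)[OF VW(1)] Hess_domainD(2)[OF VW(2)]]
    by (auto simp: Hess_domain_def)
qed

lemma Hess_dist_smooth:
  assumes "\<And>\<phi>. \<phi> \<in> smooth_per T \<Longrightarrow> Hess F U \<phi> \<in> smooth_per T"
    and "\<And>\<phi> \<psi>. \<phi> \<in> smooth_per T \<Longrightarrow> \<psi> \<in> smooth_per T \<Longrightarrow>
      L2_inner T (Hess F U \<phi>) \<psi> = L2_inner T \<phi> (Hess F U \<psi>)"
    and "\<phi> \<in> smooth_per T"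
  shows "Hess_dist k T F U \<phi> (Hess F U \<phi>)"
  using assms by (auto simp: Hess_dist_def HH_0_eq_L2_per smooth_per_subset_L2_per)

lemma smooth_per_subset_Hess_domain:
  assumes "\<And>\<phi>. \<phi> \<in> smooth_per T \<Longrightarrow> Hess F U \<phi> \<in> smooth_per T"
    and "\<And>\<phi> \<psi>. \<phi> \<in> smooth_per T \<Longrightarrow> \<psi> \<in> smooth_per T \<Longrightarrow>
      L2_inner T (Hess F U \<phi>) \<psi> = L2_inner T \<phi> (Hess F U \<psi>)"
    and \<phi>: "\<phi> \<in> smooth_per T" and "T > 0"
  shows "\<phi> \<in> Hess_domain k T F U"
proof -
  have "(\<lambda>x. \<phi> x $ k) \<in> smooth_per T" using \<phi> by (rule smooth_per_linear[OF bounded_linear_vec_nth])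
  then show ?thesis
    using Hess_dist_smooth[OF assms(1,2) \<phi>, of k] smooth_per_subset_L2_per[OF \<phi>] smooth_per_subset_sobolev_per[OF _ \<open>T > 0\<close>]
    unfolding Hess_domain_def HH_def by blast
qed

text \<open>
  The image of \<open>w + \<phi>\<close> may be replaced by the sum of the images. The two mixed terms then agree because, by
  definition of \<open>Hess_op\<close>, testing the image of \<open>w\<close> against the smooth function \<open>\<phi>\<close> moves the Hessian to \<open>\<phi>\<close>.
\<close>
lemma Hess_form_add_smooth:
  assumes Hess_smooth: "\<And>\<phi>. \<phi> \<in> smooth_per T \<Longrightarrow> Hess F U \<phi> \<in> smooth_per T"
    and Hess_sym: "\<And>\<phi> \<psi>. \<phi> \<in> smooth_per T \<Longrightarrow> \<psi> \<in> smooth_per T \<Longrightarrow>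
      L2_inner T (Hess F U \<phi>) \<psi> = L2_inner T \<phi> (Hess F U \<psi>)"
    and "T > 0" and w: "w \<in> Hess_domain k T F U" and \<phi>: "\<phi> \<in> smooth_per T"
  shows "L2_inner T (w + \<phi>) (Hess_op k T F U (w + \<phi>)) =
    L2_inner T w (Hess_op k T F U w) + 2 * L2_inner T w (Hess F U \<phi>) + L2_inner T \<phi> (Hess F U \<phi>)"
proof -
  have \<phi>D: "\<phi> \<in> Hess_domain k T F U"
    by (rule smooth_per_subset_Hess_domain[OF Hess_smooth Hess_sym \<phi> \<open>T > 0\<close>])
  have "w + \<phi> \<in> Hess_domain k T F U"
    using subspace_add[OF subspace_Hess_domain[OF Hess_smooth \<open>T > 0\<close>] w \<phi>D] .
  note sum = Hess_domainD[OF this] and w' = Hess_domainD[OF w]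
  have \<phi>2: "\<phi> \<in> L2_per T" "Hess F U \<phi> \<in> L2_per T"
    using smooth_per_subset_L2_per \<phi> Hess_smooth by blast+
  have sum_eq: "w + \<phi> = (\<lambda>x. w x + 1 *\<^sub>R \<phi> x)" by (simp add: fun_eq_iff)
  define Y where "Y = (\<lambda>x. Hess_op k T F U w x + 1 *\<^sub>R Hess F U \<phi> x)"
  have Y: "Y \<in> L2_per T" unfolding Y_def by (rule L2_per_add_scaleR[OF w'(3) \<phi>2(2)])
  have "Hess_dist k T F U (w + \<phi>) Y"
    unfolding sum_eq Y_def
    by (rule Hess_dist_linear[OF Hess_smooth w'(1) \<phi>2(1) w'(2) Hess_dist_smooth[OF Hess_smooth Hess_sym \<phi>]])
  then have "L2_inner T (w + \<phi>) (Hess_op k T F U (w + \<phi>)) = L2_inner T (w + \<phi>) Y"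
    using sum(2) by (intro L2_inner_cong_if_equal_on_smooth_per[OF \<open>T > 0\<close> sum(3) Y sum(1)]) (simp add: Hess_dist_def)
  also have "\<dots> = L2_inner T w Y + L2_inner T \<phi> Y"
    unfolding sum_eq using L2_inner_linear_left[OF w'(1) \<phi>2(1) Y, of 1] by simp
  also have "L2_inner T w Y = L2_inner T w (Hess_op k T F U w) + L2_inner T w (Hess F U \<phi>)"
    unfolding Y_def using L2_inner_linear_right[OF w'(3) \<phi>2(2) w'(1), of 1] by simp
  also have "L2_inner T \<phi> Y = L2_inner T \<phi> (Hess_op k T F U w) + L2_inner T \<phi> (Hess F U \<phi>)"
    unfolding Y_def using L2_inner_linear_right[OF w'(3) \<phi>2(2) \<phi>2(1), of 1] by simp
  also have "L2_inner T \<phi> (Hess_op k T F U w) = L2_inner T w (Hess F U \<phi>)"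
    using w'(2) \<phi> by (simp add: Hess_dist_def L2_inner_commute)
  finally show ?thesis by (simp add: sum_eq)
qed

section \<open>First and second variation\<close>

lemma axis_nth_eq: "axis \<alpha> (1::real) $ k = (if \<alpha> = k then 1 else 0)"
  by (simp add: axis_def)

text \<open>
  Densities that depend on \<open>U_x\<close> through the component \<open>k\<close> only are functions \<open>L\<close> on the space of jets
  \<open>(U, v_x)\<close>; all their derivatives are then ordinary derivatives of \<open>L\<close>.
\<close>
definition density :: "'n::finite \<Rightarrow> ((real^'n) \<times> real \<Rightarrow> real) \<Rightarrow> real^'n \<Rightarrow> real^'n \<Rightarrow> real" where
  "density k L a b = L (a, b $ k)"

definition jet :: "'n::finite \<Rightarrow> (real \<Rightarrow> real^'n) \<Rightarrow> real \<Rightarrow> (real^'n) \<times> real" where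
  "jet k u x = (u x, ddx u x $ k)"

text \<open>
  The linearized Euler-Lagrange operator. The case distinction between \<open>\<alpha> = k\<close> and \<open>\<alpha> \<noteq> k\<close> is hidden in
  \<open>axis \<alpha> 1 $ k\<close>, which is \<open>1\<close> or \<open>0\<close>: in the second case the inner direction is zero, and so is the total
  derivative.
\<close>
definition second_variation ::
  "'n::finite \<Rightarrow> ((real^'n) \<times> real \<Rightarrow> real) \<Rightarrow> (real \<Rightarrow> real^'n) \<Rightarrow> (real \<Rightarrow> real^'n) \<Rightarrow> real \<Rightarrow> real^'n" where
  "second_variation k L u V x = (\<chi> \<alpha>.
     dirderiv (dirderiv L (axis \<alpha> 1, 0)) (jet k V x) (jet k u x)
     - ddx (\<lambda>y. dirderiv (dirderiv L (0, axis \<alpha> 1 $ k)) (jet k V y) (jet k u y)) x)"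

lemma dirderiv_linear:
  assumes "smooth_on S f" "x \<in> S"
  shows "linear (\<lambda>v. dirderiv f v x)"
  using smooth_on_has_derivative[OF assms] by (rule has_derivative_linear)

lemma dirderiv_zero: "smooth_on S f \<Longrightarrow> x \<in> S \<Longrightarrow> dirderiv f 0 x = 0"
  using linear_0[OF dirderiv_linear] .

lemma dirderiv_chain:
  fixes g :: "'a::real_normed_vector \<Rightarrow> 'b::real_normed_vector"
  assumes f: "smooth_on T f" and g: "smooth_on S g" and x: "x \<in> S" "g x \<in> T"
  shows "dirderiv (\<lambda>x. f (g x)) v x = dirderiv f (dirderiv g v x) (g x)"
proof -
  have "((\<lambda>x. f (g x)) has_derivative (\<lambda>v. dirderiv f (dirderiv g v x) (g x))) (at x)"
    using has_derivative_compose[OF smooth_on_has_derivative[OF g x(1)] smooth_on_has_derivative[OF f x(2)]] .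
  from frechet_derivative_at[OF this] show ?thesis by metis
qed

lemma second_derivative_linear:
  fixes L :: "'a::euclidean_space \<Rightarrow> real"
  assumes "smooth_on UNIV L"
  shows "linear (\<lambda>w. dirderiv (dirderiv L w) v z)"
proof -
  have "(\<lambda>w. dirderiv (dirderiv L w) v z) = (\<lambda>w. dirderiv (dirderiv L v) w z)"
    using dirderiv_commute[OF open_UNIV assms] by simp
  then show ?thesis using dirderiv_linear[OF smooth_on_dirderiv[OF assms]] by simp
qed

text \<open>
  The expansion of the direction in a basis reduces the claim to derivatives in fixed directions.
\<close>
lemma smooth_on_dirderiv_varying:
  fixes f :: "'a::euclidean_space \<Rightarrow> 'b::real_normed_vector" and g v :: "'c::real_normed_vector \<Rightarrow> 'a"
  assumes "smooth_on UNIV f" "open S" "smooth_on S g" "smooth_on S v"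
  shows "smooth_on S (\<lambda>x. dirderiv f (v x) (g x))"
proof -
  have "smooth_on S (\<lambda>x. \<Sum>i\<in>Basis. (v x \<bullet> i) *\<^sub>R dirderiv f i (g x))"
    using assms
    by (intro smooth_on_sum smooth_on_scaleR smooth_on_inner smooth_on_const
        smooth_on_compose[OF assms(2) open_UNIV _ smooth_on_dirderiv[OF assms(1)]]) auto
  moreover have "dirderiv f (v x) (g x) = (\<Sum>i\<in>Basis. (v x \<bullet> i) *\<^sub>R dirderiv f i (g x))" for x
    using smooth_on_has_derivative[OF assms(1)] by (intro dirderiv_sum_Basis) (auto intro: differentiableI)
  ultimately show ?thesis by simp
qed

lemma smooth_on_vec_lambda:
  fixes f :: "'n::finite \<Rightarrow> 'a::real_normed_vector \<Rightarrow> real"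
  assumes "open S" "\<And>\<alpha>. smooth_on S (f \<alpha>)"
  shows "smooth_on S (\<lambda>x. \<chi> \<alpha>. f \<alpha> x)"
proof -
  have "(\<chi> \<alpha>. f \<alpha> x) = (\<Sum>\<alpha>\<in>UNIV. f \<alpha> x *\<^sub>R axis \<alpha> 1)" for x
    using basis_expansion[of "\<chi> \<alpha>. f \<alpha> x"] by (simp add: scalar_mult_eq_scaleR)
  then show ?thesis
    using assms by (simp add: smooth_on_sum smooth_on_scaleR smooth_on_const)
qed

lemma has_vector_derivative_vec_lambda:
  fixes f :: "'n::finite \<Rightarrow> real \<Rightarrow> real"
  assumes "\<And>\<alpha>. (f \<alpha> has_vector_derivative f' \<alpha>) (at t)"
  shows "((\<lambda>t. \<chi> \<alpha>. f \<alpha> t) has_vector_derivative (\<chi> \<alpha>. f' \<alpha>)) (at t)"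
proof -
  have expand: "(\<chi> \<alpha>. g \<alpha>) = (\<Sum>\<alpha>\<in>UNIV. g \<alpha> *\<^sub>R axis \<alpha> 1)" for g :: "'n \<Rightarrow> real"
    using basis_expansion[of "\<chi> \<alpha>. g \<alpha>"] by (simp add: scalar_mult_eq_scaleR)
  show ?thesis
    unfolding expand
    by (intro has_vector_derivative_sum bounded_linear.has_vector_derivative[OF bounded_linear_scaleR_left] assms)
qed

lemma partial_1_density:
  assumes "smooth_on UNIV L"
  shows "partial_1 \<alpha> (density k L) a b = dirderiv L (axis \<alpha> 1, 0) (a, b $ k)"
proof -
  have "((\<lambda>t. L ((a, b $ k) + t *\<^sub>R (axis \<alpha> 1, 0))) has_vector_derivative
      dirderiv L (axis \<alpha> 1, 0) ((a, b $ k) + 0 *\<^sub>R (axis \<alpha> 1, 0))) (at 0)"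
    by (rule smooth_on_chain[OF assms]) (auto intro!: derivative_eq_intros)
  then show ?thesis
    unfolding partial_1_def density_def
    by (intro DERIV_imp_deriv) (simp add: has_real_derivative_iff_has_vector_derivative)
qed

lemma partial_2_density:
  assumes "smooth_on UNIV L"
  shows "partial_2 \<alpha> (density k L) a b = dirderiv L (0, axis \<alpha> 1 $ k) (a, b $ k)"
proof -
  have "((\<lambda>t. L ((a, b $ k) + t *\<^sub>R (0, axis \<alpha> 1 $ k))) has_vector_derivative
      dirderiv L (0, axis \<alpha> 1 $ k) ((a, b $ k) + 0 *\<^sub>R (0, axis \<alpha> 1 $ k))) (at 0)"
    by (rule smooth_on_chain[OF assms]) (auto intro!: derivative_eq_intros)
  then show ?thesis
    unfolding partial_2_def density_def
    by (intro DERIV_imp_deriv) (simp add: has_real_derivative_iff_has_vector_derivative)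
qed

lemma var_deriv_density:
  assumes "smooth_on UNIV L"
  shows "var_deriv (density k L) u x = (\<chi> \<alpha>. dirderiv L (axis \<alpha> 1, 0) (jet k u x)
    - ddx (\<lambda>y. dirderiv L (0, axis \<alpha> 1 $ k) (jet k u y)) x)"
  by (simp add: var_deriv_def partial_1_density[OF assms] partial_2_density[OF assms] jet_def)

lemma smooth_on_slice_fst:
  assumes "smooth_on S f" "(t, x) \<in> S"
  shows "((\<lambda>t. f (t, x)) has_vector_derivative dirderiv f (1, 0) (t, x)) (at (t::real))"
  by (rule smooth_on_chain[OF assms(1)])
     (use assms(2) in \<open>auto intro!: has_vector_derivative_Pair has_vector_derivative_const has_vector_derivative_id\<close>)

lemma smooth_on_slice_snd:
  assumes "smooth_on S f" "(t, x) \<in> S"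
  shows "((\<lambda>x. f (t, x)) has_vector_derivative dirderiv f (0, 1) (t, x)) (at (x::real))"
  by (rule smooth_on_chain[OF assms(1)])
     (use assms(2) in \<open>auto intro!: has_vector_derivative_Pair has_vector_derivative_const has_vector_derivative_id\<close>)

lemma smooth_on_jet_family:
  fixes W :: "real \<Rightarrow> real \<Rightarrow> real^'n::finite"
  assumes J: "open J" and W: "smooth_on (J \<times> UNIV) (\<lambda>(t, x). W t x)"
  shows "smooth_on (J \<times> UNIV) (\<lambda>(t, x). jet k (W t) x)"
proof (rule smooth_on_cong)
  let ?W = "\<lambda>(t, x). W t x"
  show "open (J \<times> (UNIV :: real set))" using J by (intro open_Times) auto
  then show "smooth_on (J \<times> UNIV) (\<lambda>z. (?W z, dirderiv ?W (0, 1) z $ k))"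
    by (intro smooth_on_Pair smooth_on_linear_compose[OF bounded_linear_vec_nth] smooth_on_dirderiv W)
  fix z :: "real \<times> real" assume z: "z \<in> J \<times> UNIV"
  have "ddx (W (fst z)) (snd z) = dirderiv ?W (0, 1) z"
    using smooth_on_slice_snd[OF W, of "fst z" "snd z"] z by (intro ddx_eqI) auto
  then show "(?W z, dirderiv ?W (0, 1) z $ k) = (case z of (t, x) \<Rightarrow> jet k (W t) x)"
    by (auto simp: jet_def split: prod.split)
qed

text \<open>
  The parameter derivative of the jet is the jet of the parameter derivative, by equality of mixed
  derivatives of \<open>W\<close>.
\<close>
lemma jet_family_derivative:
  fixes W :: "real \<Rightarrow> real \<Rightarrow> real^'n::finite"
  assumes J: "open J" "t \<in> J" and W: "smooth_on (J \<times> UNIV) (\<lambda>(t, x). W t x)"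
    and V: "\<And>x. V x = dirderiv (\<lambda>(t, x). W t x) (1, 0) (t, x)"
  shows "dirderiv (\<lambda>(t, x). jet k (W t) x) (1, 0) (t, x) = jet k V x"
proof -
  let ?W = "\<lambda>(t, x). W t x" and ?j = "\<lambda>(t, x). jet k (W t) x"
  have o: "open (J \<times> (UNIV :: real set))" using J by (intro open_Times) auto
  have tx: "(t, y) \<in> J \<times> UNIV" for y :: real using J by simp
  note sj = smooth_on_jet_family[OF J(1) W, of k]
  have 1: "fst (dirderiv ?j (1, 0) (t, x)) = V x"
  proof -
    have "((\<lambda>t. fst (?j (t, x))) has_vector_derivative fst (dirderiv ?j (1, 0) (t, x))) (at t)"
      by (rule bounded_linear.has_vector_derivative[OF bounded_linear_fst smooth_on_slice_fst[OF sj tx]])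
    moreover have "((\<lambda>t. fst (?j (t, x))) has_vector_derivative V x) (at t)"
      using smooth_on_slice_fst[OF W tx] by (simp add: V jet_def)
    ultimately show ?thesis by (rule vector_derivative_unique_at)
  qed
  have 2: "snd (dirderiv ?j (1, 0) (t, x)) = ddx V x $ k"
  proof -
    have "((\<lambda>t. snd (?j (t, x))) has_vector_derivative snd (dirderiv ?j (1, 0) (t, x))) (at t)"
      by (rule bounded_linear.has_vector_derivative[OF bounded_linear_snd smooth_on_slice_fst[OF sj tx]])
    moreover have "((\<lambda>t. snd (?j (t, x))) has_vector_derivative dirderiv (dirderiv ?W (0, 1)) (1, 0) (t, x) $ k) (at t)"
    proof (rule has_vector_derivative_transform_within_open[OF _ J])
      show "((\<lambda>t. dirderiv ?W (0, 1) (t, x) $ k) has_vector_derivative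
          dirderiv (dirderiv ?W (0, 1)) (1, 0) (t, x) $ k) (at t)"
        by (rule bounded_linear.has_vector_derivative[OF bounded_linear_vec_nth
              smooth_on_slice_fst[OF smooth_on_dirderiv[OF W] tx]])
      show "dirderiv ?W (0, 1) (s, x) $ k = snd (?j (s, x))" if "s \<in> J" for s
        using ddx_eqI[OF smooth_on_slice_snd[OF W, of s x]] that by (simp add: jet_def)
    qed
    ultimately have "snd (dirderiv ?j (1, 0) (t, x)) = dirderiv (dirderiv ?W (0, 1)) (1, 0) (t, x) $ k"
      by (rule vector_derivative_unique_at)
    also have "\<dots> = dirderiv (dirderiv ?W (1, 0)) (0, 1) (t, x) $ k"
      using dirderiv_commute[OF o W tx] by simp
    also have "\<dots> = ddx V x $ k"
      using ddx_eqI[OF smooth_on_slice_snd[OF smooth_on_dirderiv[OF W] tx, of "(1, 0)" x]] by (simp add: V[abs_def])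
    finally show ?thesis .
  qed
  show ?thesis using 1 2 by (simp add: jet_def prod_eq_iff)
qed

text \<open>
  Both occurrences of linearization are instances: the Hessian comes from the family \<open>u + t V\<close>, the
  linearized profile equation from moving the parameters of the profile.
\<close>
lemma var_deriv_family_derivative:
  fixes W :: "real \<Rightarrow> real \<Rightarrow> real^'n::finite"
  assumes L: "smooth_on UNIV L" and J: "open J" "0 \<in> J"
    and W: "smooth_on (J \<times> UNIV) (\<lambda>(t, x). W t x)"
    and V: "\<And>x. V x = dirderiv (\<lambda>(t, x). W t x) (1, 0) (0, x)"
  shows "((\<lambda>t. var_deriv (density k L) (W t) x) has_vector_derivative second_variation k L (W 0) V x) (at 0)"
proof -
  let ?j = "\<lambda>(t, x). jet k (W t) x"
  have o: "open (J \<times> (UNIV :: real set))" using J by (intro open_Times) auto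
  have tx: "(0, y) \<in> J \<times> UNIV" for y :: real using J by simp
  note sj = smooth_on_jet_family[OF J(1) W, of k]
  have sG: "smooth_on (J \<times> UNIV) (\<lambda>z. dirderiv L w (?j z))" for w
    by (rule smooth_on_compose[OF o open_UNIV _ smooth_on_dirderiv[OF L] sj]) simp
  have G': "dirderiv (\<lambda>z. dirderiv L w (?j z)) (1, 0) (0, y) = dirderiv (dirderiv L w) (jet k V y) (jet k (W 0) y)" for w y
    using dirderiv_chain[OF smooth_on_dirderiv[OF L, of w] sj tx[of y] UNIV_I, where v = "(1, 0)"]
      jet_family_derivative[OF J W V, of k y] by simp
  show ?thesis
    unfolding var_deriv_density[OF L] second_variation_def
  proof (intro has_vector_derivative_vec_lambda has_vector_derivative_diff)
    fix \<alpha>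
    show "((\<lambda>t. dirderiv L (axis \<alpha> 1, 0) (jet k (W t) x)) has_vector_derivative
        dirderiv (dirderiv L (axis \<alpha> 1, 0)) (jet k V x) (jet k (W 0) x)) (at 0)"
      using smooth_on_slice_fst[OF sG[of "(axis \<alpha> 1, 0)"] tx[of x]] by (simp add: G')
    let ?w = "(0, axis \<alpha> 1 $ k)"
    let ?G = "\<lambda>z. dirderiv L ?w (?j z)"
    show "((\<lambda>t. ddx (\<lambda>y. dirderiv L ?w (jet k (W t) y)) x) has_vector_derivative
        ddx (\<lambda>y. dirderiv (dirderiv L ?w) (jet k V y) (jet k (W 0) y)) x) (at 0)"
    proof (rule has_vector_derivative_transform_within_open[OF _ J])
      have "dirderiv (dirderiv ?G (0, 1)) (1, 0) (0, x) = dirderiv (dirderiv ?G (1, 0)) (0, 1) (0, x)"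
        by (rule dirderiv_commute[OF o sG tx])
      also have "\<dots> = ddx (\<lambda>y. dirderiv (dirderiv L ?w) (jet k V y) (jet k (W 0) y)) x"
        using ddx_eqI[OF smooth_on_slice_snd[OF smooth_on_dirderiv[OF sG[of ?w], of "(1, 0)"] tx[of x]]] by (simp add: G')
      finally show "((\<lambda>t. dirderiv ?G (0, 1) (t, x)) has_vector_derivative
          ddx (\<lambda>y. dirderiv (dirderiv L ?w) (jet k V y) (jet k (W 0) y)) x) (at 0)"
        using smooth_on_slice_fst[OF smooth_on_dirderiv[OF sG[of ?w], of "(0, 1)"] tx[of x]] by simp
      show "dirderiv ?G (0, 1) (t, x) = ddx (\<lambda>y. dirderiv L ?w (jet k (W t) y)) x" if "t \<in> J" for t
        using ddx_eqI[OF smooth_on_slice_snd[OF sG[of ?w], of t x]] that by simp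
    qed
  qed
qed

lemma Hess_eq_second_variation:
  fixes u V :: "real \<Rightarrow> real^'n::finite"
  assumes L: "smooth_on UNIV L" and u: "smooth_on UNIV u" and V: "smooth_on UNIV V"
  shows "Hess (density k L) u V = second_variation k L u V"
proof
  fix x
  have comp: "smooth_on UNIV (\<lambda>z :: real \<times> real. f (snd z))" if "smooth_on UNIV f" for f :: "real \<Rightarrow> real^'n"
    by (rule smooth_on_compose[OF open_UNIV open_UNIV _ that smooth_on_linear[OF bounded_linear_snd open_UNIV]]) simp
  have "smooth_on UNIV (\<lambda>z :: real \<times> real. u (snd z) + fst z *\<^sub>R V (snd z))"
    by (intro smooth_on_add smooth_on_scaleR comp u V smooth_on_linear bounded_linear_fst open_UNIV)
  then have W: "smooth_on (UNIV \<times> UNIV) (\<lambda>(t, x). u x + t *\<^sub>R V x)"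
    by (simp add: case_prod_unfold)
  have "V x = dirderiv (\<lambda>(t, x). u x + t *\<^sub>R V x) (1, 0) (0, x)" for x
  proof -
    have "((\<lambda>t. u x + t *\<^sub>R V x) has_vector_derivative V x) (at 0)"
      by (auto intro!: derivative_eq_intros)
    with smooth_on_slice_fst[OF W, of 0 x] show ?thesis
      using vector_derivative_unique_at by fastforce
  qed
  from var_deriv_family_derivative[OF L open_UNIV _ W this, of k x]
  show "Hess (density k L) u V x = second_variation k L u V x"
    unfolding Hess_def by (intro vector_derivative_at) simp
qed

lemma smooth_on_jet: "smooth_on UNIV u \<Longrightarrow> smooth_on UNIV (jet k u)"
  unfolding jet_def[abs_def]
  by (intro smooth_on_Pair smooth_on_linear_compose[OF bounded_linear_vec_nth] smooth_on_ddx open_UNIV)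

lemma smooth_per_jet: "u \<in> smooth_per T \<Longrightarrow> jet k u \<in> smooth_per T"
  using smooth_on_jet[of u k] smooth_perD(2)[of u T] smooth_perD(2)[OF smooth_per_ddx[of u T]]
  by (simp add: smooth_per_def jet_def)

lemma smooth_per_dirderiv_jet:
  assumes "smooth_on UNIV f" "u \<in> smooth_per T" "V \<in> smooth_per T"
  shows "(\<lambda>y. dirderiv f (jet k V y) (jet k u y)) \<in> smooth_per T"
  using smooth_on_dirderiv_varying[OF assms(1) open_UNIV] smooth_per_jet[OF assms(2), of k] smooth_per_jet[OF assms(3), of k]
  by (auto simp: smooth_per_def)

lemma smooth_per_second_variation:
  fixes u V :: "real \<Rightarrow> real^'n::finite"
  assumes L: "smooth_on UNIV L" and u: "u \<in> smooth_per T" and V: "V \<in> smooth_per T"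
  shows "second_variation k L u V \<in> smooth_per T"
proof -
  note P = smooth_per_dirderiv_jet[OF smooth_on_dirderiv[OF L] u V, of _ k]
  have "smooth_on UNIV (second_variation k L u V)"
    unfolding second_variation_def[abs_def]
    using P smooth_per_ddx[OF P] by (intro smooth_on_vec_lambda smooth_on_diff) (auto simp: smooth_per_def)
  moreover have "second_variation k L u V (x + T) = second_variation k L u V x" for x
    using smooth_perD(2)[OF P] smooth_perD(2)[OF smooth_per_ddx[OF P]] by (simp add: second_variation_def)
  ultimately show ?thesis by (simp add: smooth_per_def)
qed


text \<open>
  Linear functionals of a jet are sums over its components, in the form in which they occur in
  \<open>var_deriv\<close> and \<open>second_variation\<close>.
\<close>
lemma linear_jet_expansion:
  fixes f :: "(real^'n::finite) \<times> real \<Rightarrow> real"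
  assumes "linear f"
  shows "f (a, s) = (\<Sum>\<alpha>\<in>UNIV. a $ \<alpha> * f (axis \<alpha> 1, 0)) + s * f (0, 1)"
proof -
  interpret linear f by (rule assms)
  have eq: "(a, s) = (\<Sum>\<alpha>\<in>UNIV. a $ \<alpha> *\<^sub>R (axis \<alpha> 1, 0)) + s *\<^sub>R (0, 1)"
    using basis_expansion[of a] by (simp add: scalar_mult_eq_scaleR sum_prod prod_eq_iff fst_sum snd_sum)
  show ?thesis unfolding eq by (simp only: add sum scale real_scaleR_def)
qed

text \<open>
  Up to a total derivative the product is the second derivative of \<open>L\<close> at the jet of \<open>u\<close>, evaluated at the
  jets of \<open>V\<close> and \<open>W\<close>. This expression is symmetric in \<open>V\<close> and \<open>W\<close>, whence the symmetry of the Hessian.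
\<close>
lemma second_variation_inner:
  fixes u V W :: "real \<Rightarrow> real^'n::finite"
  assumes L: "smooth_on UNIV L" and u: "u \<in> smooth_per T" and V: "V \<in> smooth_per T" and W: "W \<in> smooth_per T"
  shows "W x \<bullet> second_variation k L u V x =
    dirderiv (dirderiv L (jet k W x)) (jet k V x) (jet k u x)
    - ddx (\<lambda>y. W y $ k * dirderiv (dirderiv L (0, 1)) (jet k V y) (jet k u y)) x"
proof -
  define P where "P = (\<lambda>s y. dirderiv (dirderiv L (0, s)) (jet k V y) (jet k u y))"
  have "P 0 = (\<lambda>y. 0)"
    using linear_0[OF second_derivative_linear[OF L]] by (simp add: P_def zero_prod_def[symmetric])
  then have P0: "ddx (P (axis \<alpha> 1 $ k)) x = (if \<alpha> = k then ddx (P 1) x else 0)" for \<alpha>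
    by (auto simp: axis_nth_eq intro!: ddx_eqI has_vector_derivative_const)
  have "W x \<bullet> second_variation k L u V x =
      (\<Sum>\<alpha>\<in>UNIV. W x $ \<alpha> * dirderiv (dirderiv L (axis \<alpha> 1, 0)) (jet k V x) (jet k u x)) - W x $ k * ddx (P 1) x"
    unfolding second_variation_def P_def inner_vec_def
    by (simp add: P0[unfolded P_def] right_diff_distrib sum_subtractf if_distrib[of "(*) _"] cong: if_cong)
  moreover have "ddx (\<lambda>y. W y $ k * P 1 y) x = W x $ k * ddx (P 1) x + ddx W x $ k * P 1 x"
  proof (intro ddx_eqI has_vector_derivative_mult)
    show "((\<lambda>y. W y $ k) has_vector_derivative ddx W x $ k) (at x)"
      by (rule bounded_linear.has_vector_derivative[OF bounded_linear_vec_nth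
            smooth_on_has_vector_derivative[OF smooth_perD(1)[OF W] UNIV_I]])
    show "(P 1 has_vector_derivative ddx (P 1) x) (at x)"
      unfolding P_def
      by (rule smooth_on_has_vector_derivative[OF smooth_perD(1)[OF
            smooth_per_dirderiv_jet[OF smooth_on_dirderiv[OF L] u V]] UNIV_I])
  qed
  moreover have "dirderiv (dirderiv L (jet k W x)) (jet k V x) (jet k u x) =
      (\<Sum>\<alpha>\<in>UNIV. W x $ \<alpha> * dirderiv (dirderiv L (axis \<alpha> 1, 0)) (jet k V x) (jet k u x)) + ddx W x $ k * P 1 x"
    unfolding jet_def[of k W] P_def by (rule linear_jet_expansion[OF second_derivative_linear[OF L]])
  ultimately show ?thesis by (simp add: P_def)
qed

lemma second_variation_symmetric:
  fixes u V W :: "real \<Rightarrow> real^'n::finite"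
  assumes L: "smooth_on UNIV L" and "T > 0"
    and u: "u \<in> smooth_per T" and V: "V \<in> smooth_per T" and W: "W \<in> smooth_per T"
  shows "L2_inner T (second_variation k L u V) W = L2_inner T V (second_variation k L u W)"
proof -
  have form: "L2_inner T W (second_variation k L u V) =
      (LINT x:{0..T}|lborel. dirderiv (dirderiv L (jet k W x)) (jet k V x) (jet k u x))"
    if V: "V \<in> smooth_per T" and W: "W \<in> smooth_per T" for V W
  proof -
    let ?Q = "\<lambda>y. W y $ k * dirderiv (dirderiv L (0, 1)) (jet k V y) (jet k u y)"
    let ?B = "\<lambda>x. dirderiv (dirderiv L (jet k W x)) (jet k V x) (jet k u x)"
    have Q: "?Q \<in> smooth_per T"
      by (intro smooth_per_bilinear[OF bounded_bilinear_mult] smooth_per_linear[OF bounded_linear_vec_nth] W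
          smooth_per_dirderiv_jet smooth_on_dirderiv L u V)
    have "?B \<in> smooth_per T"
    proof -
      have "(\<lambda>x. (\<Sum>\<alpha>\<in>UNIV. W x $ \<alpha> * dirderiv (dirderiv L (axis \<alpha> 1, 0)) (jet k V x) (jet k u x))
          + ddx W x $ k * dirderiv (dirderiv L (0, 1)) (jet k V x) (jet k u x)) \<in> smooth_per T"
        by (intro smooth_per_add smooth_per_sum smooth_per_bilinear[OF bounded_bilinear_mult]
            smooth_per_linear[OF bounded_linear_vec_nth] W smooth_per_ddx
            smooth_per_dirderiv_jet smooth_on_dirderiv L u V)
      then show ?thesis unfolding jet_def[of k W] linear_jet_expansion[OF second_derivative_linear[OF L], where a = "W _"] .
    qed
    then have "L2_inner T W (second_variation k L u V) =
        (LINT x:{0..T}|lborel. ?B x) - (LINT x:{0..T}|lborel. ddx ?Q x)"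
      unfolding L2_inner_def second_variation_inner[OF L u V W]
      by (intro set_integral_diff L2_per_integrable smooth_per_subset_L2_per smooth_per_ddx Q)
    then show ?thesis using integral_ddx_per[OF Q \<open>T > 0\<close>] by simp
  qed
  have "L2_inner T W (second_variation k L u V) = L2_inner T V (second_variation k L u W)"
    unfolding form[OF V W] form[OF W V] by (simp only: dirderiv_commute[OF open_UNIV L UNIV_I])
  then show ?thesis by (simp add: L2_inner_commute)
qed

text \<open>
  The usual computation of the Euler-Lagrange equation, before integration.
\<close>
lemma first_variation_inner:
  fixes u V :: "real \<Rightarrow> real^'n::finite"
  assumes L: "smooth_on UNIV L" and u: "smooth_on UNIV u" and V: "smooth_on UNIV V"
  shows "dirderiv L (jet k V x) (jet k u x) = V x \<bullet> var_deriv (density k L) u x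
    + ddx (\<lambda>y. V y $ k * dirderiv L (0, 1) (jet k u y)) x"
proof -
  define P where "P = (\<lambda>s y. dirderiv L (0, s) (jet k u y))"
  have "P 0 = (\<lambda>y. 0)"
    using dirderiv_zero[OF L] by (simp add: P_def zero_prod_def[symmetric])
  then have P0: "ddx (P (axis \<alpha> 1 $ k)) x = (if \<alpha> = k then ddx (P 1) x else 0)" for \<alpha>
    by (auto simp: axis_nth_eq intro!: ddx_eqI has_vector_derivative_const)
  have "V x \<bullet> var_deriv (density k L) u x =
      (\<Sum>\<alpha>\<in>UNIV. V x $ \<alpha> * dirderiv L (axis \<alpha> 1, 0) (jet k u x)) - V x $ k * ddx (P 1) x"
    unfolding var_deriv_density[OF L] P_def inner_vec_def
    by (simp add: P0[unfolded P_def] right_diff_distrib sum_subtractf if_distrib[of "(*) _"] cong: if_cong)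
  moreover have "ddx (\<lambda>y. V y $ k * P 1 y) x = V x $ k * ddx (P 1) x + ddx V x $ k * P 1 x"
  proof (intro ddx_eqI has_vector_derivative_mult)
    show "((\<lambda>y. V y $ k) has_vector_derivative ddx V x $ k) (at x)"
      by (rule bounded_linear.has_vector_derivative[OF bounded_linear_vec_nth
            smooth_on_has_vector_derivative[OF V UNIV_I]])
    have "smooth_on UNIV (P 1)"
      unfolding P_def
      by (rule smooth_on_compose[OF open_UNIV open_UNIV _ smooth_on_dirderiv[OF L] smooth_on_jet[OF u]]) simp
    then show "(P 1 has_vector_derivative ddx (P 1) x) (at x)"
      by (rule smooth_on_has_vector_derivative) simp
  qed
  moreover have "dirderiv L (jet k V x) (jet k u x) =
      (\<Sum>\<alpha>\<in>UNIV. V x $ \<alpha> * dirderiv L (axis \<alpha> 1, 0) (jet k u x)) + ddx V x $ k * P 1 x"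
    unfolding jet_def[of k V] P_def by (rule linear_jet_expansion[OF dirderiv_linear[OF L UNIV_I]])
  ultimately show ?thesis by (simp add: P_def)
qed

lemma legendre_density:
  assumes "smooth_on UNIV L"
  shows "legendre (density k L) u x = ddx u x $ k * dirderiv L (0, 1) (jet k u x) - L (jet k u x)"
proof -
  have "partial_2 \<alpha> (density k L) (u x) (ddx u x) = (if \<alpha> = k then dirderiv L (0, 1) (jet k u x) else 0)" for \<alpha>
    using dirderiv_zero[OF assms] by (simp add: partial_2_density[OF assms] axis_nth_eq jet_def zero_prod_def[symmetric])
  then show ?thesis
    by (simp add: legendre_def density_def jet_def if_distrib[of "(*) _"] cong: if_cong)
qed

lemma second_variation_linear:
  fixes u V W :: "real \<Rightarrow> real^'n::finite"
  assumes L: "smooth_on UNIV L" and u: "smooth_on UNIV u" and V: "smooth_on UNIV V" and W: "smooth_on UNIV W"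
  shows "second_variation k L u (\<lambda>x. V x + r *\<^sub>R W x) x = second_variation k L u V x + r *\<^sub>R second_variation k L u W x"
proof -
  have jet: "jet k (\<lambda>x. V x + r *\<^sub>R W x) y = jet k V y + r *\<^sub>R jet k W y" for y
  proof -
    have "ddx (\<lambda>x. V x + r *\<^sub>R W x) y = ddx V y + r *\<^sub>R ddx W y"
      by (intro ddx_eqI has_vector_derivative_add bounded_linear.has_vector_derivative[OF bounded_linear_scaleR_right]
          smooth_on_has_vector_derivative[OF V UNIV_I] smooth_on_has_vector_derivative[OF W UNIV_I])
    then show ?thesis by (simp add: jet_def)
  qed
  have D: "dirderiv (dirderiv L w) (jet k V y + r *\<^sub>R jet k W y) (jet k u y) =
      dirderiv (dirderiv L w) (jet k V y) (jet k u y) + r * dirderiv (dirderiv L w) (jet k W y) (jet k u y)" for w y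
  proof -
    interpret linear "\<lambda>v. dirderiv (dirderiv L w) v (jet k u y)"
      using smooth_on_dirderiv[OF L] by (rule dirderiv_linear) simp
    show ?thesis by (simp add: add scale)
  qed
  have "ddx (\<lambda>y. dirderiv (dirderiv L w) (jet k V y) (jet k u y) + r * dirderiv (dirderiv L w) (jet k W y) (jet k u y)) x =
      ddx (\<lambda>y. dirderiv (dirderiv L w) (jet k V y) (jet k u y)) x + r * ddx (\<lambda>y. dirderiv (dirderiv L w) (jet k W y) (jet k u y)) x" for w
    by (intro ddx_eqI has_vector_derivative_add bounded_linear.has_vector_derivative[OF bounded_linear_mult_right]
        smooth_on_has_vector_derivative[OF _ UNIV_I] smooth_on_dirderiv_varying smooth_on_dirderiv L smooth_on_jet u V W open_UNIV)
  then show ?thesis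
    by (simp add: second_variation_def jet D vec_eq_iff algebra_simps)
qed

section \<open>Parameter derivatives of periodic profiles\<close>

lemma matrix_inv_inverse:
  assumes "invertible A"
  shows "A ** matrix_inv A = mat 1" "matrix_inv A ** A = mat 1"
  using someI_ex[OF assms[unfolded invertible_def]] by (simp_all add: matrix_inv_def)

text \<open>
  Symmetry of \<open>B\<close> passes to its inverse and merges the two terms of the product rule.
\<close>
lemma impulse_has_derivative:
  fixes B :: "real^'n^'n::finite"
  assumes "transpose B = B" "invertible B"
  shows "(impulse B has_derivative (\<lambda>b. b \<bullet> (matrix_inv B *v a))) (at a)"
proof -
  let ?M = "matrix_inv B"
  note inv = matrix_inv_inverse[OF assms(2)]
  have "transpose ?M = ?M"
  proof -
    have "transpose ?M ** B = mat 1"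
      using arg_cong[where f = transpose, OF inv(1)] assms(1) by (simp add: matrix_transpose_mul transpose_mat)
    then have "transpose ?M ** (B ** ?M) = ?M" by (simp add: matrix_mul_assoc)
    then show ?thesis by (simp add: inv)
  qed
  then have sym: "a \<bullet> (?M *v b) = b \<bullet> (?M *v a)" for a b
    using dot_lmul_matrix[of a ?M b] vector_transpose_matrix[of a ?M] by (simp add: inner_commute)
  have "((\<lambda>a. 1 / 2 * (a \<bullet> (?M *v a))) has_derivative (\<lambda>b. 1 / 2 * (a \<bullet> (?M *v b) + b \<bullet> (?M *v a)))) (at a)"
    by (intro has_derivative_mult_right has_derivative_inner has_derivative_ident
        bounded_linear_imp_has_derivative matrix_vector_mul_bounded_linear)
  moreover have "(\<lambda>b. 1 / 2 * (a \<bullet> (?M *v b) + b \<bullet> (?M *v a))) = (\<lambda>b. b \<bullet> (?M *v a))"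
    by (simp add: sym[of a])
  ultimately show ?thesis unfolding impulse_def[abs_def] by simp
qed

lemma smooth_on_impulse: "smooth_on UNIV (impulse B)"
  unfolding impulse_def[abs_def]
  by (intro smooth_on_mult smooth_on_const smooth_on_inner smooth_on_linear bounded_linear_ident
      matrix_vector_mul_bounded_linear open_UNIV)

definition energy :: "(real^'n \<Rightarrow> real \<Rightarrow> real) \<Rightarrow> real^'n^'n::finite \<Rightarrow> real \<Rightarrow> (real^'n) \<times> real \<Rightarrow> real" where
  "energy H B c z = H (fst z) (snd z) + c * impulse B (fst z)"

lemma HcQ_eq_density: "HcQ k H B c = density k (energy H B c)"
  by (simp add: HcQ_def density_def energy_def fun_eq_iff)

lemma lagrangian_eq_density: "lagrangian k H B c lam = density k (\<lambda>z. energy H B c z + lam \<bullet> fst z)"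
  by (simp add: lagrangian_def density_def energy_def fun_eq_iff)

text \<open>
  The derivative with respect to the parameters, in the direction \<open>d\<close>, of the integrand
  \<open>H U v_x + c Q U + lam \<bullet> U + \<mu>\<close> of the action at fixed \<open>U\<close>.
\<close>
definition param_density :: "real^'n^'n::finite \<Rightarrow> 'n param \<Rightarrow> real^'n \<Rightarrow> real" where
  "param_density B d a = fst (snd d) \<bullet> a + snd (snd d) * impulse B a + fst d"

text \<open>
  The gradient of \<open>param_density B d\<close>. For the directions of \<open>lam\<close> and \<open>c\<close> these are the functions that define
  the tangent space of the constraint manifold.
\<close>
definition param_grad :: "real^'n^'n::finite \<Rightarrow> 'n param \<Rightarrow> real^'n \<Rightarrow> real^'n" where
  "param_grad B d a = fst (snd d) + snd (snd d) *\<^sub>R (matrix_inv B *v a)"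

definition vary :: "('n::finite param \<Rightarrow> real \<Rightarrow> real^'n) \<Rightarrow> 'n param \<Rightarrow> 'n param \<Rightarrow> real \<Rightarrow> real^'n" where
  "vary U d p x = dirderiv (\<lambda>(p, x). U p x) (d, 0) (p, x)"

lemma set_integral_eq_integral:
  fixes f :: "real \<Rightarrow> real"
  assumes "continuous_on {a..b} f"
  shows "(LINT x:{a..b}|lborel. f x) = integral {a..b} f"
  using assms by (intro set_borel_integral_eq_integral borel_integrable_atLeastAtMost')

locale profile_family =
  fixes k :: "'n::finite"
    and H :: "real^'n \<Rightarrow> real \<Rightarrow> real"
    and B :: "real^'n^'n"
    and \<Omega> :: "'n param set"
    and U :: "'n param \<Rightarrow> real \<Rightarrow> real^'n"
    and \<Xi> :: "'n param \<Rightarrow> real"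
  assumes H_smooth: "smooth_on UNIV (\<lambda>(a, s). H a s)"
    and B_symmetric: "transpose B = B"
    and B_nonsingular: "invertible B"
    and Omega_open: "open \<Omega>"
    and Xi_smooth: "smooth_on \<Omega> \<Xi>"
    and Xi_pos: "\<And>p. p \<in> \<Omega> \<Longrightarrow> \<Xi> p > 0"
    and U_smooth: "smooth_on (\<Omega> \<times> UNIV) (\<lambda>(p, x). U p x)"
    and U_periodic: "\<And>p x. p \<in> \<Omega> \<Longrightarrow> U p (x + \<Xi> p) = U p x"
    and profile_E: "\<And>\<mu> lam c x. (\<mu>, lam, c) \<in> \<Omega> \<Longrightarrow>
          var_deriv (HcQ k H B c) (U (\<mu>, lam, c)) x + lam = 0"
    and profile_L: "\<And>\<mu> lam c x. (\<mu>, lam, c) \<in> \<Omega> \<Longrightarrow>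
          legendre (lagrangian k H B c lam) (U (\<mu>, lam, c)) x = \<mu>"
    and vx_ends: "\<And>p. p \<in> \<Omega> \<Longrightarrow> ddx (\<lambda>x. U p x $ k) 0 = 0 \<and> ddx (\<lambda>x. U p x $ k) (\<Xi> p) = 0"
    and Xi_mu_nonzero: "\<And>p. p \<in> \<Omega> \<Longrightarrow> pderiv_along dir_mu \<Xi> p \<noteq> 0"
begin

lemma open_domain: "open (\<Omega> \<times> (UNIV :: real set))"
  using Omega_open by (intro open_Times) auto

lemma energy_smooth: "smooth_on UNIV (energy H B c)"
proof -
  have "smooth_on UNIV (\<lambda>z. (case z of (a, s) \<Rightarrow> H a s) + c * impulse B (fst z))"
    by (intro smooth_on_add smooth_on_mult smooth_on_const H_smooth open_UNIV
        smooth_on_compose[OF open_UNIV open_UNIV _ smooth_on_impulse] smooth_on_linear bounded_linear_fst) auto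
  then show ?thesis by (simp add: energy_def[abs_def] case_prod_unfold)
qed

lemma dirderiv_energy_add:
  "dirderiv (energy H B (c + e)) w z = dirderiv (energy H B c) w z + e * (fst w \<bullet> (matrix_inv B *v fst z))"
proof -
  have der: "((\<lambda>z. energy H B c z + e * impulse B (fst z)) has_derivative
      (\<lambda>w. dirderiv (energy H B c) w z + e * (fst w \<bullet> (matrix_inv B *v fst z)))) (at z)"
    by (intro has_derivative_add smooth_on_has_derivative[OF energy_smooth] UNIV_I has_derivative_mult_right
        has_derivative_compose[OF bounded_linear_imp_has_derivative[OF bounded_linear_fst]
          impulse_has_derivative[OF B_symmetric B_nonsingular]])
  have "(\<lambda>z. energy H B c z + e * impulse B (fst z)) = energy H B (c + e)"
    by (simp add: energy_def fun_eq_iff algebra_simps)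
  with fun_cong[OF frechet_derivative_at[OF der], of w] show ?thesis by simp
qed

lemma var_deriv_energy_add:
  "var_deriv (density k (energy H B (c + e))) u x =
    var_deriv (density k (energy H B c)) u x + e *\<^sub>R (matrix_inv B *v u x)"
  unfolding var_deriv_density[OF energy_smooth] vec_eq_iff
  by (simp add: dirderiv_energy_add jet_def inner_axis inner_commute[of "axis _ _"])

lemma U_slice_smooth: "p \<in> \<Omega> \<Longrightarrow> smooth_on UNIV (U p)"
  using smooth_on_compose[OF open_UNIV open_domain _ U_smooth smooth_on_Pair[OF open_UNIV smooth_on_const
        smooth_on_linear[OF bounded_linear_ident open_UNIV]], of p]
  by simp

lemma U_smooth_per: "p \<in> \<Omega> \<Longrightarrow> U p \<in> smooth_per (\<Xi> p)"
  using U_slice_smooth U_periodic by (simp add: smooth_per_def)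

lemma vary_smooth: "p \<in> \<Omega> \<Longrightarrow> smooth_on UNIV (vary U d p)"
  using smooth_on_compose[OF open_UNIV open_domain _ smooth_on_dirderiv[OF U_smooth] smooth_on_Pair[OF open_UNIV smooth_on_const
        smooth_on_linear[OF bounded_linear_ident open_UNIV]], of p "(d, 0)"]
  by (simp add: vary_def[abs_def])

lemma vx_end: "p \<in> \<Omega> \<Longrightarrow> ddx (U p) 0 $ k = 0 \<and> ddx (U p) (\<Xi> p) $ k = 0"
proof -
  assume p: "p \<in> \<Omega>"
  have "ddx (\<lambda>x. U p x $ k) x = ddx (U p) x $ k" for x
    by (intro ddx_eqI bounded_linear.has_vector_derivative[OF bounded_linear_vec_nth]
        smooth_on_has_vector_derivative[OF U_slice_smooth[OF p]] UNIV_I)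
  then show ?thesis using vx_ends[OF p] by simp
qed

lemma line_domain_open: "open {t. p + t *\<^sub>R d \<in> \<Omega>}"
proof -
  have "open ((\<lambda>t. p + t *\<^sub>R d) -` \<Omega>)"
    using Omega_open by (rule open_vimage) (intro continuous_intros)
  then show ?thesis by (simp add: vimage_def)
qed

lemma line_smooth:
  fixes f :: "'n param \<times> real \<Rightarrow> 'b::real_normed_vector"
  assumes "smooth_on (\<Omega> \<times> UNIV) f"
  shows "smooth_on ({t. p + t *\<^sub>R d \<in> \<Omega>} \<times> UNIV) (\<lambda>(t, x). f (p + t *\<^sub>R d, x))"
proof -
  have o: "open ({t. p + t *\<^sub>R d \<in> \<Omega>} \<times> (UNIV :: real set))"
    using line_domain_open by (intro open_Times) auto
  have "smooth_on ({t. p + t *\<^sub>R d \<in> \<Omega>} \<times> UNIV) (\<lambda>z :: real \<times> real. f (p + fst z *\<^sub>R d, snd z))"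
    by (intro smooth_on_compose[OF o open_domain _ assms] smooth_on_Pair smooth_on_add smooth_on_const
        smooth_on_scaleR smooth_on_linear bounded_linear_fst bounded_linear_snd o) auto
  then show ?thesis by (simp add: case_prod_unfold)
qed

lemma vary_has_vector_derivative:
  assumes "p + t *\<^sub>R d \<in> \<Omega>"
  shows "((\<lambda>t. U (p + t *\<^sub>R d) x) has_vector_derivative vary U d (p + t *\<^sub>R d) x) (at t)"
proof -
  have "((\<lambda>t. (p + t *\<^sub>R d, x)) has_vector_derivative (d, 0)) (at t)"
    by (intro has_vector_derivative_Pair) (auto intro!: derivative_eq_intros)
  from smooth_on_chain[OF U_smooth _ this] show ?thesis using assms by (simp add: vary_def)
qed

lemma dirderiv_line:
  assumes "p + t *\<^sub>R d \<in> \<Omega>"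
  shows "dirderiv (\<lambda>(t, x). U (p + t *\<^sub>R d) x) (1, 0) (t, x) = vary U d (p + t *\<^sub>R d) x"
proof (rule vector_derivative_unique_at)
  show "((\<lambda>t. U (p + t *\<^sub>R d) x) has_vector_derivative
      dirderiv (\<lambda>(t, x). U (p + t *\<^sub>R d) x) (1, 0) (t, x)) (at t)"
    using smooth_on_slice_fst[OF line_smooth[OF U_smooth, of p d], of t x] assms by simp
qed (rule vary_has_vector_derivative[OF assms])

lemma profile_E': "p \<in> \<Omega> \<Longrightarrow> var_deriv (density k (energy H B (snd (snd p)))) (U p) x + fst (snd p) = 0"
  using profile_E[of "fst p" "fst (snd p)" "snd (snd p)" x] by (simp add: HcQ_eq_density)

text \<open>
  Derivative of the profile equation along the line \<open>p + t d\<close>. The density depends on \<open>t\<close> through \<open>c\<close>, linearly;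
  this dependence is split off first, so that the rest is the variation of a fixed density along a family.
\<close>
lemma linearized_profile_equation:
  assumes p: "p \<in> \<Omega>"
  shows "second_variation k (energy H B (snd (snd p))) (U p) (vary U d p) x = - param_grad B d (U p x)"
proof -
  define J where "J = {t. p + t *\<^sub>R d \<in> \<Omega>}"
  define c where "c = snd (snd p)"
  define W where "W = (\<lambda>t. U (p + t *\<^sub>R d))"
  have J: "open J" "0 \<in> J" using line_domain_open p by (auto simp: J_def)
  have W: "smooth_on (J \<times> UNIV) (\<lambda>(t, x). W t x)"
    using line_smooth[OF U_smooth, of p d] by (simp add: W_def J_def)
  have V: "vary U d p x = dirderiv (\<lambda>(t, x). W t x) (1, 0) (0, x)" for x
    using dirderiv_line[of p 0 d x] p by (simp add: W_def)
  have "((\<lambda>t. var_deriv (density k (energy H B c)) (W t) x + (t * snd (snd d)) *\<^sub>R (matrix_inv B *v W t x)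
        + (fst (snd p) + t *\<^sub>R fst (snd d))) has_vector_derivative
      second_variation k (energy H B c) (W 0) (vary U d p) x
        + ((0 * snd (snd d)) *\<^sub>R (matrix_inv B *v vary U d p x) + snd (snd d) *\<^sub>R (matrix_inv B *v W 0 x))
        + (0 + fst (snd d))) (at 0)"
  proof (intro has_vector_derivative_add has_vector_derivative_const)
    show "((\<lambda>t. var_deriv (density k (energy H B c)) (W t) x) has_vector_derivative
        second_variation k (energy H B c) (W 0) (vary U d p) x) (at 0)"
      by (rule var_deriv_family_derivative[OF energy_smooth J W V])
    show "((\<lambda>t. t *\<^sub>R fst (snd d)) has_vector_derivative fst (snd d)) (at 0)"
      by (auto intro!: derivative_eq_intros)
    have "((\<lambda>t. matrix_inv B *v W t x) has_vector_derivative matrix_inv B *v vary U d p x) (at 0)"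
      using vary_has_vector_derivative[of p 0 d x] p
      by (intro bounded_linear.has_vector_derivative[OF matrix_vector_mul_bounded_linear]) (simp add: W_def)
    moreover have "((\<lambda>t. t * snd (snd d)) has_vector_derivative snd (snd d)) (at 0)"
      by (auto intro!: derivative_eq_intros simp flip: has_real_derivative_iff_has_vector_derivative)
    ultimately show "((\<lambda>t. (t * snd (snd d)) *\<^sub>R (matrix_inv B *v W t x)) has_vector_derivative
        (0 * snd (snd d)) *\<^sub>R (matrix_inv B *v vary U d p x) + snd (snd d) *\<^sub>R (matrix_inv B *v W 0 x)) (at 0)"
      by (intro bounded_bilinear.has_vector_derivative[OF bounded_bilinear_scaleR])
  qed
  moreover have "((\<lambda>t. var_deriv (density k (energy H B c)) (W t) x + (t * snd (snd d)) *\<^sub>R (matrix_inv B *v W t x)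
        + (fst (snd p) + t *\<^sub>R fst (snd d))) has_vector_derivative 0) (at 0)"
  proof (rule has_vector_derivative_transform_within_open[OF has_vector_derivative_const J])
    fix t assume "t \<in> J"
    then show "0 = var_deriv (density k (energy H B c)) (W t) x + (t * snd (snd d)) *\<^sub>R (matrix_inv B *v W t x)
        + (fst (snd p) + t *\<^sub>R fst (snd d))"
      using profile_E'[of "p + t *\<^sub>R d" x] by (simp add: J_def W_def c_def var_deriv_energy_add)
  qed
  ultimately have "second_variation k (energy H B c) (W 0) (vary U d p) x
      + ((0 * snd (snd d)) *\<^sub>R (matrix_inv B *v vary U d p x) + snd (snd d) *\<^sub>R (matrix_inv B *v W 0 x))
      + (0 + fst (snd d)) = 0"
    by (rule vector_derivative_unique_at)
  then show ?thesis by (simp add: c_def W_def param_grad_def add_eq_0_iff algebra_simps)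
qed

lemma pderiv_Xi: "p \<in> \<Omega> \<Longrightarrow> pderiv_along d \<Xi> p = dirderiv \<Xi> d p"
  and Xi_line: "p + t *\<^sub>R d \<in> \<Omega> \<Longrightarrow>
    ((\<lambda>t. \<Xi> (p + t *\<^sub>R d)) has_vector_derivative dirderiv \<Xi> d (p + t *\<^sub>R d)) (at t)"
proof -
  show *: "((\<lambda>t. \<Xi> (p + t *\<^sub>R d)) has_vector_derivative dirderiv \<Xi> d (p + t *\<^sub>R d)) (at t)"
    if "p + t *\<^sub>R d \<in> \<Omega>" for p t
    using that by (intro smooth_on_chain[OF Xi_smooth]) (auto intro!: derivative_eq_intros)
  show "pderiv_along d \<Xi> p = dirderiv \<Xi> d p" if "p \<in> \<Omega>"
    unfolding pderiv_along_def using *[of p 0] that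
    by (intro DERIV_imp_deriv) (simp add: has_real_derivative_iff_has_vector_derivative)
qed

text \<open>
  Derivative of \<open>U p (x + \<Xi> p) = U p x\<close> along the line \<open>p + t d\<close>: differentiated profiles fail to be periodic
  to the extent that the period moves.
\<close>
lemma vary_shift:
  assumes p: "p \<in> \<Omega>"
  shows "vary U d p (x + \<Xi> p) = vary U d p x - pderiv_along d \<Xi> p *\<^sub>R ddx (U p) x"
proof -
  let ?U = "\<lambda>(p, x). U p x"
  let ?x' = "x + \<Xi> p"
  have in_dom: "(p, ?x') \<in> \<Omega> \<times> UNIV" using p by simp
  interpret linear "\<lambda>v. dirderiv ?U v (p, ?x')"
    by (rule dirderiv_linear[OF U_smooth in_dom])
  have "((\<lambda>t. ?U (p + t *\<^sub>R d, x + \<Xi> (p + t *\<^sub>R d))) has_vector_derivative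
      dirderiv ?U (d, dirderiv \<Xi> d p) (p + 0 *\<^sub>R d, x + \<Xi> (p + 0 *\<^sub>R d))) (at 0)"
  proof (rule smooth_on_chain[OF U_smooth])
    have "((\<lambda>t. x + \<Xi> (p + t *\<^sub>R d)) has_vector_derivative 0 + dirderiv \<Xi> d p) (at 0)"
      using p Xi_line[of p 0 d] by (intro has_vector_derivative_add has_vector_derivative_const) simp
    then show "((\<lambda>t. (p + t *\<^sub>R d, x + \<Xi> (p + t *\<^sub>R d))) has_vector_derivative (d, dirderiv \<Xi> d p)) (at 0)"
      by (intro has_vector_derivative_Pair) (auto intro!: derivative_eq_intros)
  qed (use p in simp)
  then have "((\<lambda>t. U (p + t *\<^sub>R d) (x + \<Xi> (p + t *\<^sub>R d))) has_vector_derivative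
      dirderiv ?U (d, dirderiv \<Xi> d p) (p, ?x')) (at 0)" by simp
  moreover have "((\<lambda>t. U (p + t *\<^sub>R d) (x + \<Xi> (p + t *\<^sub>R d))) has_vector_derivative vary U d p x) (at 0)"
    by (rule has_vector_derivative_transform_within_open[OF _ line_domain_open[of p d]])
       (use vary_has_vector_derivative[of p 0 d x] p U_periodic in auto)
  ultimately have "vary U d p x = dirderiv ?U (d, dirderiv \<Xi> d p) (p, ?x')"
    by (rule vector_derivative_unique_at[rotated])
  also have "(d, dirderiv \<Xi> d p) = (d, 0) + dirderiv \<Xi> d p *\<^sub>R (0, 1)" by simp
  also have "dirderiv ?U ((d, 0) + dirderiv \<Xi> d p *\<^sub>R (0, 1)) (p, ?x') =
      vary U d p ?x' + dirderiv \<Xi> d p *\<^sub>R dirderiv ?U (0, 1) (p, ?x')"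
    by (simp only: add scale vary_def)
  also have "dirderiv ?U (0, 1) (p, ?x') = ddx (U p) ?x'"
  proof -
    have "((\<lambda>x. ?U (p, x)) has_vector_derivative dirderiv ?U (0, 1) (p, ?x')) (at ?x')"
      by (rule smooth_on_chain[OF U_smooth]) (use in_dom in \<open>auto intro!: has_vector_derivative_Pair\<close>)
    then show ?thesis by (intro ddx_eqI[symmetric]) simp
  qed
  also have "\<dots> = ddx (U p) x" by (rule smooth_perD(2)[OF smooth_per_ddx[OF U_smooth_per[OF p]]])
  finally show ?thesis by (simp add: pderiv_Xi[OF p] algebra_simps)
qed

text \<open>
  The multiple of \<open>vary U dir_mu p\<close> is chosen to cancel the change of period in \<open>vary_shift\<close>. As \<open>\<mu>\<close> does
  not occur in the profile equation, this does not affect the linearized equation.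
\<close>
definition periodic_variation :: "'n param \<Rightarrow> 'n param \<Rightarrow> real \<Rightarrow> real^'n" where
  "periodic_variation d p x = vary U d p x + (- (pderiv_along d \<Xi> p / pderiv_along dir_mu \<Xi> p)) *\<^sub>R vary U dir_mu p x"

lemma periodic_variation_smooth_per:
  assumes p: "p \<in> \<Omega>"
  shows "periodic_variation d p \<in> smooth_per (\<Xi> p)"
proof -
  have "smooth_on UNIV (periodic_variation d p)"
    unfolding periodic_variation_def[abs_def]
    by (intro smooth_on_add smooth_on_scaleR smooth_on_const vary_smooth[OF p] open_UNIV)
  moreover have "periodic_variation d p (x + \<Xi> p) = periodic_variation d p x" for x
    using Xi_mu_nonzero[OF p] by (simp add: periodic_variation_def vary_shift[OF p] algebra_simps)
  ultimately show ?thesis by (simp add: smooth_per_def)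
qed

lemma second_variation_periodic_variation:
  assumes p: "p \<in> \<Omega>"
  shows "second_variation k (energy H B (snd (snd p))) (U p) (periodic_variation d p) x = - param_grad B d (U p x)"
  unfolding periodic_variation_def[abs_def]
    second_variation_linear[OF energy_smooth U_slice_smooth[OF p] vary_smooth[OF p] vary_smooth[OF p]]
    linearized_profile_equation[OF p]
  by (simp add: param_grad_def dir_mu_def)

end

section \<open>Derivatives of the action\<close>

lemma has_vector_derivative_line_shift:
  fixes q v :: "'a::real_vector"
  assumes "((\<lambda>\<tau>. F (q + t *\<^sub>R v + \<tau> *\<^sub>R v)) has_vector_derivative D) (at 0)"
  shows "((\<lambda>\<tau>. F (q + \<tau> *\<^sub>R v)) has_vector_derivative D) (at t)"
proof -
  have "((\<lambda>\<tau>. \<tau> - t) has_vector_derivative 1) (at t)"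
    by (auto intro!: derivative_eq_intros)
  moreover have "((\<lambda>\<tau>. F (q + t *\<^sub>R v + \<tau> *\<^sub>R v)) has_vector_derivative D) (at (t - t))"
    using assms by simp
  ultimately have "((\<lambda>\<tau>. F (q + t *\<^sub>R v + \<tau> *\<^sub>R v)) \<circ> (\<lambda>\<tau>. \<tau> - t) has_vector_derivative 1 *\<^sub>R D) (at t)"
    by (rule vector_diff_chain_at)
  moreover have "q + t *\<^sub>R v + (\<tau> - t) *\<^sub>R v = q + \<tau> *\<^sub>R v" for \<tau>
    by (simp add: algebra_simps)
  ultimately show ?thesis by (simp add: o_def)
qed

lemma param_density_has_derivative:
  assumes "transpose B = B" "invertible B"
  shows "(param_density B d has_derivative (\<lambda>b. param_grad B d a \<bullet> b)) (at a)"
proof -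
  have "((\<lambda>a. fst (snd d) \<bullet> a + snd (snd d) * impulse B a + fst d) has_derivative
      (\<lambda>b. fst (snd d) \<bullet> b + snd (snd d) * (b \<bullet> (matrix_inv B *v a)) + 0)) (at a)"
    by (intro has_derivative_add has_derivative_const has_derivative_mult_right
        bounded_linear_imp_has_derivative[OF bounded_linear_inner_right] impulse_has_derivative assms)
  then show ?thesis
    by (simp add: param_density_def[abs_def] param_grad_def inner_add_left inner_add_right inner_commute)
qed

lemma smooth_on_param_density: "smooth_on UNIV (param_density B d)"
  unfolding param_density_def[abs_def]
  by (intro smooth_on_add smooth_on_mult smooth_on_const smooth_on_impulse open_UNIV
      smooth_on_linear bounded_linear_inner_right)

lemma energy_param_add:
  "energy H B (snd (snd (p + t *\<^sub>R d))) z + fst (snd (p + t *\<^sub>R d)) \<bullet> fst z + fst (p + t *\<^sub>R d) =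
   energy H B (snd (snd p)) z + fst (snd p) \<bullet> fst z + fst p + t * param_density B d (fst z)"
  by (simp add: energy_def param_density_def inner_add_left algebra_simps)

context profile_family
begin

abbreviation energy_at :: "'n param \<Rightarrow> (real^'n) \<times> real \<Rightarrow> real" where
  "energy_at p \<equiv> energy H B (snd (snd p))"

definition action_density :: "'n param \<Rightarrow> real \<Rightarrow> real" where
  "action_density p x = energy_at p (jet k (U p) x) + fst (snd p) \<bullet> U p x + fst p"

lemma action_density_smooth: "p \<in> \<Omega> \<Longrightarrow> smooth_on UNIV (action_density p)"
  unfolding action_density_def[abs_def]
  by (intro smooth_on_add smooth_on_const smooth_on_inner U_slice_smooth open_UNIV
      smooth_on_compose[OF open_UNIV open_UNIV _ energy_smooth] smooth_perD(1)[OF smooth_per_jet[OF U_smooth_per]]) auto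

lemma Theta_eq_integral:
  assumes p: "p \<in> \<Omega>"
  shows "Theta k H B U \<Xi> p = integral {0..\<Xi> p} (action_density p)"
proof -
  have "ddx (\<lambda>y. U p y $ k) x = ddx (U p) x $ k" for x
    by (intro ddx_eqI bounded_linear.has_vector_derivative[OF bounded_linear_vec_nth]
        smooth_on_has_vector_derivative[OF U_slice_smooth[OF p]] UNIV_I)
  then have "Theta k H B U \<Xi> p = (LINT x:{0..\<Xi> p}|lborel. action_density p x)"
    by (cases p) (simp add: Theta_def action_density_def energy_def jet_def)
  then show ?thesis
    using set_integral_eq_integral[OF continuous_on_subset[OF smooth_on_imp_continuous_on[OF action_density_smooth[OF p]]], of 0 "\<Xi> p"]
    by simp
qed

text \<open>
  Where \<open>v_x = 0\<close> the Legendre transform of the Lagrangian reduces to minus the Lagrangian, which is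
  therefore \<open>- \<mu>\<close>.
\<close>
lemma action_density_end: assumes p: "p \<in> \<Omega>" shows "action_density p (\<Xi> p) = 0"
proof -
  let ?L = "\<lambda>z. energy_at p z + fst (snd p) \<bullet> fst z"
  have "smooth_on UNIV ?L"
    by (intro smooth_on_add energy_smooth open_UNIV smooth_on_inner smooth_on_const smooth_on_linear bounded_linear_fst)
  from legendre_density[OF this, of k "U p" "\<Xi> p"] profile_L[of "fst p" "fst (snd p)" "snd (snd p)" "\<Xi> p"] p vx_end[OF p]
  show ?thesis by (simp add: lagrangian_eq_density action_density_def jet_def)
qed

text \<open>
  The boundary term in the first variation of the action.
\<close>
definition boundary_flux :: "'n param \<Rightarrow> 'n param \<Rightarrow> real \<Rightarrow> real" where
  "boundary_flux d p y = vary U d p y $ k * dirderiv (energy_at p) (0, 1) (jet k (U p) y)"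

lemma boundary_flux_smooth: "p \<in> \<Omega> \<Longrightarrow> smooth_on UNIV (boundary_flux d p)"
  unfolding boundary_flux_def[abs_def]
  by (intro smooth_on_mult smooth_on_linear_compose[OF bounded_linear_vec_nth] vary_smooth open_UNIV
      smooth_on_compose[OF open_UNIV open_UNIV _ smooth_on_dirderiv[OF energy_smooth]]
      smooth_on_jet U_slice_smooth) auto

text \<open>
  Since \<open>v_x\<close> vanishes at the ends of the period, \<open>vary_shift\<close> shows that the component \<open>k\<close> of the variation,
  unlike the variation itself, takes the same value at both ends.
\<close>
lemma integral_boundary_flux:
  assumes p: "p \<in> \<Omega>"
  shows "integral {0..\<Xi> p} (ddx (boundary_flux d p)) = 0"
proof -
  have "(ddx (boundary_flux d p) has_integral boundary_flux d p (\<Xi> p) - boundary_flux d p 0) {0..\<Xi> p}"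
    using Xi_pos[OF p] has_vector_derivative_at_within[OF smooth_on_has_vector_derivative[OF boundary_flux_smooth[OF p]]]
    by (intro fundamental_theorem_of_calculus) auto
  moreover have "vary U d p (\<Xi> p) $ k = vary U d p 0 $ k"
    using vary_shift[OF p, of d 0] vx_end[OF p] by simp
  moreover have "jet k (U p) (\<Xi> p) = jet k (U p) 0"
    using smooth_perD(2)[OF smooth_per_jet[OF U_smooth_per[OF p]], of k 0] by simp
  ultimately show ?thesis by (auto simp: boundary_flux_def dest: integral_unique)
qed

lemma line_neighbourhood:
  assumes "p \<in> \<Omega>"
  obtains e :: real where "e > 0" "\<And>t. \<bar>t\<bar> < e \<Longrightarrow> p + t *\<^sub>R d \<in> \<Omega>"
proof -
  obtain e :: real where "e > 0" "\<And>s t. \<bar>s\<bar> < e \<Longrightarrow> \<bar>t\<bar> < e \<Longrightarrow> p + s *\<^sub>R d + t *\<^sub>R d \<in> \<Omega>"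
    using open_two_parameter_neighbourhood[OF Omega_open assms, of d d] by metis
  from this(1) this(2)[of 0] show thesis by (intro that[of e]) auto
qed

text \<open>
  The form in which \<open>integral_moving_endpoint_derivative\<close> is used: the integrand and the period both move
  along the line \<open>p + t d\<close> of parameters.
\<close>
lemma integral_line_derivative:
  fixes f :: "real \<Rightarrow> real \<Rightarrow> real"
  assumes p: "p \<in> \<Omega>"
    and f: "smooth_on ({t. p + t *\<^sub>R d \<in> \<Omega>} \<times> UNIV) (\<lambda>(t, x). f t x)"
    and f': "\<And>x. ((\<lambda>t. f t x) has_vector_derivative g x) (at 0)"
  shows "((\<lambda>t. integral {0..\<Xi> (p + t *\<^sub>R d)} (f t)) has_vector_derivative
    dirderiv \<Xi> d p * f 0 (\<Xi> p) + integral {0..\<Xi> p} g) (at 0)"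
proof -
  obtain e where e: "e > 0" "\<And>t. \<bar>t\<bar> < e \<Longrightarrow> p + t *\<^sub>R d \<in> \<Omega>"
    using line_neighbourhood[OF p] by metis
  let ?f = "\<lambda>(t, x). f t x"
  have sub: "{-e<..<e} \<times> (UNIV :: real set) \<subseteq> {t. p + t *\<^sub>R d \<in> \<Omega>} \<times> UNIV"
    using e(2) by (auto simp: abs_less_iff)
  have "((\<lambda>t. integral {0..\<Xi> (p + t *\<^sub>R d)} (f t)) has_vector_derivative
      dirderiv \<Xi> d p * f 0 (\<Xi> (p + 0 *\<^sub>R d)) + integral {0..\<Xi> (p + 0 *\<^sub>R d)} (\<lambda>x. dirderiv ?f (1, 0) (0, x))) (at 0)"
  proof (rule integral_moving_endpoint_derivative[OF e(1), where f' = "\<lambda>t x. dirderiv ?f (1, 0) (t, x)"])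
    show "((\<lambda>t. f t x) has_vector_derivative dirderiv ?f (1, 0) (t, x)) (at t)" if "\<bar>t\<bar> < e" for t x
      using smooth_on_slice_fst[OF f, of t x] e(2)[OF that] by simp
    show "continuous_on ({-e<..<e} \<times> UNIV) (\<lambda>(t, x). f t x)"
      by (rule continuous_on_subset[OF smooth_on_imp_continuous_on[OF f] sub])
    show "continuous_on ({-e<..<e} \<times> UNIV) (\<lambda>(t, x). dirderiv ?f (1, 0) (t, x))"
      using continuous_on_subset[OF smooth_on_imp_continuous_on[OF smooth_on_dirderiv[OF f]] sub]
      by (simp add: case_prod_unfold)
    show "((\<lambda>t. \<Xi> (p + t *\<^sub>R d)) has_vector_derivative dirderiv \<Xi> d p) (at 0)"
      using Xi_line[of p 0 d] p by simp
    show "0 < \<Xi> (p + 0 *\<^sub>R d)" using Xi_pos[OF p] by simp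
  qed
  moreover have "dirderiv ?f (1, 0) (0, x) = g x" for x
    using smooth_on_slice_fst[OF f, of 0 x] p by (intro vector_derivative_unique_at[OF _ f'[of x]]) simp
  ultimately show ?thesis by simp
qed

lemma line_U_smooth: "smooth_on ({t. p + t *\<^sub>R d \<in> \<Omega>} \<times> UNIV) (\<lambda>(t, x). U (p + t *\<^sub>R d) x)"
  using line_smooth[OF U_smooth, of p d] by simp

lemma open_line_domain: "open ({t. p + t *\<^sub>R d \<in> \<Omega>} \<times> (UNIV :: real set))"
  using line_domain_open by (intro open_Times) auto

text \<open>
  There are four contributions. The moving endpoint gives nothing because the integrand vanishes there.
  The variation of the profile gives, through the Euler-Lagrange equation, minus \<open>lam \<bullet> V\<close> and a total
  derivative; the former cancels against the variation of \<open>lam \<bullet> U\<close>, the latter integrates to zero. What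
  remains is the explicit dependence on the parameters.
\<close>
lemma Theta_line_derivative:
  assumes p: "p \<in> \<Omega>"
  shows "((\<lambda>t. Theta k H B U \<Xi> (p + t *\<^sub>R d)) has_vector_derivative
    integral {0..\<Xi> p} (\<lambda>x. param_density B d (U p x))) (at 0)"
proof -
  define J where "J = {t. p + t *\<^sub>R d \<in> \<Omega>}"
  define V where "V = vary U d p"
  have J: "open J" "0 \<in> J" using line_domain_open p by (auto simp: J_def)
  note o = open_line_domain[of p d, folded J_def] and sU = line_U_smooth[of p d, folded J_def]
  define f where "f = (\<lambda>t x. energy_at p (jet k (U (p + t *\<^sub>R d)) x) + fst (snd p) \<bullet> U (p + t *\<^sub>R d) x + fst p
      + t * param_density B d (U (p + t *\<^sub>R d) x))"
  have f_action_density: "f t = action_density (p + t *\<^sub>R d)" for t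
    using energy_param_add[of H B p t d] by (auto simp: f_def action_density_def jet_def fun_eq_iff)
  have "smooth_on (J \<times> UNIV) (\<lambda>z. energy_at p ((\<lambda>(t, x). jet k (U (p + t *\<^sub>R d)) x) z)
      + fst (snd p) \<bullet> (\<lambda>(t, x). U (p + t *\<^sub>R d) x) z + fst p
      + fst z * param_density B d ((\<lambda>(t, x). U (p + t *\<^sub>R d) x) z))"
    by (intro smooth_on_add smooth_on_mult smooth_on_inner smooth_on_const sU o smooth_on_linear bounded_linear_fst
        smooth_on_compose[OF o open_UNIV _ energy_smooth smooth_on_jet_family[OF J(1) sU]]
        smooth_on_compose[OF o open_UNIV _ smooth_on_param_density sU]) auto
  then have sf: "smooth_on (J \<times> UNIV) (\<lambda>(t, x). f t x)"
    by (simp add: f_def case_prod_unfold)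
  define Q where "Q = boundary_flux d p"
  have f': "((\<lambda>t. f t x) has_vector_derivative ddx Q x + param_density B d (U p x)) (at 0)" for x
  proof -
    have U': "((\<lambda>t. U (p + t *\<^sub>R d) x) has_vector_derivative V x) (at 0)"
      using vary_has_vector_derivative[of p 0 d x] p by (simp add: V_def)
    have jet': "((\<lambda>t. jet k (U (p + t *\<^sub>R d)) x) has_vector_derivative jet k V x) (at 0)"
    proof -
      have "dirderiv (\<lambda>(t, x). jet k (U (p + t *\<^sub>R d)) x) (1, 0) (0, x) = jet k V x"
        using dirderiv_line[of p 0 d] p by (intro jet_family_derivative[OF J sU]) (simp add: V_def)
      then show ?thesis
        using smooth_on_slice_fst[OF smooth_on_jet_family[OF J(1) sU, of k], of 0 x] J by simp
    qed
    have "((\<lambda>t. energy_at p (jet k (U (p + t *\<^sub>R d)) x)) has_vector_derivative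
        dirderiv (energy_at p) (jet k V x) (jet k (U (p + 0 *\<^sub>R d)) x)) (at 0)"
      by (rule smooth_on_chain[OF energy_smooth UNIV_I jet'])
    moreover have "((\<lambda>t. fst (snd p) \<bullet> U (p + t *\<^sub>R d) x) has_vector_derivative fst (snd p) \<bullet> V x) (at 0)"
      by (rule bounded_linear.has_vector_derivative[OF bounded_linear_inner_right U'])
    moreover have "((\<lambda>t. t * param_density B d (U (p + t *\<^sub>R d) x)) has_vector_derivative
        0 * dirderiv (param_density B d) (V x) (U (p + 0 *\<^sub>R d) x) + 1 * param_density B d (U (p + 0 *\<^sub>R d) x)) (at 0)"
      by (intro has_vector_derivative_mult smooth_on_chain[OF smooth_on_param_density UNIV_I] U') 
         (auto intro!: derivative_eq_intros)
    ultimately have "((\<lambda>t. f t x) has_vector_derivative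
        dirderiv (energy_at p) (jet k V x) (jet k (U (p + 0 *\<^sub>R d)) x) + fst (snd p) \<bullet> V x + 0
        + (0 * dirderiv (param_density B d) (V x) (U (p + 0 *\<^sub>R d) x) + 1 * param_density B d (U (p + 0 *\<^sub>R d) x))) (at 0)"
      unfolding f_def by (intro has_vector_derivative_add has_vector_derivative_const)
    moreover have "dirderiv (energy_at p) (jet k V x) (jet k (U p) x) + fst (snd p) \<bullet> V x = ddx Q x"
    proof -
      have "dirderiv (energy_at p) (jet k V x) (jet k (U p) x) =
          V x \<bullet> var_deriv (density k (energy_at p)) (U p) x + ddx Q x"
        unfolding Q_def V_def boundary_flux_def[abs_def]
        by (rule first_variation_inner[OF energy_smooth U_slice_smooth[OF p] vary_smooth[OF p]])
      moreover have "var_deriv (density k (energy_at p)) (U p) x = - fst (snd p)"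
        using profile_E'[OF p, of x] by (simp add: eq_neg_iff_add_eq_0)
      ultimately show ?thesis by (simp add: inner_commute)
    qed
    ultimately show ?thesis by simp
  qed
  have "((\<lambda>t. integral {0..\<Xi> (p + t *\<^sub>R d)} (f t)) has_vector_derivative
      dirderiv \<Xi> d p * f 0 (\<Xi> p) + integral {0..\<Xi> p} (\<lambda>x. ddx Q x + param_density B d (U p x))) (at 0)"
    by (rule integral_line_derivative[OF p sf[unfolded J_def] f'])
  moreover have "f 0 (\<Xi> p) = 0" using action_density_end[OF p] by (simp add: f_action_density)
  moreover have "integral {0..\<Xi> p} (\<lambda>x. ddx Q x + param_density B d (U p x)) =
      integral {0..\<Xi> p} (\<lambda>x. param_density B d (U p x))"
  proof -
    have "continuous_on {0..\<Xi> p} (ddx Q)"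
      using continuous_on_subset[OF smooth_on_imp_continuous_on[OF smooth_on_ddx[OF open_UNIV boundary_flux_smooth[OF p]]]]
      by (simp add: Q_def)
    moreover have "continuous_on {0..\<Xi> p} (\<lambda>x. param_density B d (U p x))"
      by (rule continuous_on_subset[OF smooth_on_imp_continuous_on[OF
            smooth_on_compose[OF open_UNIV open_UNIV _ smooth_on_param_density U_slice_smooth[OF p]]]]) auto
    ultimately have "integral {0..\<Xi> p} (\<lambda>x. ddx Q x + param_density B d (U p x)) =
        integral {0..\<Xi> p} (ddx Q) + integral {0..\<Xi> p} (\<lambda>x. param_density B d (U p x))"
      by (intro Henstock_Kurzweil_Integration.integral_add integrable_continuous_interval)
    then show ?thesis using integral_boundary_flux[OF p, of d] by (simp add: Q_def)
  qed
  ultimately have "((\<lambda>t. integral {0..\<Xi> (p + t *\<^sub>R d)} (f t)) has_vector_derivative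
      integral {0..\<Xi> p} (\<lambda>x. param_density B d (U p x))) (at 0)"
    by simp
  then show ?thesis
    by (rule has_vector_derivative_transform_within_open[OF _ J]) (simp add: f_action_density Theta_eq_integral J_def)
qed

text \<open>
  The derivative of the action in the direction \<open>d\<close>, written as an integral: the mean of a component of \<open>U\<close>,
  the impulse, or the period.
\<close>
definition charge :: "'n param \<Rightarrow> 'n param \<Rightarrow> real" where
  "charge d p = integral {0..\<Xi> p} (\<lambda>x. param_density B d (U p x))"

lemma pderiv_Theta: "p \<in> \<Omega> \<Longrightarrow> pderiv_along d (Theta k H B U \<Xi>) p = charge d p"
  unfolding pderiv_along_def charge_def using Theta_line_derivative[of p d]
  by (intro DERIV_imp_deriv) (simp add: has_real_derivative_iff_has_vector_derivative)

lemma charge_line_derivative: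
  assumes p: "p \<in> \<Omega>"
  shows "((\<lambda>t. charge d (p + t *\<^sub>R d')) has_vector_derivative
    dirderiv \<Xi> d' p * param_density B d (U p (\<Xi> p))
    + integral {0..\<Xi> p} (\<lambda>x. param_grad B d (U p x) \<bullet> vary U d' p x)) (at 0)"
proof -
  have "((\<lambda>t. param_density B d (U (p + t *\<^sub>R d') x)) has_vector_derivative
      param_grad B d (U p x) \<bullet> vary U d' p x) (at 0)" for x
  proof -
    have "((\<lambda>t. U (p + t *\<^sub>R d') x) has_vector_derivative vary U d' p x) (at 0)"
      using vary_has_vector_derivative[of p 0 d' x] p by simp
    from has_derivative_compose[OF this[unfolded has_vector_derivative_def]
        param_density_has_derivative[OF B_symmetric B_nonsingular, of d]]
    show ?thesis by (simp add: has_vector_derivative_def)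
  qed
  moreover have "smooth_on ({t. p + t *\<^sub>R d' \<in> \<Omega>} \<times> UNIV) (\<lambda>(t, x). param_density B d (U (p + t *\<^sub>R d') x))"
    using smooth_on_compose[OF open_line_domain open_UNIV _ smooth_on_param_density line_U_smooth, of p d' B d]
    by (simp add: case_prod_unfold)
  ultimately have "((\<lambda>t. integral {0..\<Xi> (p + t *\<^sub>R d')} (\<lambda>x. param_density B d (U (p + t *\<^sub>R d') x))) has_vector_derivative
      dirderiv \<Xi> d' p * param_density B d (U (p + 0 *\<^sub>R d') (\<Xi> p))
      + integral {0..\<Xi> p} (\<lambda>x. param_grad B d (U p x) \<bullet> vary U d' p x)) (at 0)"
    by (intro integral_line_derivative[OF p])
  then show ?thesis by (simp add: charge_def)
qed

lemma charge_dir_mu: "p \<in> \<Omega> \<Longrightarrow> charge dir_mu p = \<Xi> p"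
  using Xi_pos[of p] by (simp add: charge_def param_density_def dir_mu_def)

text \<open>
  Equality of the mixed derivatives of the action in the directions \<open>d\<close> and \<open>\<mu>\<close>, the derivative in the
  direction \<open>\<mu>\<close> being the period.
\<close>
lemma charge_mu_derivative:
  assumes p: "p \<in> \<Omega>"
  shows "((\<lambda>t. charge d (p + t *\<^sub>R dir_mu)) has_vector_derivative dirderiv \<Xi> d p) (at 0)"
proof -
  let ?q = "\<lambda>s t. p + s *\<^sub>R d + t *\<^sub>R dir_mu"
  obtain e where e: "e > 0" and dom: "\<And>s t. \<bar>s\<bar> < e \<Longrightarrow> \<bar>t\<bar> < e \<Longrightarrow> ?q s t \<in> \<Omega>"
    using open_two_parameter_neighbourhood[OF Omega_open p] by metis
  have swap: "?q s t = p + t *\<^sub>R dir_mu + s *\<^sub>R d" for s t by (simp add: algebra_simps)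
  have cont: "continuous_on ({-e<..<e} \<times> {-e<..<e}) (\<lambda>(s, t). F (?q s t))" if "smooth_on \<Omega> F" for F :: "'n param \<Rightarrow> real"
    unfolding case_prod_unfold
    by (rule continuous_on_compose2[OF smooth_on_imp_continuous_on[OF that]])
       (auto intro!: continuous_intros dom)
  have "((\<lambda>t. charge d (p + t *\<^sub>R dir_mu)) has_vector_derivative dirderiv \<Xi> d (?q 0 0)) (at 0)"
  proof (rule mixed_partial_derivatives[OF e, where g = "\<lambda>s t. Theta k H B U \<Xi> (?q s t)"
        and h = "\<lambda>s t. \<Xi> (?q s t)" and k = "\<lambda>s t. dirderiv \<Xi> d (?q s t)"])
    fix s t :: real assume st: "\<bar>s\<bar> < e" "\<bar>t\<bar> < e"
    show "((\<lambda>t. Theta k H B U \<Xi> (?q s t)) has_vector_derivative \<Xi> (?q s t)) (at t)"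
      using Theta_line_derivative[OF dom[OF st], of dir_mu] charge_dir_mu[OF dom[OF st]]
      by (intro has_vector_derivative_line_shift[where F = "Theta k H B U \<Xi>" and q = "p + s *\<^sub>R d"])
         (simp add: charge_def)
    show "((\<lambda>s. \<Xi> (?q s t)) has_vector_derivative dirderiv \<Xi> d (?q s t)) (at s)"
      using dom[OF st] unfolding swap by (rule Xi_line)
  next
    fix t :: real assume t: "\<bar>t\<bar> < e"
    have "p + t *\<^sub>R dir_mu \<in> \<Omega>" using dom[of 0 t] e t by simp
    then show "((\<lambda>s. Theta k H B U \<Xi> (?q s t)) has_vector_derivative charge d (p + t *\<^sub>R dir_mu)) (at 0)"
      unfolding swap charge_def by (rule Theta_line_derivative)
  qed (intro cont Xi_smooth smooth_on_dirderiv)+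
  then show ?thesis by simp
qed

text \<open>
  The endpoint value \<open>g\<close> enters both the second derivative of the action and, by \<open>charge_mu_derivative\<close>, the
  derivative of the period. The rank one correction in \<open>C\<close> eliminates it, and the same correction turns
  \<open>vary\<close> into \<open>periodic_variation\<close>.
\<close>
lemma C_matrix_entry:
  assumes p: "p \<in> \<Omega>"
  shows "C_matrix (Theta k H B U \<Xi>) \<Xi> p $ a $ b =
    integral {0..\<Xi> p} (\<lambda>x. param_grad B (dir_check b) (U p x) \<bullet> periodic_variation (dir_check a) p x)"
proof -
  let ?a = "dir_check a" and ?b = "dir_check b"
  define I where "I = (\<lambda>d. integral {0..\<Xi> p} (\<lambda>x. param_grad B ?b (U p x) \<bullet> vary U d p x))"
  define g where "g = param_density B ?b (U p (\<Xi> p))"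
  have "((\<lambda>t. pderiv_along ?b (Theta k H B U \<Xi>) (p + t *\<^sub>R ?a)) has_vector_derivative dirderiv \<Xi> ?a p * g + I ?a) (at 0)"
  proof (rule has_vector_derivative_transform_within_open[OF _ line_domain_open[of p ?a]])
    show "((\<lambda>t. charge ?b (p + t *\<^sub>R ?a)) has_vector_derivative dirderiv \<Xi> ?a p * g + I ?a) (at 0)"
      using charge_line_derivative[OF p, of ?b ?a] by (simp add: g_def I_def)
  qed (use p pderiv_Theta in auto)
  then have 1: "pderiv_along ?a (pderiv_along ?b (Theta k H B U \<Xi>)) p = dirderiv \<Xi> ?a p * g + I ?a"
    unfolding pderiv_along_def[of ?a]
    by (intro DERIV_imp_deriv) (simp add: has_real_derivative_iff_has_vector_derivative)
  have 2: "dirderiv \<Xi> dir_mu p * g + I dir_mu = dirderiv \<Xi> ?b p"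
    using vector_derivative_unique_at[OF charge_line_derivative[OF p, of ?b dir_mu] charge_mu_derivative[OF p, of ?b]]
    by (simp add: g_def I_def)
  have mu: "dirderiv \<Xi> dir_mu p \<noteq> 0" using Xi_mu_nonzero[OF p] pderiv_Xi[OF p] by simp
  have cont: "continuous_on {0..\<Xi> p} (\<lambda>x. param_grad B ?b (U p x) \<bullet> vary U d p x)" for d
    unfolding param_grad_def
    by (intro continuous_intros bounded_linear.continuous_on[OF matrix_vector_mul_bounded_linear]
        continuous_on_subset[OF smooth_on_imp_continuous_on[OF U_slice_smooth[OF p]]]
        continuous_on_subset[OF smooth_on_imp_continuous_on[OF vary_smooth[OF p]]]) auto
  define r where "r = dirderiv \<Xi> ?a p / dirderiv \<Xi> dir_mu p"
  have "integral {0..\<Xi> p} (\<lambda>x. param_grad B ?b (U p x) \<bullet> periodic_variation ?a p x) =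
      integral {0..\<Xi> p} (\<lambda>x. param_grad B ?b (U p x) \<bullet> vary U ?a p x - r * (param_grad B ?b (U p x) \<bullet> vary U dir_mu p x))"
    by (simp add: periodic_variation_def inner_diff_right pderiv_Xi[OF p] r_def)
  also have "\<dots> = I ?a - r * I dir_mu"
    unfolding I_def
    by (subst Henstock_Kurzweil_Integration.integral_diff)
       (auto intro!: integrable_continuous_interval continuous_intros cont)
  also have "\<dots> = C_matrix (Theta k H B U \<Xi>) \<Xi> p $ a $ b"
    using 2[symmetric] mu by (simp add: C_matrix_def 1 pderiv_Xi[OF p] r_def field_simps)
  finally show ?thesis by simp
qed

end

section \<open>The index formula\<close>

text \<open>
  The linear combination of the directions \<open>dir_check a\<close> with coefficients \<open>x $ a\<close>.
\<close>
definition check_combination :: "real^('n option) \<Rightarrow> 'n::finite param" where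
  "check_combination x = (0, (\<chi> \<alpha>. x $ Some \<alpha>), x $ None)"

lemma linear_check_combination: "linear check_combination"
  by (rule linearI) (auto simp: check_combination_def vec_eq_iff)

lemma check_combination_axis: "check_combination (axis a 1) = dir_check a"
  by (cases a) (auto simp: check_combination_def dir_check_def axis_def vec_eq_iff)

lemma linear_param_grad: "linear (\<lambda>d. param_grad B d a)"
  by (rule linearI) (auto simp: param_grad_def algebra_simps)

text \<open>
  The \<open>N\<close> components of the mean value and the product with \<open>B\<^sup>-\<^sup>1 u\<close> are the values of a linear functional
  of \<open>x\<close> on the axes.
\<close>
lemma tangent_C_iff:
  fixes u :: "real \<Rightarrow> real^'n::finite"
  assumes V: "V \<in> L2_per T" and u: "u \<in> smooth_per T"
  shows "V \<in> tangent_C k T B u \<longleftrightarrow> (\<forall>x. L2_inner T V (\<lambda>y. param_grad B (check_combination x) (u y)) = 0)"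
proof -
  have Bu: "(\<lambda>y. matrix_inv B *v u y) \<in> L2_per T"
    using smooth_per_linear[OF matrix_vector_mul_bounded_linear u] by (rule smooth_per_subset_L2_per)
  have eq: "L2_inner T V (\<lambda>y. param_grad B (check_combination x) (u y)) =
      (\<chi> \<alpha>. x $ Some \<alpha>) \<bullet> (LINT y:{0..T}|lborel. V y) + x $ None * (LINT y:{0..T}|lborel. V y \<bullet> (matrix_inv B *v u y))" for x
  proof -
    let ?l = "(\<chi> \<alpha>. x $ Some \<alpha>) :: real^'n"
    have "L2_inner T V (\<lambda>y. param_grad B (check_combination x) (u y)) =
        L2_inner T V (\<lambda>y. ?l) + x $ None * L2_inner T V (\<lambda>y. matrix_inv B *v u y)"
      unfolding param_grad_def check_combination_def fst_conv snd_conv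
      by (rule L2_inner_linear_right[OF smooth_per_subset_L2_per[OF smooth_per_const] Bu V])
    moreover have "L2_inner T V (\<lambda>y. ?l) = ?l \<bullet> (LINT y:{0..T}|lborel. V y)"
      using L2_per_integrable[OF V]
      by (simp add: L2_inner_def set_lebesgue_integral_def set_integrable_def inner_commute[of _ ?l] flip: integral_inner_right)
    ultimately show ?thesis by (simp add: L2_inner_def)
  qed
  show ?thesis
  proof
    assume "V \<in> tangent_C k T B u"
    then show "\<forall>x. L2_inner T V (\<lambda>y. param_grad B (check_combination x) (u y)) = 0"
      unfolding eq by (simp add: tangent_C_def)
  next
    assume all: "\<forall>x. L2_inner T V (\<lambda>y. param_grad B (check_combination x) (u y)) = 0"
    have "(LINT y:{0..T}|lborel. V y \<bullet> (matrix_inv B *v u y)) = 0"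
      using all[unfolded eq, rule_format, of "axis None 1"] by (simp add: axis_def zero_vec_def[symmetric])
    moreover have "(LINT y:{0..T}|lborel. V y) $ \<alpha> = 0" for \<alpha>
    proof -
      have "(\<chi> \<beta>. axis (Some \<alpha>) (1::real) $ Some \<beta>) = axis \<alpha> 1"
        by (auto simp: axis_def vec_eq_iff)
      then show ?thesis
        using all[unfolded eq, rule_format, of "axis (Some \<alpha>) 1"] 
        by (simp add: inner_axis' axis_nth_eq)
    qed
    ultimately show "V \<in> tangent_C k T B u"
      using V by (simp add: tangent_C_def HH_0_eq_L2_per vec_eq_iff)
  qed
qed

context profile_family
begin

lemma periodic_variation_linear:
  assumes p: "p \<in> \<Omega>"
  shows "linear (\<lambda>d. periodic_variation d p)"
proof -
  have v: "linear (\<lambda>d. vary U d p x)" for x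
  proof -
    have "linear (\<lambda>v. dirderiv (\<lambda>(p, x). U p x) v (p, x))"
      using p by (intro dirderiv_linear[OF U_smooth]) simp
    from linear_compose[OF bounded_linear.linear[OF bounded_linear_Pair[OF bounded_linear_ident bounded_linear_zero]] this]
    show ?thesis by (simp add: o_def vary_def)
  qed
  have \<xi>: "linear (\<lambda>d. pderiv_along d \<Xi> p)"
    using dirderiv_linear[OF Xi_smooth p] by (simp add: pderiv_Xi[OF p])
  show ?thesis
  proof (rule linearI)
    show "periodic_variation (d + d') p = periodic_variation d p + periodic_variation d' p" for d d'
      by (simp add: fun_eq_iff periodic_variation_def linear_add[OF v] linear_add[OF \<xi>] add_divide_distrib algebra_simps)
    show "periodic_variation (r *\<^sub>R d) p = r *\<^sub>R periodic_variation d p" for r d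
      by (simp add: fun_eq_iff scaleR_fun_def periodic_variation_def linear_scale[OF v] linear_scale[OF \<xi>] algebra_simps)
  qed
qed

text \<open>
  The abstract decomposition is applied to \<open>\<Phi> x\<close>, the periodic variation in the direction
  \<open>check_combination x\<close>, and to the matrix \<open>M = - C\<close>. As \<open>A (\<Phi> x)\<close> is minus a combination of the functions
  that define the tangent space, orthogonality holds by definition of the tangent space. The form of \<open>A\<close> on
  the range of \<open>\<Phi>\<close> is that of \<open>M\<close> by \<open>C_matrix_entry\<close>; its symmetry comes from that of \<open>A\<close>. Nonsingularity
  of \<open>M\<close> gives directness and, solving \<open>M *v x = v\<close>, the component of an element in the range of \<open>\<Phi>\<close>.
\<close>
lemma index_formula:
  assumes p: "p \<in> \<Omega>" and C: "invertible (C_matrix (Theta k H B U \<Xi>) \<Xi> p)"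
  defines "T \<equiv> \<Xi> p" and "F \<equiv> HcQ k H B (snd (snd p))" and "M \<equiv> - C_matrix (Theta k H B U \<Xi>) \<Xi> p"
  defines "D \<equiv> Hess_domain k T F (U p)" and "q \<equiv> \<lambda>V. L2_inner T V (Hess_op k T F (U p) V)"
  shows "neg_signature D q = neg_signature (D \<inter> tangent_C k T B (U p)) q + enat (neg_eigenvalue_count M)"
proof -
  let ?A = "Hess F (U p)"
  note u = U_smooth_per[OF p, folded T_def]
  have T: "T > 0" using Xi_pos[OF p] by (simp add: T_def)
  have A: "?A V = second_variation k (energy_at p) (U p) V" if "V \<in> smooth_per T" for V
    unfolding F_def HcQ_eq_density
    by (rule Hess_eq_second_variation[OF energy_smooth smooth_perD(1)[OF u] smooth_perD(1)[OF that]])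
  have A_smooth: "?A V \<in> smooth_per T" if "V \<in> smooth_per T" for V
    unfolding A[OF that] by (rule smooth_per_second_variation[OF energy_smooth u that])
  have A_sym: "L2_inner T (?A V) W = L2_inner T V (?A W)" if "V \<in> smooth_per T" "W \<in> smooth_per T" for V W
    unfolding A[OF that(1)] A[OF that(2)] by (rule second_variation_symmetric[OF energy_smooth T u that])
  define \<Phi> where "\<Phi> = (\<lambda>x. periodic_variation (check_combination x) p)"
  have \<Phi>_lin: "linear \<Phi>"
    using linear_compose[OF linear_check_combination periodic_variation_linear[OF p]] by (simp add: \<Phi>_def o_def)
  have \<Phi>_smooth: "\<Phi> x \<in> smooth_per T" for x
    using periodic_variation_smooth_per[OF p] by (simp add: \<Phi>_def T_def)
  have A_\<Phi>: "?A (\<Phi> x) = (\<lambda>y. - param_grad B (check_combination x) (U p y))" for x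
    unfolding A[OF \<Phi>_smooth] using second_variation_periodic_variation[OF p] by (simp add: \<Phi>_def fun_eq_iff)
  have grad_smooth: "(\<lambda>y. param_grad B (check_combination x) (U p y)) \<in> smooth_per T" for x
    using smooth_per_linear[OF bounded_linear_minus[OF bounded_linear_ident] A_smooth[OF \<Phi>_smooth[of x]]] by (simp add: A_\<Phi>)
  have L2_A_\<Phi>: "L2_inner T V (?A (\<Phi> x)) = - L2_inner T V (\<lambda>y. param_grad B (check_combination x) (U p y))" for V x
    unfolding A_\<Phi> by (simp add: L2_inner_def set_lebesgue_integral_def)
  have A_\<Phi>_lin: "linear (\<lambda>x. L2_inner T V (?A (\<Phi> x)))" if V: "V \<in> L2_per T" for V
  proof -
    note g = smooth_per_subset_L2_per[OF grad_smooth]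
    have *: "L2_inner T V (\<lambda>y. param_grad B (check_combination (x + r *\<^sub>R z)) (U p y)) =
        L2_inner T V (\<lambda>y. param_grad B (check_combination x) (U p y)) + r * L2_inner T V (\<lambda>y. param_grad B (check_combination z) (U p y))" for x z r
      using L2_inner_linear_right[OF g g V, of x r z]
      by (simp add: linear_add[OF linear_check_combination] linear_scale[OF linear_check_combination]
          linear_add[OF linear_param_grad] linear_scale[OF linear_param_grad])
    have 0: "L2_inner T V (\<lambda>y. param_grad B (check_combination 0) (U p y)) = 0"
      using *[of 0 1 0] by simp
    show ?thesis
      unfolding L2_A_\<Phi>
      by (rule linearI) (use *[of _ 1] *[of 0] 0 in \<open>simp_all\<close>)
  qed
  have right: "L2_inner T V (?A (\<Phi> y)) = (\<Sum>b\<in>UNIV. y $ b * L2_inner T V (?A (\<Phi> (axis b 1))))"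
    if "V \<in> L2_per T" for V y
  proof -
    have "y = (\<Sum>b\<in>UNIV. y $ b *\<^sub>R axis b 1)"
      using basis_expansion[of y] by (simp add: scalar_mult_eq_scaleR)
    from arg_cong[OF this, of "\<lambda>y. L2_inner T V (?A (\<Phi> y))"] show ?thesis
      by (simp add: linear_sum[OF A_\<Phi>_lin[OF that]] linear_scale[OF A_\<Phi>_lin[OF that]])
  qed
  have form: "L2_inner T (\<Phi> x) (?A (\<Phi> y)) = x \<bullet> (M *v y)" for x y
  proof -
    have entry: "L2_inner T (\<Phi> (axis a 1)) (?A (\<Phi> (axis b 1))) = M $ a $ b" for a b
    proof -
      let ?f = "\<lambda>x. param_grad B (dir_check b) (U p x) \<bullet> periodic_variation (dir_check a) p x"
      have "(\<lambda>x. param_grad B (check_combination (axis b 1)) (U p x) \<bullet> \<Phi> (axis a 1) x) \<in> smooth_per T"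
        by (rule smooth_per_bilinear[OF bounded_bilinear_inner grad_smooth \<Phi>_smooth])
      then have "continuous_on {0..T} ?f"
        by (intro smooth_perD(3)) (simp add: check_combination_axis \<Phi>_def)
      then have "L2_inner T (\<Phi> (axis a 1)) (\<lambda>y. param_grad B (check_combination (axis b 1)) (U p y)) = integral {0..T} ?f"
        using set_integral_eq_integral[of 0 T ?f] by (simp add: L2_inner_def \<Phi>_def check_combination_axis inner_commute)
      then show ?thesis
        unfolding L2_A_\<Phi> by (simp add: M_def C_matrix_entry[OF p] T_def)
    qed
    \<comment> \<open>The form is expanded in its second argument only; its symmetry then gives the expansion in the first.\<close>
    have swap: "L2_inner T (\<Phi> x) (?A (\<Phi> y)) = L2_inner T (\<Phi> y) (?A (\<Phi> x))" for x y
      using A_sym[OF \<Phi>_smooth \<Phi>_smooth, of y x] by (simp add: L2_inner_commute)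
    note L2 = smooth_per_subset_L2_per[OF \<Phi>_smooth]
    have "L2_inner T (\<Phi> x) (?A (\<Phi> y)) = (\<Sum>b\<in>UNIV. y $ b * (\<Sum>a\<in>UNIV. x $ a * L2_inner T (\<Phi> (axis a 1)) (?A (\<Phi> (axis b 1)))))"
      unfolding right[OF L2, of x y] swap[of x "axis _ 1"] right[OF L2, of "axis _ 1" x]
      by (simp add: swap[of "axis _ 1" "axis _ 1"])
    also have "\<dots> = (\<Sum>b\<in>UNIV. \<Sum>a\<in>UNIV. x $ a * (M $ a $ b * y $ b))"
      by (simp add: entry sum_distrib_left mult_ac)
    also have "\<dots> = (\<Sum>a\<in>UNIV. \<Sum>b\<in>UNIV. x $ a * (M $ a $ b * y $ b))"
      by (rule sum.swap)
    also have "\<dots> = x \<bullet> (M *v y)"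
      by (simp add: inner_vec_def matrix_vector_mult_def sum_distrib_left)
    finally show ?thesis .
  qed
  have M_sym: "x \<bullet> (M *v y) = y \<bullet> (M *v x)" for x y
    using A_sym[OF \<Phi>_smooth \<Phi>_smooth, of y x] form by (simp add: L2_inner_commute)
  have M_transpose: "transpose M = M"
  proof -
    have "M $ a $ b = M $ b $ a" for a b
      using M_sym[of "axis a 1" "axis b 1"] by (simp add: inner_axis' matrix_vector_mult_basis column_def)
    then show ?thesis by (simp add: transpose_def vec_eq_iff)
  qed
  have M_surj: "\<exists>x. M *v x = v" and M_inj: "M *v x = 0 \<Longrightarrow> x = 0" for v x
  proof -
    let ?C = "C_matrix (Theta k H B U \<Xi>) \<Xi> p"
    note inv = matrix_inv_inverse[OF C]
    have neg: "M *v x = - (?C *v x)" for x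
      by (simp add: M_def matrix_vector_mult_def vec_eq_iff sum_negf)
    have "?C *v (matrix_inv ?C *v v) = v" for v
      by (simp add: matrix_vector_mul_assoc inv)
    then have "M *v (matrix_inv ?C *v (- v)) = v" by (simp add: neg)
    then show "\<exists>x. M *v x = v" by blast
    have "matrix_inv ?C *v (?C *v x) = x"
      by (simp add: matrix_vector_mul_assoc inv)
    then show "x = 0" if "M *v x = 0" using that by (simp add: neg)
  qed
  have D_L2: "V \<in> L2_per T" if "V \<in> D" for V using that Hess_domainD(1) by (simp add: D_def)
  have tangent: "V \<in> tangent_C k T B (U p) \<longleftrightarrow> (\<forall>x. L2_inner T V (?A (\<Phi> x)) = 0)" if "V \<in> L2_per T" for V
    unfolding tangent_C_iff[OF that u] L2_A_\<Phi> by simp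
  have D: "subspace D" unfolding D_def by (rule subspace_Hess_domain[OF A_smooth T])
  have \<Phi>D: "\<Phi> x \<in> D" for x
    unfolding D_def by (rule smooth_per_subset_Hess_domain[OF A_smooth A_sym \<Phi>_smooth T])
  show ?thesis
  proof (rule neg_signature_orthogonal_decomposition[OF D _ Int_lower1 \<Phi>_lin _ _ _ _ _ M_transpose])
    show "subspace (D \<inter> tangent_C k T B (U p))"
    proof (rule subspace_funI)
      show "(\<lambda>x. 0) \<in> D \<inter> tangent_C k T B (U p)"
        using subspace_0[OF D] tangent[OF smooth_per_subset_L2_per[OF smooth_per_const], of 0]
        by (simp add: zero_fun_def L2_inner_def)
      fix V W r assume VW: "V \<in> D \<inter> tangent_C k T B (U p)" "W \<in> D \<inter> tangent_C k T B (U p)"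
      then have L2: "V \<in> L2_per T" "W \<in> L2_per T" using D_L2 by auto
      have "V + r *\<^sub>R W \<in> D" using VW D by (simp add: subspace_add subspace_scale)
      moreover have "(\<lambda>x. V x + r *\<^sub>R W x) \<in> tangent_C k T B (U p)"
        using VW tangent[OF L2(1)] tangent[OF L2(2)]
        by (simp add: tangent[OF L2_per_add_scaleR[OF L2]]
            L2_inner_linear_left[OF L2 smooth_per_subset_L2_per[OF A_smooth[OF \<Phi>_smooth]]])
      ultimately show "(\<lambda>x. V x + r *\<^sub>R W x) \<in> D \<inter> tangent_C k T B (U p)"
        by (simp add: fun_linear_combination)
    qed
    show "range \<Phi> \<subseteq> D" using \<Phi>D by auto
    show "x = 0" if "\<Phi> x \<in> D \<inter> tangent_C k T B (U p)" for x
    proof -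
      have "L2_inner T (\<Phi> x) (?A (\<Phi> y)) = 0" for y
        using that tangent[OF smooth_per_subset_L2_per[OF \<Phi>_smooth], of x] by simp
      then have "y \<bullet> (M *v x) = 0" for y using M_sym[of y x] form[of x y] by simp
      from this[of "M *v x"] have "M *v x = 0" by simp
      then show ?thesis by (rule M_inj)
    qed
    show "\<exists>x. V - \<Phi> x \<in> D \<inter> tangent_C k T B (U p)" if V: "V \<in> D" for V
    proof -
      define v where "v = (\<chi> a. L2_inner T V (?A (\<Phi> (axis a 1))))"
      obtain x where x: "M *v x = v" using M_surj by blast
      note L2 = D_L2[OF V] smooth_per_subset_L2_per[OF \<Phi>_smooth[of x]]
      have "V - \<Phi> x \<in> D" by (rule subspace_diff[OF D V \<Phi>D])
      moreover have "V - \<Phi> x \<in> tangent_C k T B (U p)"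
      proof -
        have eq: "V - \<Phi> x = (\<lambda>y. V y + (- 1) *\<^sub>R \<Phi> x y)" by (simp add: fun_eq_iff)
        have "L2_inner T V (?A (\<Phi> y)) = y \<bullet> v" for y
          using right[OF L2(1), of y] by (simp add: inner_vec_def v_def)
        then show ?thesis
          unfolding eq tangent[OF L2_per_add_scaleR[OF L2]]
          using L2_inner_linear_left[OF L2 smooth_per_subset_L2_per[OF A_smooth[OF \<Phi>_smooth]], of "-1"] form M_sym x
          by simp
      qed
      ultimately show ?thesis by blast
    qed
    show "q (w + \<Phi> x) = q w + x \<bullet> (M *v x)" if w: "w \<in> D \<inter> tangent_C k T B (U p)" for w x
    proof -
      have "L2_inner T w (?A (\<Phi> x)) = 0" using w tangent[OF D_L2, of w] by simp
      then show ?thesis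
        using Hess_form_add_smooth[OF A_smooth A_sym T _ \<Phi>_smooth, of w k x] w
        by (simp add: q_def D_def form)
    qed
    show "q 0 = 0" by (simp add: q_def L2_inner_def set_lebesgue_integral_def)
  qed
qed

end

theorem theorem3:
  fixes k :: "'n::finite"
    and H :: "real^'n \<Rightarrow> real \<Rightarrow> real"
    and B :: "real^'n^'n"
    and \<Omega> :: "'n param set"
    and U :: "'n param \<Rightarrow> real \<Rightarrow> real^'n"
    and \<Xi> :: "'n param \<Rightarrow> real"
  assumes H_smooth: "smooth_on UNIV (\<lambda>(a, s). H a s)"
    and B_symmetric: "transpose B = B"
    and B_nonsingular: "invertible B"
    and Omega_open: "open \<Omega>"
    and Xi_smooth: "smooth_on \<Omega> \<Xi>"
    and Xi_pos: "\<forall>p\<in>\<Omega>. \<Xi> p > 0"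
    and U_smooth: "smooth_on (\<Omega> \<times> UNIV) (\<lambda>(p, x). U p x)"
    and U_periodic: "\<forall>p\<in>\<Omega>. \<forall>x. U p (x + \<Xi> p) = U p x"
    and profile_E: "\<forall>(\<mu>, lam, c)\<in>\<Omega>. \<forall>x.
          var_deriv (HcQ k H B c) (U (\<mu>, lam, c)) x + lam = 0"
    and profile_L: "\<forall>(\<mu>, lam, c)\<in>\<Omega>. \<forall>x.
          legendre (lagrangian k H B c lam) (U (\<mu>, lam, c)) x = \<mu>"
    and U_ends: "\<forall>p\<in>\<Omega>. U p 0 = U p (\<Xi> p)"
    and vx_ends: "\<forall>p\<in>\<Omega>. ddx (\<lambda>x. U p x $ k) 0 = 0 \<and> ddx (\<lambda>x. U p x $ k) (\<Xi> p) = 0"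
    and Xi_mu_nonzero: "\<forall>p\<in>\<Omega>. pderiv_along dir_mu \<Xi> p \<noteq> 0"
    and C_nonsingular: "\<forall>p\<in>\<Omega>. invertible (C_matrix (Theta k H B U \<Xi>) \<Xi> p)"
  shows "\<forall>(\<mu>, lam, c)\<in>\<Omega>.
      let p = (\<mu>, lam, c);
          F = HcQ k H B c;
          D = Hess_domain k (\<Xi> p) F (U p);
          q = (\<lambda>V. L2_inner (\<Xi> p) V (Hess_op k (\<Xi> p) F (U p) V))
      in neg_signature D q =
           neg_signature (D \<inter> tangent_C k (\<Xi> p) B (U p)) q
           + enat (neg_eigenvalue_count (- C_matrix (Theta k H B U \<Xi>) \<Xi> p))"
proof -
  interpret profile_family k H B \<Omega> U \<Xi>
  proof
    show "var_deriv (HcQ k H B c) (U (\<mu>, lam, c)) x + lam = 0" if "(\<mu>, lam, c) \<in> \<Omega>" for \<mu> lam c x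
      using profile_E that by blast
    show "legendre (lagrangian k H B c lam) (U (\<mu>, lam, c)) x = \<mu>" if "(\<mu>, lam, c) \<in> \<Omega>" for \<mu> lam c x
      using profile_L that by blast
  qed (use assms in auto)
  show ?thesis
  proof (clarify)
    fix \<mu> lam c assume p: "(\<mu>, lam, c) \<in> \<Omega>"
    from index_formula[OF p] C_nonsingular p
    show "let p = (\<mu>, lam, c);
          F = HcQ k H B c;
          D = Hess_domain k (\<Xi> p) F (U p);
          q = (\<lambda>V. L2_inner (\<Xi> p) V (Hess_op k (\<Xi> p) F (U p) V))
      in neg_signature D q =
           neg_signature (D \<inter> tangent_C k (\<Xi> p) B (U p)) q
           + enat (neg_eigenvalue_count (- C_matrix (Theta k H B U \<Xi>) \<Xi> p))"
      by (simp add: Let_def)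
  qed
qed

end
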